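(* Let $E=\{1,\dots,s\}$, let $\mathbf p=(p_{ij})_{i,j\in E}$ be a random transition matrix with rows $\mathbf p_1,\dots,\mathbf p_s$, let $\boldsymbol\alpha=(\alpha_{ij})_{i,j\in E}$ and $\boldsymbol\theta=(\theta_{ij})_{i,j\in E}$ be arrays of positive random parameters, and let $\mathbf t_{\mathbf q}=(t^{ij}_{q_{ij}})_{i,j\in E}$ be an array of positive (constant or random) hyperparameters. Let the observed data $(\mathbf j,\mathbf x,u_T)$ with $u_T>0$, together with the unobserved next state $j_{\tau+1}$, have, given $(\mathbf p,\boldsymbol\alpha,\boldsymbol\theta,\mathbf t_{\mathbf q})$, the full likelihood $$L(\mathbf j,\mathbf x,u_T,j_{\tau+1}\mid \mathbf p,\boldsymbol\alpha,\boldsymbol\theta)=\prod_{i,k\in E}p_{ik}^{N_{ik}}\cdot\prod_{i,k\in E}\left[\frac{\alpha_{ik}^{N_{ik}}}{\theta_{ik}^{\alpha_{ik}N_{ik}}}\Big(\prod_{\rho=1}^{N_{ik}}x_{ik}^{\rho}\Big)^{\alpha_{ik}-1}\exp\Big\{-\frac{1}{\theta_{ik}^{\alpha_{ik}}}\sum_{\rho=1}^{N_{ik}}(x_{ik}^{\rho})^{\alpha_{ik}}\Big\}\right]\cdot p_{j_\tau j_{\tau+1}}\exp\Big\{-\Big(\frac{u_T}{\theta_{j_\tau j_{\tau+1}}}\Big)^{\alpha_{j_\tau j_{\tau+1}}}\Big\}$$ (data notation is defined in the context). Let the prior on $(\mathbf p,\boldsymbol\alpha,\boldsymbol\theta,\mathbf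 t_{\mathbf q})$ be the following. (i) $\mathbf p$ is independent of $(\boldsymbol\alpha,\boldsymbol\theta,\mathbf t_{\mathbf q})$, and the rows of $\mathbf p$ are $s$ independent vectors, the $i$-th one having the Dirichlet distribution with parameter $\boldsymbol\gamma_i=(\gamma_{i1},\dots,\gamma_{is})$, $\gamma_{ij}>0$. (ii) Given the $\alpha_{ij}$'s and the $t^{ij}_{q_{ij}}$'s, the $\theta_{ij}$'s are independent with $\theta_{ij}\sim\mathcal{GIG}\big(m_{ij},\,b_{ij}(t^{ij}_{q_{ij}},\alpha_{ij}),\,\alpha_{ij}\big)$, where $$b_{ij}(t^{ij}_{q_{ij}},\alpha_{ij})=\big(t^{ij}_{q_{ij}}\big)^{\alpha_{ij}}\big[(1-q_{ij})^{-1/m_{ij}}-1\big]^{-1},\qquad q_{ij}\in(0,1),$$ and each $t^{ij}_{q_{ij}}$ is either a known positive constant or uniformly distributed over an interval $(t_1,t_2)$ with $0\le t_1<t_2<\infty$; the $t^{ij}_{q_{ij}}$'s are independent of each other and of $(\mathbf p,\boldsymbol\alpha)$. (iii) The $\alpha_{ij}$'s are independent, with prior densities $$\pi_{3,ij}(\alpha_{ij})\propto\alpha_{ij}^{m_{ij}-c_{ij}}(\alpha_{ij}-\alpha_{0,ij})^{c_{ij}-1}\exp\{-m_{ij}d_{ij}\alpha_{ij}\}\,\mathbf 1(\alpha_{ij}\in I_{ij}),$$ where $m_{ij}>0$, $c_{ij}>0$, $\alpha_{0,ij}>0$, $d_{ij}\ge 0$ are fixed constants, and $I_{ij}=(\alpha_{0,ij},\alpha_{1,ij})$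 with $\alpha_{0,ij}<\alpha_{1,ij}<\infty$ if $d_{ij}=0$, while $I_{ij}=(\alpha_{0,ij},\infty)$ if $d_{ij}>0$. Then, for all $i,j\in E$: (a) the conditional distribution of $\mathbf p_i$ given $\mathbf j,\mathbf x,u_T,j_{\tau+1},\mathbf p_{(-i)},\boldsymbol\alpha,\boldsymbol\theta,\mathbf t_{\mathbf q}$ is Dirichlet with parameter $\tilde{\mathbf N}_i+\boldsymbol\gamma_i$; (b) the conditional distribution of $\theta_{ij}^{\alpha_{ij}}$ given $\mathbf j,\mathbf x,u_T,j_{\tau+1},\mathbf p,\boldsymbol\alpha,\boldsymbol\theta_{(-ij)},\mathbf t_{\mathbf q}$ is inverse Gamma with shape $m_{ij}+N_{ij}$ and rate $b_{ij}(t^{ij}_{q_{ij}},\alpha_{ij})+\tilde M_{ij}(\alpha_{ij})$; (c) the conditional density of $\alpha_{ij}$ given $\mathbf j,\mathbf x,u_T,j_{\tau+1},\mathbf p,\boldsymbol\alpha_{(-ij)},\boldsymbol\theta,\mathbf t_{\mathbf q}$ is proportional to $$\alpha_{ij}^{N_{ij}+1+m_{ij}-c_{ij}}(\alpha_{ij}-\alpha_{0,ij})^{c_{ij}-1}\exp\left\{-\left(m_{ij}d_{ij}-\log\frac{\mathcal C_{ij}\,(t^{ij}_{q_{ij}})^{m_{ij}}}{\theta_{ij}^{N_{ij}+m_{ij}}}\right)\alpha_{ij}\right\}\exp\left\{-\frac{b_{ij}(t^{ij}_{q_{ij}},\alpha_{ij})+\tilde M_{ij}(\alpha_{ij})}{\theta_{ij}^{\alpha_{ij}}}\right\}\mathbf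 1(\alpha_{ij}\in I_{ij}),$$ and it is log-concave if $c_{ij}\ge 1$; (d) the conditional probability mass function of the unseen state $J_{\tau+1}$ given $\mathbf j,\mathbf x,u_T,\mathbf p,\boldsymbol\alpha,\boldsymbol\theta,\mathbf t_{\mathbf q}$ is, at $j\in E$, $$\frac{p_{j_\tau j}\exp\left\{-\left(\frac{u_T}{\theta_{j_\tau j}}\right)^{\alpha_{j_\tau j}}\right\}}{\sum_{k\in E}p_{j_\tau k}\exp\left\{-\left(\frac{u_T}{\theta_{j_\tau k}}\right)^{\alpha_{j_\tau k}}\right\}};$$ (e) if $t^{ij}_{q_{ij}}$ is uniformly distributed over $(t_1,t_2)$, then its conditional distribution given $\mathbf j,\mathbf x,u_T,\mathbf p,\boldsymbol\alpha,\boldsymbol\theta,\mathbf t_{\mathbf q(-ij)}$ is a generalized Gamma doubly truncated to $(t_1,t_2)$ with parameters $a=\theta_{ij}[(1-q_{ij})^{-1/m_{ij}}-1]^{1/\alpha_{ij}}$, $d=\alpha_{ij}m_{ij}+1$ and $p=\alpha_{ij}$, i.e. its conditional density is $$\pi\big(t^{ij}_{q_{ij}}\mid \mathbf j,\mathbf x,u_T,\mathbf p,\boldsymbol\alpha,\boldsymbol\theta,\mathbf t_{\mathbf q(-ij)}\big)\propto\frac{p/a^{d}}{\Gamma(d/p)}\big(t^{ij}_{q_{ij}}\big)^{d-1}\exp\left\{-\big(t^{ij}_{q_{ij}}/a\big)^{p}\right\}\mathbf 1(t_1<t^{ij}_{q_{ij}}<t_2).$$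
   Context: Data. A Markov renewal process on the finite state space $E=\{1,\dots,s\}$, started from a fixed state $j_0$, is observed over $[0,T]$. It changes state $\tau\ge 1$ times, at times $0<t_1^*<\dots<t_\tau^*\le T$ (with $t_0^*:=0$), visiting the states $j_0,j_1,\dots,j_\tau$; $x_n=t_n^*-t_{n-1}^*>0$ is the holding time in state $j_{n-1}$, and $u_T=T-t_\tau^*$ is the right-censored time spent in the last state $j_\tau$; it is assumed that $u_T>0$. The data are $(\mathbf j,\mathbf x,u_T)$ with $(\mathbf j,\mathbf x)=(j_n,x_n)_{n=1,\dots,\tau}$. Under the model, given the parameters, the transition from state $i$ to state $j$ has probability $p_{ij}$, and the holding time in $i$ before a transition to $j$ has the Weibull density with shape $\alpha_{ij}$ and scale $\theta_{ij}$, i.e. $\frac{\alpha_{ij}}{\theta_{ij}}\left(\frac{x}{\theta_{ij}}\right)^{\alpha_{ij}-1}\exp\{-(x/\theta_{ij})^{\alpha_{ij}}\}$, $x>0$. The variable $J_{\tau+1}$ (value $j_{\tau+1}\in E$) is the unobserved state following $j_\tau$. Statistics. The process visits the string $(i,j)$ when a visit to $i$ is followed by a visit to $j$. $N_{ij}$ is the number of observed visits to the string $(i,j)$ (among the $\tau$ observed transitions), and $x_{ij}^{\rho}$ is the time spent in $i$ at the $\rho$-th visit to the string $(i,j)$. Define $$\tilde N_{ij}=N_{ij}+\mathbf 1\big((j_\tau,j_{\tau+1})=(i,j)\big),\qquad \tilde{\mathbf N}_i=(\tilde N_{i1},\dots,\tilde N_{is}),$$ $$\tilde M_{ij}(\alpha_{ij})=\sum_{\rho=1}^{N_{ij}}(x_{ij}^{\rho})^{\alpha_{ij}}+u_T^{\alpha_{ij}}\,\mathbf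 1\big((j_\tau,j_{\tau+1})=(i,j)\big),\qquad \mathcal C_{ij}=\prod_{\rho=1}^{N_{ij}}x_{ij}^{\rho}$$ (empty sums are $0$, empty products are $1$). Notation. $\mathbf p_{(-i)}$ is $\mathbf p$ without its $i$-th row; $\boldsymbol\alpha_{(-ij)}$, $\boldsymbol\theta_{(-ij)}$, $\mathbf t_{\mathbf q(-ij)}$ are the arrays $\boldsymbol\alpha$, $\boldsymbol\theta$, $\mathbf t_{\mathbf q}$ without the $(i,j)$ entry. $\mathbf 1(\cdot)$ is the indicator function. Distributions. The Dirichlet distribution with parameter $(\gamma_{i1},\dots,\gamma_{is})$ has density proportional to $\prod_{j}p_{ij}^{\gamma_{ij}-1}$ on the simplex $\{p_{ij}\ge0,\ \sum_jp_{ij}=1\}$. For $m,b,\alpha>0$, $\theta\sim\mathcal{GIG}(m,b,\alpha)$ (generalized inverse Gamma) means that $\theta$ has density $\frac{\alpha b^m}{\Gamma(m)}\theta^{-(1+m\alpha)}\exp\{-b/\theta^{\alpha}\}$, $\theta>0$; equivalently $\theta^{-\alpha}$ has the Gamma distribution with shape $m$ and rate $b$. The inverse Gamma distribution with shape $m$ and rate $b$ is the law with density $\frac{b^m}{\Gamma(m)}y^{-m-1}e^{-b/y}$, $y>0$. The generalized Gamma distribution with parameters $a,d,p>0$ has density $\frac{p/a^d}{\Gamma(d/p)}t^{d-1}\exp\{-(t/a)^p\}$, $t>0$; "doubly truncated to $(t_1,t_2)$" means conditioned to lie in $(t_1,t_2)$. All conditional distributions are those determined by the joint law whose density is the product of the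 full likelihood $L$ and the prior. In (a)–(c) and (e), "proportional" means up to a factor not depending on the variable whose conditional law is described. In (e), the letters $a,d,p$ denote the generalized Gamma parameters and are unrelated to $d_{ij}$ and $\mathbf p$. *)

theory Defs
  imports "HOL-Probability.Probability"
begin

text \<open>
  \<open>cond_law M MX X MY Y K\<close>: the kernel \<open>K\<close> is a (regular version of the) conditional distribution
  of \<open>X\<close> given \<open>Y\<close> under the measure \<open>M\<close>, where \<open>X\<close> and \<open>Y\<close> take values in \<open>MX\<close> and \<open>MY\<close>.
  The measure \<open>M\<close> need not be normalised; conditional distributions do not change when \<open>M\<close> is
  rescaled. Sigma-finiteness of the law of \<open>Y\<close> makes the conditional probabilities almost surely
  unique. \<open>K y\<close> is required to be a probability measure for almost all \<open>y\<close> only, since explicit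
  formulas for \<open>K\<close> are meaningless off the support of \<open>Y\<close> (e.g. at negative parameter values).
\<close>

definition cond_law ::
  "'w measure \<Rightarrow> 'x measure \<Rightarrow> ('w \<Rightarrow> 'x) \<Rightarrow> 'y measure \<Rightarrow> ('w \<Rightarrow> 'y) \<Rightarrow> ('y \<Rightarrow> 'x measure) \<Rightarrow> bool"
where
  "cond_law M MX X MY Y K \<longleftrightarrow>
     X \<in> measurable M MX \<and> Y \<in> measurable M MY \<and> sigma_finite_measure (distr M MY Y) \<and>
     (\<forall>y\<in>space MY. sets (K y) = sets MX) \<and>
     (\<forall>A\<in>sets MX. (\<lambda>y. emeasure (K y) A) \<in> borel_measurable MY) \<and>
     (AE w in M. prob_space (K (Y w))) \<and>
     (\<forall>A\<in>sets MX. \<forall>B\<in>sets MY.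
        emeasure M {w \<in> space M. X w \<in> A \<and> Y w \<in> B} =
        (\<integral>\<^sup>+ w. indicator B (Y w) * emeasure (K (Y w)) A \<partial>M))"

definition normalized :: "'a measure \<Rightarrow> ('a \<Rightarrow> real) \<Rightarrow> 'a \<Rightarrow> real" where
  "normalized M g x = g x / (\<integral>z. g z \<partial>M)"

text \<open>The law whose density with respect to \<open>M\<close> is proportional to \<open>g\<close>.\<close>

definition prop_law :: "'a measure \<Rightarrow> ('a \<Rightarrow> real) \<Rightarrow> 'a measure" where
  "prop_law M g = density M (\<lambda>x. ennreal (normalized M g x))"

text \<open>\<open>ln f\<close> is concave as a function with value minus infinity where \<open>f\<close> vanishes;
  \<open>concave_on\<close> includes the convexity of the set.\<close>

definition log_concave :: "('a::real_vector \<Rightarrow> real) \<Rightarrow> bool" where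
  "log_concave f \<longleftrightarrow> (\<forall>x. 0 \<le> f x) \<and> concave_on {x. 0 < f x} (\<lambda>x. ln (f x))"

definition prob_simplex :: "nat \<Rightarrow> (nat \<Rightarrow> real) set" where
  "prob_simplex s = {p. (\<forall>j\<in>{1..s}. 0 \<le> p j) \<and> (\<Sum>j\<in>{1..s}. p j) = 1}"

text \<open>Lebesgue measure in the first \<open>s - 1\<close> coordinates on the hyperplane of vectors with
  coordinate sum 1; it is the usual reference measure for Dirichlet densities.\<close>

definition hyperplane_measure :: "nat \<Rightarrow> (nat \<Rightarrow> real) measure" where
  "hyperplane_measure s =
     distr (PiM {1..<s} (\<lambda>_. lborel)) (PiM {1..s} (\<lambda>_. borel))
       (\<lambda>v. \<lambda>j\<in>{1..s}. if j < s then v j else 1 - (\<Sum>k\<in>{1..<s}. v k))"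

definition dirichlet :: "nat \<Rightarrow> (nat \<Rightarrow> real) \<Rightarrow> (nat \<Rightarrow> real) measure" where
  "dirichlet s g =
     prop_law (hyperplane_measure s)
       (\<lambda>p. (\<Prod>j\<in>{1..s}. p j powr (g j - 1)) * indicator (prob_simplex s) p)"

definition gig_density :: "real \<Rightarrow> real \<Rightarrow> real \<Rightarrow> real \<Rightarrow> real" where
  "gig_density m b \<alpha> \<theta> =
     \<alpha> * b powr m / Gamma m * \<theta> powr (- (1 + m * \<alpha>)) * exp (- b / \<theta> powr \<alpha>) * indicator {0<..} \<theta>"

definition inv_gamma :: "real \<Rightarrow> real \<Rightarrow> real measure" where
  "inv_gamma m b =
     density lborel (\<lambda>y. ennreal (b powr m / Gamma m * y powr (- m - 1) * exp (- b / y) * indicator {0<..} y))"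

definition gen_gamma_density :: "real \<Rightarrow> real \<Rightarrow> real \<Rightarrow> real \<Rightarrow> real" where
  "gen_gamma_density a d p t =
     (p / a powr d) / Gamma (d / p) * t powr (d - 1) * exp (- ((t / a) powr p)) * indicator {0<..} t"

definition gen_gamma :: "real \<Rightarrow> real \<Rightarrow> real \<Rightarrow> real measure" where
  "gen_gamma a d p = density lborel (\<lambda>t. ennreal (gen_gamma_density a d p t))"

text \<open>\<open>uniform_measure M A\<close> is \<open>M\<close> conditioned on the event \<open>A\<close>.\<close>

definition trunc_gen_gamma :: "real \<Rightarrow> real \<Rightarrow> real \<Rightarrow> real \<Rightarrow> real \<Rightarrow> real measure" where
  "trunc_gen_gamma a d p t1 t2 = uniform_measure (gen_gamma a d p) {t1<..<t2}"

text \<open>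
  An observation is \<open>(js, x, u)\<close>: the visited states \<open>js 1, \<dots>, js \<tau>\<close>, the holding times
  \<open>x 1, \<dots>, x \<tau>\<close> (\<open>x n\<close> is spent in the state preceding \<open>js n\<close>) and the censored time \<open>u\<close> spent in
  the last state. The observation horizon is the sum of all the \<open>x n\<close> and of \<open>u\<close>.
\<close>

type_synonym obs = "(nat \<Rightarrow> nat) \<times> (nat \<Rightarrow> real) \<times> real"

definition obs_space :: "nat \<Rightarrow> nat \<Rightarrow> obs measure" where
  "obs_space s \<tau> =
     PiM {1..\<tau>} (\<lambda>_. count_space {1..s}) \<Otimes>\<^sub>M PiM {1..\<tau>} (\<lambda>_. borel) \<Otimes>\<^sub>M borel"

definition positive_times :: "nat \<Rightarrow> obs \<Rightarrow> bool" where
  "positive_times \<tau> = (\<lambda>(js, x, u). (\<forall>n\<in>{1..\<tau>}. 0 < x n) \<and> 0 < u)"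

definition state_at :: "nat \<Rightarrow> (nat \<Rightarrow> nat) \<Rightarrow> nat \<Rightarrow> nat" where
  "state_at j0 js n = (if n = 0 then j0 else js n)"

definition visits :: "nat \<Rightarrow> nat \<Rightarrow> (nat \<Rightarrow> nat) \<Rightarrow> nat \<Rightarrow> nat \<Rightarrow> nat set" where
  "visits \<tau> j0 js i k = {n \<in> {1..\<tau>}. state_at j0 js (n - 1) = i \<and> state_at j0 js n = k}"

definition N_visits :: "nat \<Rightarrow> nat \<Rightarrow> (nat \<Rightarrow> nat) \<Rightarrow> nat \<Rightarrow> nat \<Rightarrow> nat" where
  "N_visits \<tau> j0 js i k = card (visits \<tau> j0 js i k)"

text \<open>The time spent in \<open>i\<close> at the \<open>r\<close>-th visit to the string \<open>(i,k)\<close>, for \<open>r = 1, 2, \<dots>\<close>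
  (list positions start at 0).\<close>

definition visit_time ::
  "nat \<Rightarrow> nat \<Rightarrow> (nat \<Rightarrow> nat) \<Rightarrow> (nat \<Rightarrow> real) \<Rightarrow> nat \<Rightarrow> nat \<Rightarrow> nat \<Rightarrow> real" where
  "visit_time \<tau> j0 js x i k r = x (sorted_list_of_set (visits \<tau> j0 js i k) ! (r - 1))"

definition C_stat :: "nat \<Rightarrow> nat \<Rightarrow> (nat \<Rightarrow> nat) \<Rightarrow> (nat \<Rightarrow> real) \<Rightarrow> nat \<Rightarrow> nat \<Rightarrow> real" where
  "C_stat \<tau> j0 js x i k = (\<Prod>r\<in>{1..N_visits \<tau> j0 js i k}. visit_time \<tau> j0 js x i k r)"

definition M_stat ::
  "nat \<Rightarrow> nat \<Rightarrow> (nat \<Rightarrow> nat) \<Rightarrow> (nat \<Rightarrow> real) \<Rightarrow> nat \<Rightarrow> nat \<Rightarrow> real \<Rightarrow> real" where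
  "M_stat \<tau> j0 js x i k \<alpha> = (\<Sum>r\<in>{1..N_visits \<tau> j0 js i k}. visit_time \<tau> j0 js x i k r powr \<alpha>)"

text \<open>\<open>jn\<close> is the unobserved state following the last observed one.\<close>

definition N_tilde :: "nat \<Rightarrow> nat \<Rightarrow> (nat \<Rightarrow> nat) \<Rightarrow> nat \<Rightarrow> nat \<Rightarrow> nat \<Rightarrow> nat" where
  "N_tilde \<tau> j0 js jn i k =
     N_visits \<tau> j0 js i k + of_bool ((state_at j0 js \<tau>, jn) = (i, k))"

definition M_tilde ::
  "nat \<Rightarrow> nat \<Rightarrow> obs \<Rightarrow> nat \<Rightarrow> nat \<Rightarrow> nat \<Rightarrow> real \<Rightarrow> real" where
  "M_tilde \<tau> j0 = (\<lambda>(js, x, u) jn i k \<alpha>.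
     M_stat \<tau> j0 js x i k \<alpha> + u powr \<alpha> * of_bool ((state_at j0 js \<tau>, jn) = (i, k)))"

definition full_likelihood ::
  "nat \<Rightarrow> nat \<Rightarrow> nat \<Rightarrow> obs \<Rightarrow> nat \<Rightarrow> (nat \<Rightarrow> nat \<Rightarrow> real) \<Rightarrow>
   (nat \<times> nat \<Rightarrow> real) \<Rightarrow> (nat \<times> nat \<Rightarrow> real) \<Rightarrow> real" where
  "full_likelihood s \<tau> j0 = (\<lambda>(js, x, u) jn p \<alpha> \<theta>.
     (\<Prod>(i,k)\<in>{1..s} \<times> {1..s}. p i k ^ N_visits \<tau> j0 js i k) *
     (\<Prod>(i,k)\<in>{1..s} \<times> {1..s}.
        \<alpha> (i,k) ^ N_visits \<tau> j0 js i k / \<theta> (i,k) powr (\<alpha> (i,k) * real (N_visits \<tau> j0 js i k)) *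
        C_stat \<tau> j0 js x i k powr (\<alpha> (i,k) - 1) *
        exp (- (1 / \<theta> (i,k) powr \<alpha> (i,k)) * M_stat \<tau> j0 js x i k (\<alpha> (i,k)))) *
     (let l = state_at j0 js \<tau> in p l jn * exp (- ((u / \<theta> (l,jn)) powr \<alpha> (l,jn)))))"

datatype t_prior = Known real | Uniform real real

fun valid_t_prior :: "t_prior \<Rightarrow> bool" where
  "valid_t_prior (Known t) \<longleftrightarrow> 0 < t"
| "valid_t_prior (Uniform t1 t2) \<longleftrightarrow> 0 \<le> t1 \<and> t1 < t2"

fun t_law :: "t_prior \<Rightarrow> real measure" where
  "t_law (Known t) = return lborel t"
| "t_law (Uniform t1 t2) = uniform_measure lborel {t1<..<t2}"

definition b_rate :: "real \<Rightarrow> real \<Rightarrow> real \<Rightarrow> real \<Rightarrow> real" where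
  "b_rate m q t \<alpha> = t powr \<alpha> * inverse ((1 - q) powr (- 1 / m) - 1)"

definition alpha_support :: "real \<Rightarrow> real \<Rightarrow> real \<Rightarrow> real set" where
  "alpha_support d \<alpha>0 \<alpha>1 = (if d = 0 then {\<alpha>0<..<\<alpha>1} else {\<alpha>0<..})"

definition alpha_law :: "real \<Rightarrow> real \<Rightarrow> real \<Rightarrow> real \<Rightarrow> real \<Rightarrow> real measure" where
  "alpha_law m c d \<alpha>0 \<alpha>1 = prop_law lborel
     (\<lambda>\<alpha>. \<alpha> powr (m - c) * (\<alpha> - \<alpha>0) powr (c - 1) * exp (- m * d * \<alpha>) *
          indicator (alpha_support d \<alpha>0 \<alpha>1) \<alpha>)"

abbreviation arrays :: "(nat \<times> nat) set \<Rightarrow> (nat \<times> nat \<Rightarrow> real) measure" where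
  "arrays I \<equiv> PiM I (\<lambda>_. borel)"

abbreviation row_space :: "nat \<Rightarrow> (nat \<Rightarrow> real) measure" where
  "row_space s \<equiv> PiM {1..s} (\<lambda>_. borel)"

abbreviation matrices :: "nat set \<Rightarrow> nat \<Rightarrow> (nat \<Rightarrow> nat \<Rightarrow> real) measure" where
  "matrices I s \<equiv> PiM I (\<lambda>_. row_space s)"

abbreviation index_pairs :: "nat \<Rightarrow> (nat \<times> nat) set" where
  "index_pairs s \<equiv> {1..s} \<times> {1..s}"

text \<open>
  The law of \<open>(p, \<alpha>, \<theta>, t)\<close>. The matrix \<open>p\<close> has independent Dirichlet rows and is independent of the
  rest; the entries of \<open>\<alpha>\<close> and of \<open>t\<close> are all independent; and, given \<open>(\<alpha>, t)\<close>, the entries of \<open>\<theta>\<close>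
  are independent, their joint conditional density being the product of the generalized inverse
  Gamma densities.
\<close>

definition prior_law ::
  "nat \<Rightarrow> (nat \<Rightarrow> nat \<Rightarrow> real) \<Rightarrow> (nat \<times> nat \<Rightarrow> real) \<Rightarrow> (nat \<times> nat \<Rightarrow> real) \<Rightarrow> (nat \<times> nat \<Rightarrow> real) \<Rightarrow>
   (nat \<times> nat \<Rightarrow> real) \<Rightarrow> (nat \<times> nat \<Rightarrow> real) \<Rightarrow> (nat \<times> nat \<Rightarrow> real) \<Rightarrow> (nat \<times> nat \<Rightarrow> t_prior) \<Rightarrow>
   ((nat \<Rightarrow> nat \<Rightarrow> real) \<times> (nat \<times> nat \<Rightarrow> real) \<times> (nat \<times> nat \<Rightarrow> real) \<times> (nat \<times> nat \<Rightarrow> real)) measure"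
where
  "prior_law s \<gamma> m q c d \<alpha>0 \<alpha>1 \<pi>t =
     PiM {1..s} (\<lambda>i. dirichlet s (\<gamma> i)) \<Otimes>\<^sub>M
     density
       (PiM (index_pairs s) (\<lambda>e. alpha_law (m e) (c e) (d e) (\<alpha>0 e) (\<alpha>1 e)) \<Otimes>\<^sub>M
        PiM (index_pairs s) (\<lambda>_. lborel) \<Otimes>\<^sub>M
        PiM (index_pairs s) (\<lambda>e. t_law (\<pi>t e)))
       (\<lambda>(\<alpha>, \<theta>, t). ennreal
          (\<Prod>e\<in>index_pairs s. gig_density (m e) (b_rate (m e) (q e) (t e) (\<alpha> e)) (\<alpha> e) (\<theta> e)))"

text \<open>
  The joint law of \<open>(data, jn, p, \<alpha>, \<theta>, t)\<close> has density \<open>full_likelihood\<close> with respect to the product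
  of a dominating measure \<open>D\<close> for the data, counting measure for \<open>jn\<close>, and the prior law. Typical
  choices for \<open>D\<close>, with a fixed number \<open>\<tau>\<close> of transitions (the number is part of the data): for
  observation over \<open>[0,T]\<close>, the image of counting measure times Lebesgue measure on
  \<open>{x. all x n > 0, sum of all x n < T}\<close> under \<open>(js, x) \<mapsto> (js, x, T - sum of all x n)\<close>; or the point
  mass at given data, which yields the (unnormalised) posterior law of \<open>(jn, p, \<alpha>, \<theta>, t)\<close>.
\<close>

definition joint_law ::
  "nat \<Rightarrow> nat \<Rightarrow> nat \<Rightarrow> obs measure \<Rightarrow>
   ((nat \<Rightarrow> nat \<Rightarrow> real) \<times> (nat \<times> nat \<Rightarrow> real) \<times> (nat \<times> nat \<Rightarrow> real) \<times> (nat \<times> nat \<Rightarrow> real)) measure \<Rightarrow>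
   (obs \<times> nat \<times> (nat \<Rightarrow> nat \<Rightarrow> real) \<times> (nat \<times> nat \<Rightarrow> real) \<times> (nat \<times> nat \<Rightarrow> real) \<times> (nat \<times> nat \<Rightarrow> real)) measure"
where
  "joint_law s \<tau> j0 D prior =
     density (D \<Otimes>\<^sub>M count_space {1..s} \<Otimes>\<^sub>M prior)
       (\<lambda>(dat, jn, p, \<alpha>, \<theta>, t). ennreal (full_likelihood s \<tau> j0 dat jn p \<alpha> \<theta>))"

definition alpha_kernel ::
  "nat \<Rightarrow> nat \<Rightarrow> real \<Rightarrow> real \<Rightarrow> real \<Rightarrow> real \<Rightarrow> real \<Rightarrow> real \<Rightarrow> nat \<Rightarrow> nat \<Rightarrow>
   obs \<Rightarrow> nat \<Rightarrow> real \<Rightarrow> real \<Rightarrow> real \<Rightarrow> real" where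
  "alpha_kernel \<tau> j0 m q c d \<alpha>0 \<alpha>1 i j = (\<lambda>(js, x, u) jn \<theta> t \<alpha>.
     let N = real (N_visits \<tau> j0 js i j) in
       \<alpha> powr (N + 1 + m - c) * (\<alpha> - \<alpha>0) powr (c - 1) *
       exp (- (m * d - ln (C_stat \<tau> j0 js x i j * t powr m / \<theta> powr (N + m))) * \<alpha>) *
       exp (- ((b_rate m q t \<alpha> + M_tilde \<tau> j0 (js, x, u) jn i j \<alpha>) / \<theta> powr \<alpha>)) *
       indicator (alpha_support d \<alpha>0 \<alpha>1) \<alpha>)"

end

theory Submission
  imports Defs
begin

text \<open>
  Likelihood times prior is a density with respect to a product of sigma-finite measures, so
  integrating out one coordinate gives the law of all the others, and the normalised section of the
  density is the conditional law of that coordinate. For each family of parameters the density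
  factors over the strings \<open>(i,k)\<close>, and the single factor containing the coordinate of interest is
  proportional to the claimed kernel. Where a normalising constant vanishes or a prior normaliser
  is infinite (so that Isabelle's integral is 0), the corresponding set is null for the joint law.
  For \<open>\<alpha>\<close> finiteness of the normaliser follows from \<open>ln w \<le> w - 1\<close>: the powers of the data are
  dominated by the exponential factors, leaving a shifted Gamma kernel. With \<open>N\<close> visits the
  logarithm of the kernel is concave because its possibly convex part
  \<open>(N + 1 + m - c) ln \<alpha> + (c - 1) ln (\<alpha> - \<alpha>\<^sub>0)\<close> has second derivative at most \<open>- (N + m) / \<alpha>\<^sup>2\<close>.
\<close>

text \<open>For fixed \<open>y\<close> everything reduces to one identity: the integral of the
  section of the joint density over an event equals \<open>c * emeasure (K y) A\<close> with one
  \<open>c < \<infinity>\<close> for all events. This \<open>c\<close> is the marginal density of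
  the conditioning variables at \<open>y\<close>. Its value is irrelevant, its finiteness amounts to
  sigma-finiteness of their law, and at \<open>c = 0\<close> nothing is claimed about
  \<open>K y\<close>; so normalising constants of prior and posterior never have to be matched, and
  the joint law may have infinite mass. The obstacle is bookkeeping at bad points: positivity of
  \<alpha>, t and the data holds only almost everywhere, \<theta> is integrated over the whole line,
  and \<open>ennreal\<close> hides negative values. Two claims go beyond a plain coordinate: in (b)
  the conditioned variable \<open>\<theta> powr \<alpha>\<close> is a function of the coordinate and
  of \<open>y\<close>, and in (e) the next state is not conditioned on, so it is split off together
  with t and summed out; the dependence on t is the same for each next state, whence the sum changes
  only \<open>c\<close>.\<close>

section \<open>Conditional laws by splitting off a coordinate\<close>

text \<open>\<open>B\<close> is the image of \<open>\<mu> \<Otimes>\<^sub>M \<nu>\<close> under \<open>\<phi>\<close>. The version with iterated integrals makes it easy to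
  split off a coordinate deep inside nested products.\<close>

definition splits :: "'w measure \<Rightarrow> 'x measure \<Rightarrow> 'y measure \<Rightarrow> ('x \<Rightarrow> 'y \<Rightarrow> 'w) \<Rightarrow> bool" where
  "splits B \<mu> \<nu> \<phi> \<longleftrightarrow>
     sigma_finite_measure \<mu> \<and> sigma_finite_measure \<nu> \<and>
     (\<lambda>(x, y). \<phi> x y) \<in> measurable (\<mu> \<Otimes>\<^sub>M \<nu>) B \<and>
     (\<forall>h\<in>borel_measurable B. (\<integral>\<^sup>+ w. h w \<partial>B) = (\<integral>\<^sup>+ y. \<integral>\<^sup>+ x. h (\<phi> x y) \<partial>\<mu> \<partial>\<nu>))"

lemma splits_measurable:
  assumes "splits B \<mu> \<nu> \<phi>"
  shows "(\<lambda>(x, y). \<phi> x y) \<in> measurable (\<mu> \<Otimes>\<^sub>M \<nu>) B" "(\<lambda>(y, x). \<phi> x y) \<in> measurable (\<nu> \<Otimes>\<^sub>M \<mu>) B"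
proof -
  show m[measurable]: "(\<lambda>(x, y). \<phi> x y) \<in> measurable (\<mu> \<Otimes>\<^sub>M \<nu>) B"
    using assms by (simp add: splits_def)
  have "(\<lambda>z. case (snd z, fst z) of (x, y) \<Rightarrow> \<phi> x y) \<in> measurable (\<nu> \<Otimes>\<^sub>M \<mu>) B"
    by (rule measurable_compose[OF _ m]) simp
  then show "(\<lambda>(y, x). \<phi> x y) \<in> measurable (\<nu> \<Otimes>\<^sub>M \<mu>) B"
    by (simp add: case_prod_beta)
qed

lemma splits_PiM:
  assumes "\<And>k. sigma_finite_measure (M k)" "finite I" "e \<in> I"
  shows "splits (PiM I M) (M e) (PiM (I - {e}) M) (\<lambda>x f. f(e := x))"
proof -
  interpret product_sigma_finite M by (rule product_sigma_finite.intro) (rule assms)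
  interpret R: finite_product_sigma_finite M "I - {e}" by standard (simp add: assms)
  have I: "insert e (I - {e}) = I" using assms by auto
  have "(\<lambda>(x, f). f(e := x)) \<in> measurable (M e \<Otimes>\<^sub>M PiM (I - {e}) M) (PiM I M)"
    unfolding case_prod_beta
    by (rule measurable_fun_upd[where J="I - {e}"]) (use assms in auto)
  moreover have "(\<integral>\<^sup>+ w. h w \<partial>PiM I M) = (\<integral>\<^sup>+ f. \<integral>\<^sup>+ x. h (f(e := x)) \<partial>M e \<partial>PiM (I - {e}) M)"
    if "h \<in> borel_measurable (PiM I M)" for h
    using product_nn_integral_insert[of "I - {e}" e h] that assms(2) unfolding I by simp
  ultimately show ?thesis
    unfolding splits_def using assms(1) R.sigma_finite_measure_axioms by simp
qed

lemma splits_pair: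
  assumes "sigma_finite_measure \<mu>" "sigma_finite_measure \<nu>"
  shows "splits (\<mu> \<Otimes>\<^sub>M \<nu>) \<mu> \<nu> (\<lambda>x y. (x, y))"
proof -
  interpret pair_sigma_finite \<mu> \<nu> using assms by (simp add: pair_sigma_finite_def)
  show ?thesis unfolding splits_def using assms by (auto simp: nn_integral_snd)
qed

text \<open>Tonelli: with the untouched coordinate \<open>a\<close> integrated outermost, the
  splitting of \<open>B\<close> applies to each section. Together with
  \<open>splits_lift_right\<close> this reaches a coordinate at any depth of a nested
  product.\<close>

lemma splits_lift_left:
  assumes N: "sigma_finite_measure N" and B: "sigma_finite_measure B" and s: "splits B \<mu> \<nu> \<phi>"
  shows "splits (N \<Otimes>\<^sub>M B) \<mu> (N \<Otimes>\<^sub>M \<nu>) (\<lambda>x (a, y). (a, \<phi> x y))"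
proof -
  have sig: "sigma_finite_measure \<mu>" "sigma_finite_measure \<nu>" using s by (auto simp: splits_def)
  interpret m: sigma_finite_measure \<mu> by fact
  interpret n: sigma_finite_measure \<nu> by fact
  interpret B: sigma_finite_measure B by fact
  interpret NB: pair_sigma_finite N B using N B by (simp add: pair_sigma_finite_def)
  interpret Nn: pair_sigma_finite N \<nu> using N sig by (simp add: pair_sigma_finite_def)
  note m[measurable] = splits_measurable[OF s]
  have "(\<lambda>z. (fst (snd z), (\<lambda>(x, y). \<phi> x y) (fst z, snd (snd z)))) \<in> measurable (\<mu> \<Otimes>\<^sub>M (N \<Otimes>\<^sub>M \<nu>)) (N \<Otimes>\<^sub>M B)"
    by measurable
  then have 1: "(\<lambda>(x, z). (\<lambda>(a, y). (a, \<phi> x y)) z) \<in> measurable (\<mu> \<Otimes>\<^sub>M (N \<Otimes>\<^sub>M \<nu>)) (N \<Otimes>\<^sub>M B)"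
    by (simp add: case_prod_beta)
  \<comment> \<open>Measurability of an integral over \<open>x\<close> in the remaining variables
    needs the integrated variable as second component, hence this swapped copy of the previous
    fact.\<close>
  have "(\<lambda>z. (fst (fst z), (\<lambda>(x, y). \<phi> x y) (snd z, snd (fst z)))) \<in> measurable ((N \<Otimes>\<^sub>M \<nu>) \<Otimes>\<^sub>M \<mu>) (N \<Otimes>\<^sub>M B)"
    by measurable
  then have 3: "(\<lambda>(z, x). (\<lambda>(a, y). (a, \<phi> x y)) z) \<in> measurable ((N \<Otimes>\<^sub>M \<nu>) \<Otimes>\<^sub>M \<mu>) (N \<Otimes>\<^sub>M B)"
    by (simp add: case_prod_beta)
  have 2: "(\<integral>\<^sup>+ w. h w \<partial>(N \<Otimes>\<^sub>M B)) = (\<integral>\<^sup>+ z. \<integral>\<^sup>+ x. h (case z of (a, y) \<Rightarrow> (a, \<phi> x y)) \<partial>\<mu> \<partial>(N \<Otimes>\<^sub>M \<nu>))"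
    if h[measurable]: "h \<in> borel_measurable (N \<Otimes>\<^sub>M B)" for h
  proof -
    from measurable_compose[OF 3 h]
    have hm[measurable]: "(\<lambda>z. \<integral>\<^sup>+ x. h (case z of (a, y) \<Rightarrow> (a, \<phi> x y)) \<partial>\<mu>) \<in> borel_measurable (N \<Otimes>\<^sub>M \<nu>)"
      by (intro m.borel_measurable_nn_integral) (simp add: case_prod_beta)
    have "(\<integral>\<^sup>+ w. h w \<partial>(N \<Otimes>\<^sub>M B)) = (\<integral>\<^sup>+ a. \<integral>\<^sup>+ b. h (a, b) \<partial>B \<partial>N)"
      using h by (simp add: B.nn_integral_fst)
    also have "\<dots> = (\<integral>\<^sup>+ a. \<integral>\<^sup>+ y. \<integral>\<^sup>+ x. h (a, \<phi> x y) \<partial>\<mu> \<partial>\<nu> \<partial>N)"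
      using s by (intro nn_integral_cong) (auto simp: splits_def)
    also have "\<dots> = (\<integral>\<^sup>+ z. \<integral>\<^sup>+ x. h (case z of (a, y) \<Rightarrow> (a, \<phi> x y)) \<partial>\<mu> \<partial>(N \<Otimes>\<^sub>M \<nu>))"
      by (subst n.nn_integral_fst[symmetric]) auto
    finally show ?thesis .
  qed
  show ?thesis unfolding splits_def
    using sig 1 2 Nn.sigma_finite_measure_axioms by blast
qed

lemma splits_lift_right:
  assumes N: "sigma_finite_measure N" and B: "sigma_finite_measure B" and s: "splits B \<mu> \<nu> \<phi>"
  shows "splits (B \<Otimes>\<^sub>M N) \<mu> (\<nu> \<Otimes>\<^sub>M N) (\<lambda>x (y, b). (\<phi> x y, b))"
proof -
  have sig: "sigma_finite_measure \<mu>" "sigma_finite_measure \<nu>" using s by (auto simp: splits_def)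
  interpret m: sigma_finite_measure \<mu> by fact
  interpret n: sigma_finite_measure \<nu> by fact
  interpret BN: pair_sigma_finite B N using N B by (simp add: pair_sigma_finite_def)
  interpret nN: pair_sigma_finite \<nu> N using N sig by (simp add: pair_sigma_finite_def)
  note m[measurable] = splits_measurable[OF s]
  have "(\<lambda>z. ((\<lambda>(x, y). \<phi> x y) (fst z, fst (snd z)), snd (snd z))) \<in> measurable (\<mu> \<Otimes>\<^sub>M (\<nu> \<Otimes>\<^sub>M N)) (B \<Otimes>\<^sub>M N)"
    by measurable
  then have 1: "(\<lambda>(x, z). (\<lambda>(y, b). (\<phi> x y, b)) z) \<in> measurable (\<mu> \<Otimes>\<^sub>M (\<nu> \<Otimes>\<^sub>M N)) (B \<Otimes>\<^sub>M N)"
    by (simp add: case_prod_beta)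
  have "(\<lambda>z. ((\<lambda>(x, y). \<phi> x y) (snd z, fst (fst z)), snd (fst z))) \<in> measurable ((\<nu> \<Otimes>\<^sub>M N) \<Otimes>\<^sub>M \<mu>) (B \<Otimes>\<^sub>M N)"
    by measurable
  then have 3: "(\<lambda>(z, x). (\<lambda>(y, b). (\<phi> x y, b)) z) \<in> measurable ((\<nu> \<Otimes>\<^sub>M N) \<Otimes>\<^sub>M \<mu>) (B \<Otimes>\<^sub>M N)"
    by (simp add: case_prod_beta)
  have 2: "(\<integral>\<^sup>+ w. h w \<partial>(B \<Otimes>\<^sub>M N)) = (\<integral>\<^sup>+ z. \<integral>\<^sup>+ x. h (case z of (y, b) \<Rightarrow> (\<phi> x y, b)) \<partial>\<mu> \<partial>(\<nu> \<Otimes>\<^sub>M N))"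
    if h[measurable]: "h \<in> borel_measurable (B \<Otimes>\<^sub>M N)" for h
  proof -
    from measurable_compose[OF 3 h]
    have hm[measurable]: "(\<lambda>z. \<integral>\<^sup>+ x. h (case z of (y, b) \<Rightarrow> (\<phi> x y, b)) \<partial>\<mu>) \<in> borel_measurable (\<nu> \<Otimes>\<^sub>M N)"
      by (intro m.borel_measurable_nn_integral) (simp add: case_prod_beta)
    have "(\<integral>\<^sup>+ w. h w \<partial>(B \<Otimes>\<^sub>M N)) = (\<integral>\<^sup>+ b. \<integral>\<^sup>+ a. h (a, b) \<partial>B \<partial>N)"
      using h by (simp add: BN.nn_integral_snd)
    also have "\<dots> = (\<integral>\<^sup>+ b. \<integral>\<^sup>+ y. \<integral>\<^sup>+ x. h (\<phi> x y, b) \<partial>\<mu> \<partial>\<nu> \<partial>N)"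
    proof (intro nn_integral_cong)
      fix b assume [simp]: "b \<in> space N"
      have "(\<lambda>a. h (a, b)) \<in> borel_measurable B" by measurable
      then show "(\<integral>\<^sup>+ a. h (a, b) \<partial>B) = (\<integral>\<^sup>+ y. \<integral>\<^sup>+ x. h (\<phi> x y, b) \<partial>\<mu> \<partial>\<nu>)"
        using s by (auto simp: splits_def)
    qed
    also have "\<dots> = (\<integral>\<^sup>+ z. \<integral>\<^sup>+ x. h (case z of (y, b) \<Rightarrow> (\<phi> x y, b)) \<partial>\<mu> \<partial>(\<nu> \<Otimes>\<^sub>M N))"
      by (subst nN.nn_integral_snd[symmetric]) auto
    finally show ?thesis .
  qed
  show ?thesis unfolding splits_def
    using sig 1 2 nN.sigma_finite_measure_axioms by blast
qed

text \<open>Allows two coordinates to be removed at once, as in (e), where neither the next state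
  nor the entry of t is among the conditioning variables.\<close>

lemma splits_compose:
  assumes s1: "splits B \<mu>1 \<nu>1 \<phi>1" and s2: "splits \<nu>1 \<mu>2 \<nu>2 \<phi>2"
  shows "splits B (\<mu>1 \<Otimes>\<^sub>M \<mu>2) \<nu>2 (\<lambda>(x1, x2) y. \<phi>1 x1 (\<phi>2 x2 y))"
proof -
  interpret m1: sigma_finite_measure \<mu>1 using s1 by (simp add: splits_def)
  interpret m2: sigma_finite_measure \<mu>2 using s2 by (simp add: splits_def)
  interpret n2: sigma_finite_measure \<nu>2 using s2 by (simp add: splits_def)
  interpret m12: pair_sigma_finite \<mu>1 \<mu>2 ..
  note [measurable] = splits_measurable[OF s1] splits_measurable[OF s2]
  have "(\<lambda>z. (\<lambda>(x, y). \<phi>1 x y) (fst (fst z), (\<lambda>(x, y). \<phi>2 x y) (snd (fst z), snd z)))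
        \<in> measurable ((\<mu>1 \<Otimes>\<^sub>M \<mu>2) \<Otimes>\<^sub>M \<nu>2) B"
    by measurable
  then have 1: "(\<lambda>(x, y). (\<lambda>(x1, x2) y. \<phi>1 x1 (\<phi>2 x2 y)) x y) \<in> measurable ((\<mu>1 \<Otimes>\<^sub>M \<mu>2) \<Otimes>\<^sub>M \<nu>2) B"
    by (simp add: case_prod_beta)
  have 2: "(\<integral>\<^sup>+ w. h w \<partial>B) = (\<integral>\<^sup>+ y. \<integral>\<^sup>+ x. h ((\<lambda>(x1, x2) y. \<phi>1 x1 (\<phi>2 x2 y)) x y) \<partial>(\<mu>1 \<Otimes>\<^sub>M \<mu>2) \<partial>\<nu>2)"
    if h[measurable]: "h \<in> borel_measurable B" for h
  proof -
    have "(\<lambda>z. h ((\<lambda>(x, y). \<phi>1 x y) (snd z, fst z))) \<in> borel_measurable (\<nu>1 \<Otimes>\<^sub>M \<mu>1)" by measurable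
    then have hm: "(\<lambda>y. \<integral>\<^sup>+ x. h (\<phi>1 x y) \<partial>\<mu>1) \<in> borel_measurable \<nu>1"
      by (intro m1.borel_measurable_nn_integral) (simp add: case_prod_beta)
    have "(\<integral>\<^sup>+ w. h w \<partial>B) = (\<integral>\<^sup>+ y. \<integral>\<^sup>+ x2. \<integral>\<^sup>+ x1. h (\<phi>1 x1 (\<phi>2 x2 y)) \<partial>\<mu>1 \<partial>\<mu>2 \<partial>\<nu>2)"
      using s1 s2 h hm by (auto simp: splits_def)
    also have "\<dots> = (\<integral>\<^sup>+ y. \<integral>\<^sup>+ x. h ((\<lambda>(x1, x2) y. \<phi>1 x1 (\<phi>2 x2 y)) x y) \<partial>(\<mu>1 \<Otimes>\<^sub>M \<mu>2) \<partial>\<nu>2)"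
    proof (intro nn_integral_cong)
      fix y assume [simp]: "y \<in> space \<nu>2"
      have "(\<lambda>x. h ((\<lambda>(x, y). \<phi>1 x y) (fst x, (\<lambda>(x, y). \<phi>2 x y) (snd x, y)))) \<in> borel_measurable (\<mu>1 \<Otimes>\<^sub>M \<mu>2)"
        by measurable
      then show "(\<integral>\<^sup>+ x2. \<integral>\<^sup>+ x1. h (\<phi>1 x1 (\<phi>2 x2 y)) \<partial>\<mu>1 \<partial>\<mu>2) =
          (\<integral>\<^sup>+ x. h ((\<lambda>(x1, x2) y. \<phi>1 x1 (\<phi>2 x2 y)) x y) \<partial>(\<mu>1 \<Otimes>\<^sub>M \<mu>2))"
        by (subst m12.nn_integral_snd[symmetric]) (auto simp: case_prod_beta)
    qed
    finally show ?thesis .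
  qed
  show ?thesis unfolding splits_def
    using 1 2 m12.sigma_finite_measure_axioms n2.sigma_finite_measure_axioms by blast
qed

text \<open>\<open>F\<close> integrated along a section is the density of the law of
  \<open>Y\<close> with respect to \<open>\<nu>\<close>, so the identity demanded by
  \<open>cond_law\<close> is Tonelli plus the pointwise identity in \<open>ae\<close>.
  \<open>X\<close> is evaluated at \<open>\<phi> x y\<close> and may thus depend on \<open>y\<close>
  too. The constant may vary with \<open>y\<close> without any measurability assumption.\<close>

lemma cond_law_of_splits:
  assumes s: "splits B \<mu> \<nu> \<phi>" and F[measurable]: "F \<in> borel_measurable B" and M: "M = density B F"
    and sets\<nu>: "sets \<nu> = sets MY"
    and X[measurable]: "X \<in> measurable B MX" and Y[measurable]: "Y \<in> measurable B MY"
    and Y\<phi>: "\<And>x y. x \<in> space \<mu> \<Longrightarrow> y \<in> space MY \<Longrightarrow> Y (\<phi> x y) = y"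
    and Ks: "\<And>y. y \<in> space MY \<Longrightarrow> sets (K y) = sets MX"
    and Km[measurable]: "\<And>A. A \<in> sets MX \<Longrightarrow> (\<lambda>y. emeasure (K y) A) \<in> borel_measurable MY"
    and ae: "AE y in \<nu>. \<exists>c<\<infinity>. (c \<noteq> 0 \<longrightarrow> prob_space (K y)) \<and>
        (\<forall>A\<in>sets MX. (\<integral>\<^sup>+ x. F (\<phi> x y) * indicator A (X (\<phi> x y)) \<partial>\<mu>) = c * emeasure (K y) A)"
  shows "cond_law M MX X MY Y K"
proof -
  define Z where "Z y = (\<integral>\<^sup>+ x. F (\<phi> x y) \<partial>\<mu>)" for y
  interpret m: sigma_finite_measure \<mu> using s by (simp add: splits_def)
  interpret n: sigma_finite_measure \<nu> using s by (simp add: splits_def)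
  note [measurable] = splits_measurable[OF s]
  note [measurable_cong] = sets\<nu>
  have sp: "space \<nu> = space MY" using sets\<nu> by (rule sets_eq_imp_space_eq)
  have [measurable]: "X \<in> measurable M MX" "Y \<in> measurable M MY" unfolding M by measurable
  have "(\<lambda>z. F ((\<lambda>(y, x). \<phi> x y) z)) \<in> borel_measurable (MY \<Otimes>\<^sub>M \<mu>)" by measurable
  then have Zm[measurable]: "Z \<in> borel_measurable MY"
    unfolding Z_def by (intro m.borel_measurable_nn_integral) (simp add: case_prod_beta)
  have XY: "\<phi> x y \<in> space B" if "x \<in> space \<mu>" "y \<in> space MY" for x y
  proof -
    have "(x, y) \<in> space (\<mu> \<Otimes>\<^sub>M \<nu>)" using that sp by (simp add: space_pair_measure)
    from measurable_space[OF splits_measurable(1)[OF s] this] show ?thesis by simp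
  qed
  have Xsp: "X (\<phi> x y) \<in> space MX" if "x \<in> space \<mu>" "y \<in> space MY" for x y
    using measurable_space[OF X XY[OF that]] .
  \<comment> \<open>The event \<open>space MX\<close> identifies the unspecified \<open>c\<close> as
    \<open>Z y\<close>, which is measurable in \<open>y\<close>. If \<open>c = 0\<close> this uses
    no property of \<open>K y\<close>.\<close>
  have ae': "AE y in \<nu>. Z y < \<infinity> \<and> (Z y \<noteq> 0 \<longrightarrow> prob_space (K y)) \<and>
        (\<forall>A\<in>sets MX. (\<integral>\<^sup>+ x. F (\<phi> x y) * indicator A (X (\<phi> x y)) \<partial>\<mu>) = Z y * emeasure (K y) A)"
    using ae AE_space
  proof eventually_elim
    case (elim y)
    then have y: "y \<in> space MY" using sp by simp
    obtain c where c: "c < \<infinity>" "c \<noteq> 0 \<longrightarrow> prob_space (K y)"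
      "\<forall>A\<in>sets MX. (\<integral>\<^sup>+ x. F (\<phi> x y) * indicator A (X (\<phi> x y)) \<partial>\<mu>) = c * emeasure (K y) A"
      using elim by blast
    have "Z y = (\<integral>\<^sup>+ x. F (\<phi> x y) * indicator (space MX) (X (\<phi> x y)) \<partial>\<mu>)"
      unfolding Z_def by (intro nn_integral_cong) (simp add: Xsp y)
    also have "\<dots> = c * emeasure (K y) (space MX)" using c by simp
    also have "\<dots> = c"
    proof (cases "c = 0")
      case False
      then interpret prob_space "K y" using c by simp
      have "space MX = space (K y)" using sets_eq_imp_space_eq[OF Ks[OF y]] by simp
      then show ?thesis by (simp add: emeasure_space_1)
    qed simp
    finally show ?case using c by simp
  qed
  \<comment> \<open>The joint law and, through \<open>keyY\<close>, the law of \<open>Y\<close> are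
    both instances of this formula with a test function \<open>g\<close> of the conditioning
    variables.\<close>
  have key: "(\<integral>\<^sup>+ w. indicator A (X w) * g (Y w) \<partial>M) = (\<integral>\<^sup>+ y. g y * (Z y * emeasure (K y) A) \<partial>\<nu>)"
    if [measurable]: "A \<in> sets MX" "g \<in> borel_measurable MY" for A g
  proof -
    have "(\<integral>\<^sup>+ w. indicator A (X w) * g (Y w) \<partial>M) = (\<integral>\<^sup>+ w. F w * (indicator A (X w) * g (Y w)) \<partial>B)"
      unfolding M by (simp add: nn_integral_density)
    also have "\<dots> = (\<integral>\<^sup>+ y. \<integral>\<^sup>+ x. F (\<phi> x y) * (indicator A (X (\<phi> x y)) * g (Y (\<phi> x y))) \<partial>\<mu> \<partial>\<nu>)"
    proof -
      have "(\<lambda>w. F w * (indicator A (X w) * g (Y w))) \<in> borel_measurable B" by measurable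
      then show ?thesis using s by (simp add: splits_def)
    qed
    also have "\<dots> = (\<integral>\<^sup>+ y. g y * (\<integral>\<^sup>+ x. F (\<phi> x y) * indicator A (X (\<phi> x y)) \<partial>\<mu>) \<partial>\<nu>)"
    proof (intro nn_integral_cong)
      fix y assume y: "y \<in> space \<nu>"
      then have [simp]: "y \<in> space MY" using sp by simp
      have [measurable]: "(\<lambda>x. \<phi> x y) \<in> measurable \<mu> B"
        using measurable_compose[OF measurable_Pair2'[OF y] splits_measurable(1)[OF s]] by simp
      show "(\<integral>\<^sup>+ x. F (\<phi> x y) * (indicator A (X (\<phi> x y)) * g (Y (\<phi> x y))) \<partial>\<mu>) =
        g y * (\<integral>\<^sup>+ x. F (\<phi> x y) * indicator A (X (\<phi> x y)) \<partial>\<mu>)"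
        by (subst nn_integral_cmult[symmetric])
           (auto intro!: nn_integral_cong simp: Y\<phi> mult_ac)
    qed
    also have "\<dots> = (\<integral>\<^sup>+ y. g y * (Z y * emeasure (K y) A) \<partial>\<nu>)"
    proof (rule nn_integral_cong_AE)
      show "AE y in \<nu>. g y * (\<integral>\<^sup>+ x. F (\<phi> x y) * indicator A (X (\<phi> x y)) \<partial>\<mu>) =
          g y * (Z y * emeasure (K y) A)"
        using ae' by eventually_elim (simp add: that)
    qed
    finally show ?thesis .
  qed
  have keyY: "(\<integral>\<^sup>+ w. g (Y w) \<partial>M) = (\<integral>\<^sup>+ y. g y * Z y \<partial>\<nu>)" if g[measurable]: "g \<in> borel_measurable MY" for g
  proof -
    have "(\<integral>\<^sup>+ w. g (Y w) \<partial>M) = (\<integral>\<^sup>+ w. indicator (space MX) (X w) * g (Y w) \<partial>M)"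
      using measurable_space[OF X] by (intro nn_integral_cong) (simp add: M)
    also have "\<dots> = (\<integral>\<^sup>+ y. g y * (Z y * emeasure (K y) (space MX)) \<partial>\<nu>)"
      by (rule key) (auto simp: g)
    also have "\<dots> = (\<integral>\<^sup>+ y. g y * Z y \<partial>\<nu>)"
    proof (rule nn_integral_cong_AE)
      show "AE y in \<nu>. g y * (Z y * emeasure (K y) (space MX)) = g y * Z y"
        using ae' AE_space
      proof eventually_elim
        case (elim y)
        then show ?case
          using sp prob_space.emeasure_space_1[of "K y"] sets_eq_imp_space_eq[OF Ks[of y]]
          by (cases "Z y = 0") auto
      qed
    qed
    finally show ?thesis .
  qed
  \<comment> \<open>Once the law of \<open>Y\<close> has density \<open>Z\<close>, its
    sigma-finiteness is equivalent to finiteness of \<open>Z\<close> almost everywhere.\<close>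
  have law: "distr M MY Y = density \<nu> Z"
  proof (rule measure_eqI)
    show "sets (distr M MY Y) = sets (density \<nu> Z)" by (simp add: sets\<nu>)
    fix C assume "C \<in> sets (distr M MY Y)"
    then have C[measurable]: "C \<in> sets MY" by simp
    then have "emeasure (distr M MY Y) C = (\<integral>\<^sup>+ y. indicator C y \<partial>distr M MY Y)" by simp
    also have "\<dots> = (\<integral>\<^sup>+ w. indicator C (Y w) \<partial>M)"
      by (subst nn_integral_distr) auto
    also have "\<dots> = emeasure (density \<nu> Z) C"
      by (subst keyY) (auto simp: emeasure_density mult.commute)
    finally show "emeasure (distr M MY Y) C = emeasure (density \<nu> Z) C" .
  qed
  have sfin: "sigma_finite_measure (distr M MY Y)"
    unfolding law using ae' by (subst n.sigma_finite_iff_density_finite) auto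
  \<comment> \<open>Points with \<open>Z y = 0\<close> are negligible for this law, and up to a null
    set only there may \<open>K y\<close> fail to be a probability measure.\<close>
  have "AE y in distr M MY Y. prob_space (K y)"
    unfolding law using ae' by (subst AE_density, simp, eventually_elim) auto
  then have pr: "AE w in M. prob_space (K (Y w))"
    by (rule AE_distrD[rotated]) simp
  have "emeasure M {w \<in> space M. X w \<in> A \<and> Y w \<in> C} =
        (\<integral>\<^sup>+ w. indicator C (Y w) * emeasure (K (Y w)) A \<partial>M)"
    if [measurable]: "A \<in> sets MX" "C \<in> sets MY" for A C
  proof -
    have "emeasure M {w \<in> space M. X w \<in> A \<and> Y w \<in> C} =
        (\<integral>\<^sup>+ w. indicator {w \<in> space M. X w \<in> A \<and> Y w \<in> C} w \<partial>M)" by simp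
    also have "\<dots> = (\<integral>\<^sup>+ w. indicator A (X w) * indicator C (Y w) \<partial>M)"
      by (intro nn_integral_cong) (auto split: split_indicator)
    also have "\<dots> = (\<integral>\<^sup>+ y. indicator C y * (Z y * emeasure (K y) A) \<partial>\<nu>)" by (rule key) auto
    also have "\<dots> = (\<integral>\<^sup>+ y. indicator C y * emeasure (K y) A * Z y \<partial>\<nu>)"
      by (simp add: mult_ac)
    also have "\<dots> = (\<integral>\<^sup>+ w. indicator C (Y w) * emeasure (K (Y w)) A \<partial>M)"
      by (rule keyY[symmetric]) measurable
    finally show ?thesis .
  qed
  then show ?thesis unfolding cond_law_def using sfin pr Ks by auto
qed

section \<open>Laws given by a density up to a constant\<close>

text \<open>The mass is 1 or 0: a vanishing integral, including the default value 0 for a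
  nonintegrable \<open>g\<close>, makes the quotient in \<open>normalized\<close> zero through
  division by zero.\<close>

lemma emeasure_prop_law_le_1:
  assumes "g \<in> borel_measurable M" "\<And>x. 0 \<le> g x"
  shows "emeasure (prop_law M g) (space M) \<le> 1"
proof -
  have "emeasure (prop_law M g) (space M) = (\<integral>\<^sup>+ x. ennreal (normalized M g x) \<partial>M)"
    unfolding prop_law_def using assms
    by (subst emeasure_density) (auto simp: normalized_def intro!: nn_integral_cong)
  also have "\<dots> = (\<integral>\<^sup>+ x. ennreal (g x) * ennreal (1 / (\<integral>z. g z \<partial>M)) \<partial>M)"
    using assms by (intro nn_integral_cong) (simp add: normalized_def flip: ennreal_mult'')
  also have "\<dots> = (\<integral>\<^sup>+ x. ennreal (g x) \<partial>M) * ennreal (1 / (\<integral>z. g z \<partial>M))"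
    using assms by (intro nn_integral_multc) auto
  also have "\<dots> \<le> 1"
  proof (cases "integrable M g")
    case True
    have "0 \<le> (\<integral>z. g z \<partial>M)" using assms by simp
    then show ?thesis using True assms
      by (subst nn_integral_eq_integral) (auto simp: ennreal_mult'[symmetric])
  qed (simp add: not_integrable_integral_eq)
  finally show ?thesis .
qed

lemma sets_prop_law [simp, measurable_cong]: "sets (prop_law M g) = sets M"
  by (simp add: prop_law_def)

lemma space_prop_law [simp]: "space (prop_law M g) = space M"
  by (simp add: prop_law_def)

text \<open>No integrability is needed: if \<open>g\<close> has no finite integral, \<open>prop_law M g\<close> is the null measure.\<close>

lemma sigma_finite_prop_law:
  assumes "g \<in> borel_measurable M" "\<And>x. 0 \<le> g x"
  shows "sigma_finite_measure (prop_law M g)"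
proof -
  have "finite_measure (prop_law M g)"
    using emeasure_prop_law_le_1[OF assms] by (intro finite_measureI) (auto simp: top_unique)
  then show ?thesis by (rule finite_measure.sigma_finite_measure)
qed

lemma nn_integral_prop_law:
  assumes "g \<in> borel_measurable M" "f \<in> borel_measurable M"
  shows "(\<integral>\<^sup>+ x. f x \<partial>prop_law M g) = (\<integral>\<^sup>+ x. ennreal (g x / (\<integral>z. g z \<partial>M)) * f x \<partial>M)"
  unfolding prop_law_def using assms
  by (subst nn_integral_density) (auto simp: normalized_def)

lemma AE_prop_law:
  assumes "g \<in> borel_measurable M" "\<And>x. x \<in> space M \<Longrightarrow> g x \<noteq> 0 \<Longrightarrow> P x"
  shows "AE x in prop_law M g. P x"
  unfolding prop_law_def using assms
  by (subst AE_density) (auto simp: normalized_def intro!: AE_I2 dest!: less_imp_neq)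

text \<open>Converts a section integral known up to a factor \<open>c\<close> into the form demanded
  by \<open>cond_law_of_splits\<close>; the new constant is \<open>c\<close> times the integral of
  \<open>g\<close>. If that integral is 0, then \<open>g\<close> vanishes almost everywhere and both
  sides are 0.\<close>

lemma prop_law_of_proportional:
  assumes g[measurable]: "g \<in> borel_measurable M" and g0: "\<And>x. 0 \<le> g x" and int: "integrable M g"
    and c: "c < \<infinity>"
    and J: "\<And>A. A \<in> sets M \<Longrightarrow> J A = c * (\<integral>\<^sup>+ x. ennreal (g x) * indicator A x \<partial>M)"
  shows "\<exists>c'<\<infinity>. (c' \<noteq> 0 \<longrightarrow> prob_space (prop_law M g)) \<and>
    (\<forall>A\<in>sets M. J A = c' * emeasure (prop_law M g) A)"
proof (intro exI conjI ballI impI)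
  let ?I = "\<integral>z. g z \<partial>M"
  have I0: "0 \<le> ?I" using g0 by simp
  show "c * ennreal ?I < \<infinity>" using c by (simp add: ennreal_mult_less_top)
  have *: "emeasure (prop_law M g) A = (\<integral>\<^sup>+ x. ennreal (g x) * indicator A x \<partial>M) * ennreal (1 / ?I)"
    if [measurable]: "A \<in> sets M" for A
  proof -
    have "emeasure (prop_law M g) A = (\<integral>\<^sup>+ x. ennreal (g x) * indicator A x * ennreal (1 / ?I) \<partial>M)"
      unfolding prop_law_def
      by (subst emeasure_density)
         (auto simp: normalized_def g0 divide_inverse ennreal_mult'' intro!: nn_integral_cong
               split: split_indicator)
    then show ?thesis by (simp add: nn_integral_multc)
  qed
  show "J A = c * ennreal ?I * emeasure (prop_law M g) A" if A[measurable]: "A \<in> sets M" for A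
  proof (cases "?I = 0")
    case True
    then have "AE x in M. g x = 0"
      using int g0 by (subst (asm) integral_nonneg_eq_0_iff_AE) auto
    then have "(\<integral>\<^sup>+ x. ennreal (g x) * indicator A x \<partial>M) = (\<integral>\<^sup>+ x. 0 \<partial>M)"
      by (intro nn_integral_cong_AE) (auto elim!: eventually_mono)
    then show ?thesis using True J[OF A] by simp
  next
    case False
    then have "ennreal ?I * ennreal (1 / ?I) = 1" using I0 by (simp flip: ennreal_mult'')
    then have "c * ennreal ?I * (x * ennreal (1 / ?I)) = c * x" for x
      by (metis (no_types, lifting) mult.assoc mult.commute mult_1)
    then show ?thesis using J[OF A] *[OF A] by simp
  qed
  show "prob_space (prop_law M g)" if "c * ennreal ?I \<noteq> 0"
  proof (rule prob_spaceI)
    have "0 < ?I" using that I0 by (cases "?I = 0") auto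
    moreover have "(\<integral>\<^sup>+ x. ennreal (g x) * indicator (space M) x \<partial>M) = ennreal ?I"
      using int g0 by (subst nn_integral_eq_integral[symmetric]) (auto intro!: nn_integral_cong)
    ultimately show "emeasure (prop_law M g) (space (prop_law M g)) = 1"
      by (simp add: * flip: ennreal_mult'')
  qed
qed

lemma measurable_emeasure_density:
  assumes "sigma_finite_measure L" "(\<lambda>(y, x). f y x) \<in> borel_measurable (M \<Otimes>\<^sub>M L)" "A \<in> sets L"
  shows "(\<lambda>y. emeasure (density L (f y)) A) \<in> borel_measurable M"
proof -
  interpret sigma_finite_measure L by fact
  note [measurable] = assms(2,3)
  have f: "f y \<in> borel_measurable L" if "y \<in> space M" for y
    using measurable_compose[OF measurable_Pair1'[OF that] assms(2)] by simp
  have "(\<lambda>y. \<integral>\<^sup>+ x. f y x * indicator A x \<partial>L) \<in> borel_measurable M"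
  proof (rule borel_measurable_nn_integral)
    have "(\<lambda>z. (\<lambda>(y, x). f y x) z * indicator A (snd z)) \<in> borel_measurable (M \<Otimes>\<^sub>M L)" by measurable
    then show "(\<lambda>(y, x). f y x * indicator A x) \<in> borel_measurable (M \<Otimes>\<^sub>M L)"
      by (simp add: case_prod_beta)
  qed
  then show ?thesis
    by (rule measurable_cong[THEN iffD1, rotated]) (simp add: emeasure_density f assms(3))
qed

lemma measurable_emeasure_prop_law:
  assumes "sigma_finite_measure L" "(\<lambda>(y, x). g y x) \<in> borel_measurable (M \<Otimes>\<^sub>M L)" "A \<in> sets L"
  shows "(\<lambda>y. emeasure (prop_law L (g y)) A) \<in> borel_measurable M"
proof -
  interpret sigma_finite_measure L by fact
  note [measurable] = assms(2)
  have [measurable]: "(\<lambda>y. \<integral>x. g y x \<partial>L) \<in> borel_measurable M"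
    by (rule borel_measurable_lebesgue_integral) fact
  have "(\<lambda>z. ennreal ((\<lambda>(y, x). g y x) z / (\<integral>x. g (fst z) x \<partial>L))) \<in> borel_measurable (M \<Otimes>\<^sub>M L)"
    by measurable
  then show ?thesis unfolding prop_law_def
    by (intro measurable_emeasure_density assms) (simp add: case_prod_beta normalized_def)
qed

section \<open>Almost sure statements and sigma-finiteness in products\<close>

lemma AE_pair_fst:
  assumes "sigma_finite_measure N" "AE x in M. P x"
  shows "AE w in M \<Otimes>\<^sub>M N. P (fst w)"
proof -
  interpret sigma_finite_measure N by fact
  obtain S where S: "{x \<in> space M. \<not> P x} \<subseteq> S" "emeasure M S = 0" "S \<in> sets M"
    using assms(2) by (rule AE_E)
  have "S \<times> space N \<in> null_sets (M \<Otimes>\<^sub>M N)"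
    using S by (auto simp: null_sets_def emeasure_pair_measure_Times)
  then show ?thesis
    by (rule AE_I') (use S in \<open>auto simp: space_pair_measure\<close>)
qed

lemma AE_pair_snd:
  assumes "sigma_finite_measure N" "AE x in N. P x"
  shows "AE w in M \<Otimes>\<^sub>M N. P (snd w)"
proof -
  interpret sigma_finite_measure N by fact
  obtain S where S: "{x \<in> space N. \<not> P x} \<subseteq> S" "emeasure N S = 0" "S \<in> sets N"
    using assms(2) by (rule AE_E)
  have "space M \<times> S \<in> null_sets (M \<Otimes>\<^sub>M N)"
    using S by (auto simp: null_sets_def emeasure_pair_measure_Times)
  then show ?thesis
    by (rule AE_I') (use S in \<open>auto simp: space_pair_measure\<close>)
qed

text \<open>The prior factors are treated as sigma-finite only, since a law with divergent
  normaliser is the null measure. The cylinder over a null set of one factor is null because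
  splitting off that coordinate makes the inner integral 0.\<close>

lemma AE_PiM_component_sigma_finite:
  assumes M: "\<And>k. sigma_finite_measure (M k)" and I: "finite I" "e \<in> I" and ae: "AE x in M e. P x"
  shows "AE f in PiM I M. P (f e)"
proof -
  obtain S where S: "{x \<in> space (M e). \<not> P x} \<subseteq> S" "emeasure (M e) S = 0" and [measurable]: "S \<in> sets (M e)"
    using ae by (rule AE_E)
  have [measurable]: "(\<lambda>f. f e) \<in> measurable (PiM I M) (M e)" using I by simp
  have "{f \<in> space (PiM I M). f e \<in> S} \<in> null_sets (PiM I M)"
  proof (rule null_setsI)
    have "emeasure (PiM I M) {f \<in> space (PiM I M). f e \<in> S} =
        (\<integral>\<^sup>+ f. indicator {f \<in> space (PiM I M). f e \<in> S} f \<partial>PiM I M)"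
      by (rule nn_integral_indicator[symmetric]) measurable
    also have "\<dots> = (\<integral>\<^sup>+ f. indicator S (f e) \<partial>PiM I M)"
      by (intro nn_integral_cong) (auto split: split_indicator)
    also have "\<dots> = 0"
      using splits_PiM[OF M I] S(2) by (simp add: splits_def)
    finally show "emeasure (PiM I M) {f \<in> space (PiM I M). f e \<in> S} = 0" .
  qed measurable
  then show ?thesis
    by (rule AE_I') (use S I in \<open>auto simp: space_PiM PiE_iff\<close>)
qed

lemma AE_PiM_all_components:
  assumes M: "\<And>k. sigma_finite_measure (M k)" and I: "finite I"
    and ae: "\<And>e. e \<in> I \<Longrightarrow> AE x in M e. P e x"
  shows "AE f in PiM I M. \<forall>e\<in>I. P e (f e)"
  using AE_PiM_component_sigma_finite[OF M I _ ae] I by (intro AE_finite_allI) auto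

lemma sigma_finite_PiM:
  assumes "\<And>k. sigma_finite_measure (M k)" "finite I"
  shows "sigma_finite_measure (PiM I M)"
proof -
  interpret product_sigma_finite M by (rule product_sigma_finite.intro) (rule assms)
  show ?thesis by (rule sigma_finite) fact
qed

lemma sigma_finite_pair:
  assumes "sigma_finite_measure M" "sigma_finite_measure N"
  shows "sigma_finite_measure (M \<Otimes>\<^sub>M N)"
proof -
  interpret pair_sigma_finite M N using assms by (simp add: pair_sigma_finite_def)
  show ?thesis by (rule P.sigma_finite_measure_axioms)
qed

text \<open>Applied three times in \<open>P_eq\<close> to move the density of the \<theta>-entries
  from the innermost part of the prior out to the whole product.\<close>

lemma pair_density_right:
  assumes "sigma_finite_measure R" "g \<in> borel_measurable R" "\<And>x. g x \<noteq> \<infinity>"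
  shows "N \<Otimes>\<^sub>M density R g = density (N \<Otimes>\<^sub>M R) (\<lambda>w. g (snd w))"
proof -
  have "sigma_finite_measure (density R g)"
    using assms by (subst sigma_finite_measure.sigma_finite_iff_density_finite) auto
  then have "density N (\<lambda>_. 1) \<Otimes>\<^sub>M density R g = density (N \<Otimes>\<^sub>M R) (\<lambda>(a, b). 1 * g b)"
    using assms by (intro pair_measure_density) auto
  then show ?thesis by (simp add: density_1 case_prod_unfold)
qed

section \<open>The prior laws\<close>

lemma sets_hyperplane_measure [simp, measurable_cong]: "sets (hyperplane_measure s) = sets (row_space s)"
  by (simp add: hyperplane_measure_def)

lemma space_hyperplane_measure [simp]: "space (hyperplane_measure s) = space (row_space s)"
  by (simp add: hyperplane_measure_def)

text \<open>Outside \<open>I\<close> every element of the product takes the value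
  \<open>undefined\<close>, so the evaluation is constant there. This frees later measurability
  goals from index conditions.\<close>

lemma measurable_PiM_borel_component:
  "(\<lambda>f. f e) \<in> borel_measurable (PiM I (\<lambda>_. borel))"
proof (cases "e \<in> I")
  case False
  then show ?thesis
    by (intro measurable_cong[THEN iffD2, OF _ measurable_const[of undefined]])
       (auto simp: space_PiM PiE_def extensional_def)
qed simp

lemma measurable_matrices_component:
  "(\<lambda>p. p l k) \<in> borel_measurable (matrices I s)"
proof (cases "l \<in> I")
  case True
  then show ?thesis
    using measurable_compose[OF measurable_component_singleton[OF True, of "\<lambda>_. row_space s"]
        measurable_PiM_borel_component[of k]] by simp
next
  case False
  then show ?thesis
    by (intro measurable_cong[THEN iffD2, OF _ measurable_const[of "undefined k"]])
       (auto simp: space_PiM PiE_def extensional_def)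
qed

lemma dirichlet_kernel_measurable:
  "(\<lambda>p. (\<Prod>j\<in>{1..s}. p j powr (g j - 1)) * indicator (prob_simplex s) p) \<in> borel_measurable (hyperplane_measure s)"
  unfolding measurable_cong_sets[OF sets_hyperplane_measure refl]
proof -
  note [measurable] = measurable_PiM_borel_component
  have "{p \<in> space (row_space s). (\<forall>j\<in>{1..s}. 0 \<le> p j) \<and> (\<Sum>j\<in>{1..s}. p j) = 1} \<in> sets (row_space s)"
    by measurable
  then have [measurable]: "Measurable.pred (row_space s) (\<lambda>p. p \<in> prob_simplex s)"
    by (simp add: prob_simplex_def pred_def)
  show "(\<lambda>p. (\<Prod>j\<in>{1..s}. p j powr (g j - 1)) * indicator (prob_simplex s) p) \<in> borel_measurable (row_space s)"
    unfolding indicator_def by measurable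
qed

lemma dirichlet_sets [simp, measurable_cong]: "sets (dirichlet s g) = sets (row_space s)"
  by (simp add: dirichlet_def)

lemma dirichlet_space [simp]: "space (dirichlet s g) = space (row_space s)"
  by (simp add: dirichlet_def)

lemma sigma_finite_dirichlet: "sigma_finite_measure (dirichlet s g)"
  unfolding dirichlet_def using dirichlet_kernel_measurable
  by (intro sigma_finite_prop_law) (auto intro!: mult_nonneg_nonneg prod_nonneg)

lemma AE_dirichlet: "AE p in dirichlet s g. p \<in> prob_simplex s"
  unfolding dirichlet_def using dirichlet_kernel_measurable
  by (intro AE_prop_law) (auto simp: indicator_def split: if_splits)

lemma alpha_support_measurable [measurable]: "alpha_support d \<alpha>0 \<alpha>1 \<in> sets borel"
  by (simp add: alpha_support_def)

lemma sets_alpha_law [simp, measurable_cong]: "sets (alpha_law m c d \<alpha>0 \<alpha>1) = sets borel"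
  by (simp add: alpha_law_def)

lemma sigma_finite_alpha_law: "sigma_finite_measure (alpha_law m c d \<alpha>0 \<alpha>1)"
  unfolding alpha_law_def by (intro sigma_finite_prop_law) auto

lemma AE_alpha_law: "AE a in alpha_law m c d \<alpha>0 \<alpha>1. a \<in> alpha_support d \<alpha>0 \<alpha>1"
  unfolding alpha_law_def by (intro AE_prop_law) (auto simp: indicator_def split: if_splits)

lemma sets_t_law [simp, measurable_cong]: "sets (t_law \<pi>) = sets borel"
  by (cases \<pi>) auto

text \<open>Wanted for every \<open>\<pi>\<close>, valid or not, because sigma-finiteness of the
  factors of a product is assumed at all indices, also at those outside the index set.\<close>

lemma sigma_finite_t_law: "sigma_finite_measure (t_law \<pi>)"
proof (cases \<pi>)
  case (Known t)
  interpret prob_space "return lborel t" by (rule prob_space_return) simp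
  show ?thesis using sigma_finite_measure_axioms Known by simp
next
  case (Uniform t1 t2)
  show ?thesis
  proof (cases "t1 < t2")
    case True
    interpret prob_space "uniform_measure lborel {t1<..<t2}"
      using True by (intro prob_space_uniform_measure) auto
    show ?thesis using sigma_finite_measure_axioms Uniform by simp
  next
    case False
    then have "uniform_measure lborel {t1<..<t2} = density lborel (\<lambda>_. 0)"
      by (simp add: uniform_measure_def)
    then show ?thesis using Uniform
      by (simp add: sigma_finite_measure.sigma_finite_iff_density_finite[OF lborel.sigma_finite_measure_axioms])
  qed
qed

lemma AE_t_law: "valid_t_prior \<pi> \<Longrightarrow> AE t in t_law \<pi>. 0 < t"
proof (cases \<pi>)
  case (Known t)
  assume "valid_t_prior \<pi>"
  then show ?thesis unfolding Known t_law.simps by (subst AE_return) auto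
next
  case (Uniform t1 t2)
  assume "valid_t_prior \<pi>"
  with Uniform have t: "0 \<le> t1" by simp
  show ?thesis unfolding Uniform t_law.simps
    by (rule AE_uniform_measureI) (use t in auto)
qed

section \<open>Gamma integrals\<close>

text \<open>Substitution is done on compact intervals that exhaust the line; their images under
  \<open>exp\<close> exhaust the positive half-line, and continuity from below of the two measures
  with these densities gives the limit.\<close>

lemma nn_integral_exp_substitution:
  assumes [measurable]: "f \<in> borel_measurable borel"
  shows "(\<integral>\<^sup>+ y. f y * indicator {0<..} y \<partial>lborel) = (\<integral>\<^sup>+ r. f (exp r) * ennreal (exp r) \<partial>lborel)"
proof -
  \<comment> \<open>The shift by 1 keeps the intervals nondegenerate even at
    \<open>n = 0\<close>.\<close>
  define A where "A n = {exp (- real n - 1)..exp (real n + 1)}" for n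
  define B where "B n = {- real n - 1..real n + 1}" for n
  have UA: "(\<Union>n. A n) = {0<..}"
  proof (intro equalityI subsetI)
    fix y :: real assume "y \<in> {0<..}"
    then have y: "0 < y" by simp
    obtain n where "\<bar>ln y\<bar> \<le> real n" using real_arch_simple by blast
    then have "- real n - 1 \<le> ln y" "ln y \<le> real n + 1" by auto
    then have "exp (- real n - 1) \<le> exp (ln y)" "exp (ln y) \<le> exp (real n + 1)" by auto
    with y show "y \<in> (\<Union>n. A n)" by (auto simp: A_def)
  qed (auto simp: A_def intro: less_le_trans[OF exp_gt_zero])
  have UB: "(\<Union>n. B n) = UNIV"
  proof (intro equalityI subsetI)
    fix y :: real
    obtain n where "\<bar>y\<bar> \<le> real n" using real_arch_simple by blast
    then show "y \<in> (\<Union>n. B n)" by (auto simp: B_def intro!: exI[of _ n])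
  qed auto
  have "(\<integral>\<^sup>+ y. f y * indicator {0<..} y \<partial>lborel) = emeasure (density lborel f) (\<Union>n. A n)"
    by (simp add: UA emeasure_density)
  also have "\<dots> = (SUP n. emeasure (density lborel f) (A n))"
    by (rule SUP_emeasure_incseq[symmetric]) (auto simp: A_def incseq_def)
  also have "\<dots> = (SUP n. emeasure (density lborel (\<lambda>r. f (exp r) * ennreal (exp r))) (B n))"
  proof (rule SUP_cong[OF refl])
    fix n
    have "(\<integral>\<^sup>+ y. f y * indicator {exp (- real n - 1)..exp (real n + 1)} y \<partial>lborel) =
        (\<integral>\<^sup>+ r. f (exp r) * ennreal (exp r) * indicator {- real n - 1..real n + 1} r \<partial>lborel)"
      by (rule nn_integral_substitution_aux) (auto intro!: derivative_eq_intros continuous_intros)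
    then show "emeasure (density lborel f) (A n) =
        emeasure (density lborel (\<lambda>r. f (exp r) * ennreal (exp r))) (B n)"
      by (simp add: A_def B_def emeasure_density)
  qed
  also have "\<dots> = emeasure (density lborel (\<lambda>r. f (exp r) * ennreal (exp r))) (\<Union>n. B n)"
    by (rule SUP_emeasure_incseq) (auto simp: B_def incseq_def)
  also have "\<dots> = (\<integral>\<^sup>+ r. f (exp r) * ennreal (exp r) \<partial>lborel)"
    by (simp add: UB emeasure_density)
  finally show ?thesis .
qed

text \<open>After \<open>y = exp r\<close> a power map becomes a linear one.\<close>

lemma nn_integral_powr_substitution:
  fixes a :: real
  assumes f[measurable]: "f \<in> borel_measurable borel" and a: "a \<noteq> 0"
  shows "(\<integral>\<^sup>+ y. f y * indicator {0<..} y \<partial>lborel) =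
    (\<integral>\<^sup>+ x. f (x powr a) * ennreal (\<bar>a\<bar> * x powr (a - 1)) * indicator {0<..} x \<partial>lborel)"
proof -
  have "(\<integral>\<^sup>+ y. f y * indicator {0<..} y \<partial>lborel) = (\<integral>\<^sup>+ r. f (exp r) * ennreal (exp r) \<partial>lborel)"
    by (rule nn_integral_exp_substitution) fact
  also have "\<dots> = ennreal \<bar>a\<bar> * (\<integral>\<^sup>+ r. f (exp (a * r)) * ennreal (exp (a * r)) \<partial>lborel)"
    by (subst nn_integral_real_affine[where c=a and t=0]) (use a in auto)
  also have "\<dots> = (\<integral>\<^sup>+ r. ennreal \<bar>a\<bar> * (f (exp (a * r)) * ennreal (exp (a * r))) \<partial>lborel)"
    by (rule nn_integral_cmult[symmetric]) measurable
  also have "\<dots> = (\<integral>\<^sup>+ r. f (exp r powr a) * ennreal (\<bar>a\<bar> * exp r powr (a - 1)) * ennreal (exp r) \<partial>lborel)"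
  proof (rule nn_integral_cong)
    fix r
    have "\<bar>a\<bar> * exp (a * r) = \<bar>a\<bar> * exp r powr (a - 1) * exp r"
      by (simp add: powr_def algebra_simps flip: exp_add)
    then have "ennreal \<bar>a\<bar> * ennreal (exp (a * r)) = ennreal (\<bar>a\<bar> * exp r powr (a - 1)) * ennreal (exp r)"
      by (simp flip: ennreal_mult'')
    then show "ennreal \<bar>a\<bar> * (f (exp (a * r)) * ennreal (exp (a * r))) =
        f (exp r powr a) * ennreal (\<bar>a\<bar> * exp r powr (a - 1)) * ennreal (exp r)"
      by (simp add: powr_def mult_ac) (metis mult.commute mult.left_commute)
  qed
  also have "\<dots> = (\<integral>\<^sup>+ x. f (x powr a) * ennreal (\<bar>a\<bar> * x powr (a - 1)) * indicator {0<..} x \<partial>lborel)"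
    by (subst nn_integral_exp_substitution) auto
  finally show ?thesis .
qed

text \<open>Euler's integral after \<open>t = B * x\<close>; the Jacobian \<open>B\<close> joins
  \<open>B powr (M - 1)\<close> to give the power in the denominator.\<close>

lemma nn_integral_gamma_kernel:
  fixes M B :: real
  assumes M: "0 < M" and B: "0 < B"
  shows "(\<integral>\<^sup>+ x. ennreal (x powr (M - 1) * exp (- B * x) * indicator {0<..} x) \<partial>lborel) = ennreal (Gamma M / B powr M)"
proof -
  have "ennreal (Gamma M) = (\<integral>\<^sup>+ t. ennreal (indicator {0..} t * t powr (M - 1) / exp t) \<partial>lborel)"
    by (rule Gamma_conv_nn_integral_real) fact
  also have "\<dots> = (\<integral>\<^sup>+ t. ennreal (t powr (M - 1) * exp (- t) * indicator {0<..} t) \<partial>lborel)"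
    by (intro nn_integral_cong arg_cong[where f=ennreal]) (auto simp: exp_minus field_simps split: split_indicator)
  also have "\<dots> = ennreal \<bar>B\<bar> * (\<integral>\<^sup>+ x. ennreal ((0 + B * x) powr (M - 1) * exp (- (0 + B * x)) * indicator {0<..} (0 + B * x)) \<partial>lborel)"
    by (rule nn_integral_real_affine) (use B in auto)
  also have "\<dots> = ennreal B * (\<integral>\<^sup>+ x. ennreal (B powr (M - 1)) * ennreal (x powr (M - 1) * exp (- B * x) * indicator {0<..} x) \<partial>lborel)"
    using B by (intro arg_cong2[where f="(*)"] nn_integral_cong)
      (auto simp: powr_mult zero_less_mult_iff ennreal_mult'[symmetric] split: split_indicator)
  also have "\<dots> = ennreal B * (ennreal (B powr (M - 1)) * (\<integral>\<^sup>+ x. ennreal (x powr (M - 1) * exp (- B * x) * indicator {0<..} x) \<partial>lborel))"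
    by (subst nn_integral_cmult) auto
  also have "\<dots> = ennreal (B powr M) * (\<integral>\<^sup>+ x. ennreal (x powr (M - 1) * exp (- B * x) * indicator {0<..} x) \<partial>lborel)"
  proof -
    have "B * B powr (M - 1) = B powr M" using B by (simp add: powr_diff)
    then show ?thesis using B by (simp add: mult.assoc[symmetric] ennreal_mult'[symmetric])
  qed
  finally have *: "ennreal (Gamma M) = ennreal (B powr M) * (\<integral>\<^sup>+ x. ennreal (x powr (M - 1) * exp (- B * x) * indicator {0<..} x) \<partial>lborel)" .
  have "ennreal (Gamma M / B powr M) = ennreal (1 / B powr M) * ennreal (Gamma M)"
    by (simp flip: ennreal_mult')
  also have "\<dots> = ennreal (1 / B powr M) * ennreal (B powr M) * (\<integral>\<^sup>+ x. ennreal (x powr (M - 1) * exp (- B * x) * indicator {0<..} x) \<partial>lborel)"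
    by (simp only: * mult.assoc)
  also have "ennreal (1 / B powr M) * ennreal (B powr M) = 1"
    using B by (simp flip: ennreal_mult')
  finally show ?thesis by simp
qed

lemma emeasure_inv_gamma:
  assumes M: "0 < M" and B: "0 < B" and A[measurable]: "A \<in> sets borel"
  shows "(\<integral>\<^sup>+ y. ennreal (y powr (- M - 1) * exp (- B / y) * indicator {0<..} y) * indicator A y \<partial>lborel) =
    ennreal (Gamma M / B powr M) * emeasure (inv_gamma M B) A"
proof -
  have G: "0 < Gamma M" using M by (rule Gamma_real_pos)
  have "emeasure (inv_gamma M B) A =
      (\<integral>\<^sup>+ y. ennreal (B powr M / Gamma M) * (ennreal (y powr (- M - 1) * exp (- B / y) * indicator {0<..} y) * indicator A y) \<partial>lborel)"
    unfolding inv_gamma_def using G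
    by (subst emeasure_density) (auto intro!: nn_integral_cong simp: ennreal_mult'[symmetric] split: split_indicator)
  also have "\<dots> = ennreal (B powr M / Gamma M) * (\<integral>\<^sup>+ y. ennreal (y powr (- M - 1) * exp (- B / y) * indicator {0<..} y) * indicator A y \<partial>lborel)"
    by (rule nn_integral_cmult) measurable
  finally have "ennreal (Gamma M / B powr M) * emeasure (inv_gamma M B) A =
     ennreal (Gamma M / B powr M) * ennreal (B powr M / Gamma M) * (\<integral>\<^sup>+ y. ennreal (y powr (- M - 1) * exp (- B / y) * indicator {0<..} y) * indicator A y \<partial>lborel)"
    by (simp add: mult.assoc)
  also have "ennreal (Gamma M / B powr M) * ennreal (B powr M / Gamma M) = 1"
    using B G by (simp flip: ennreal_mult')
  finally show ?thesis by simp
qed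

text \<open>Inversion is the power substitution with exponent -1; it turns the inverse Gamma kernel
  into the Gamma kernel, with the same normalising constant.\<close>

lemma prob_space_inv_gamma:
  assumes M: "0 < M" and B: "0 < B"
  shows "prob_space (inv_gamma M B)"
proof (rule prob_spaceI)
  have G: "0 < Gamma M" using M by (rule Gamma_real_pos)
  have "(\<integral>\<^sup>+ y. ennreal (y powr (- M - 1) * exp (- B / y)) * indicator {0<..} y \<partial>lborel) =
      (\<integral>\<^sup>+ x. ennreal ((x powr (-1)) powr (- M - 1) * exp (- B / (x powr (-1)))) * ennreal (\<bar>-1\<bar> * x powr (-1 - 1)) * indicator {0<..} x \<partial>lborel)"
    by (rule nn_integral_powr_substitution) auto
  also have "\<dots> = (\<integral>\<^sup>+ x. ennreal (x powr (M - 1) * exp (- B * x) * indicator {0<..} x) \<partial>lborel)"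
  proof (rule nn_integral_cong)
    fix x :: real
    show "ennreal ((x powr (-1)) powr (- M - 1) * exp (- B / (x powr (-1)))) * ennreal (\<bar>-1\<bar> * x powr (-1 - 1)) * indicator {0<..} x =
      ennreal (x powr (M - 1) * exp (- B * x) * indicator {0<..} x)"
    proof (cases "0 < x")
      case True
      have "(x powr (-1)) powr (- M - 1) * x powr (-1 - 1) = x powr (M - 1)"
        unfolding powr_powr powr_add[symmetric] by (rule arg_cong) simp
      moreover have "- B / (x powr (-1)) = - B * x" using True by (simp add: powr_minus_divide)
      ultimately show ?thesis using True
        by (simp add: ennreal_mult''[symmetric] mult_ac)
    qed simp
  qed
  also have "\<dots> = ennreal (Gamma M / B powr M)" by (rule nn_integral_gamma_kernel) fact+
  finally have "(\<integral>\<^sup>+ y. ennreal (y powr (- M - 1) * exp (- B / y)) * indicator {0<..} y \<partial>lborel) = ennreal (Gamma M / B powr M)" .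
  moreover have "(\<integral>\<^sup>+ y. ennreal (y powr (- M - 1) * exp (- B / y) * indicator {0<..} y) * indicator UNIV y \<partial>lborel) =
     (\<integral>\<^sup>+ y. ennreal (y powr (- M - 1) * exp (- B / y)) * indicator {0<..} y \<partial>lborel)"
    by (intro nn_integral_cong) (auto split: split_indicator)
  ultimately have "ennreal (Gamma M / B powr M) * emeasure (inv_gamma M B) UNIV = ennreal (Gamma M / B powr M) * 1"
    using emeasure_inv_gamma[OF M B, of UNIV] by simp
  then have "emeasure (inv_gamma M B) UNIV = 1"
    using G B by (subst (asm) ennreal_mult_cancel_left) auto
  then show "emeasure (inv_gamma M B) (space (inv_gamma M B)) = 1" by (simp add: inv_gamma_def)
qed

section \<open>The factor of a single string\<close>

text \<open>The part of the rate b that does not involve t. It makes t the q-quantile of the holding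
  time under the prior: averaging the survival function
  \<open>exp (- (t / \<theta>) powr \<alpha>)\<close> over the generalized inverse Gamma law gives
  \<open>(1 + t powr \<alpha> / b) powr (- m)\<close>, and for this b the value is
  \<open>1 - q\<close>.\<close>

definition b_coeff :: "real \<Rightarrow> real \<Rightarrow> real" where
  "b_coeff m q = inverse ((1 - q) powr (- 1 / m) - 1)"

lemma b_rate_eq: "b_rate m q t a = t powr a * b_coeff m q"
  by (simp add: b_rate_def b_coeff_def)

lemma b_coeff_pos:
  assumes "0 < m" "0 < q" "q < 1"
  shows "0 < b_coeff m q"
proof -
  have "1 < (1 - q) powr (- 1 / m)"
  proof -
    have "1 powr (- 1 / m) < (1 - q) powr (- 1 / m)"
      by (rule powr_less_mono2_neg) (use assms in auto)
    then show ?thesis by simp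
  qed
  then show ?thesis by (simp add: b_coeff_def)
qed

lemma b_rate_pos:
  assumes "0 < m" "0 < q" "q < 1" "0 < t"
  shows "0 < b_rate m q t a"
  using assms b_coeff_pos by (simp add: b_rate_eq)

lemma visit_time_pos:
  assumes "positive_times \<tau> (js, x, u)" "r \<in> {1..N_visits \<tau> j0 js i k}"
  shows "0 < visit_time \<tau> j0 js x i k r"
proof -
  have fin: "finite (visits \<tau> j0 js i k)" by (simp add: visits_def)
  have "sorted_list_of_set (visits \<tau> j0 js i k) ! (r - 1) \<in> set (sorted_list_of_set (visits \<tau> j0 js i k))"
    using assms(2) by (intro nth_mem) (auto simp: N_visits_def)
  then have "sorted_list_of_set (visits \<tau> j0 js i k) ! (r - 1) \<in> {1..\<tau>}"
    using fin by (auto simp: visits_def)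
  then show ?thesis using assms(1) by (auto simp: visit_time_def positive_times_def)
qed

lemma C_stat_pos:
  assumes "positive_times \<tau> (js, x, u)"
  shows "0 < C_stat \<tau> j0 js x i k"
  unfolding C_stat_def by (intro prod_pos visit_time_pos[OF assms])

lemma M_tilde_nonneg: "0 \<le> M_tilde \<tau> j0 dat jn i k a"
  by (cases dat) (auto simp: M_tilde_def M_stat_def intro!: add_nonneg_nonneg sum_nonneg)

text \<open>The factor of likelihood times prior that involves \<open>\<alpha>\<close>, \<open>\<theta>\<close> and \<open>t\<close> at the string \<open>(i,k)\<close>.\<close>

definition cell ::
  "nat \<Rightarrow> nat \<Rightarrow> real \<Rightarrow> real \<Rightarrow> obs \<Rightarrow> nat \<Rightarrow> nat \<Rightarrow> nat \<Rightarrow> real \<Rightarrow> real \<Rightarrow> real \<Rightarrow> real"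
where
  "cell \<tau> j0 m q = (\<lambda>(js, x, u) jn i k a \<theta> t.
     a ^ N_visits \<tau> j0 js i k / \<theta> powr (a * real (N_visits \<tau> j0 js i k)) *
     C_stat \<tau> j0 js x i k powr (a - 1) *
     exp (- (M_tilde \<tau> j0 (js, x, u) jn i k a / \<theta> powr a)) *
     gig_density m (b_rate m q t a) a \<theta>)"

text \<open>Conjugacy of the scale: the powers of \<theta> from data and prior merge and the two
  exponentials add their rates, so the kernel is again generalized inverse Gamma, with shape
  \<open>m + N\<close>. For \<open>\<theta> \<le> 0\<close> both sides vanish through the
  indicator.\<close>

lemma cell_theta:
  "cell \<tau> j0 m q (js, x, u) jn i k a \<theta> t =
     (a ^ N_visits \<tau> j0 js i k * C_stat \<tau> j0 js x i k powr (a - 1) * (a * b_rate m q t a powr m / Gamma m)) *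
     (\<theta> powr (- (1 + (m + real (N_visits \<tau> j0 js i k)) * a)) *
      exp (- (b_rate m q t a + M_tilde \<tau> j0 (js, x, u) jn i k a) / \<theta> powr a) * indicator {0<..} \<theta>)"
proof (cases "0 < \<theta>")
  case True
  define N where "N = real (N_visits \<tau> j0 js i k)"
  have "\<theta> powr (- (1 + m * a)) / \<theta> powr (a * N) = \<theta> powr (- (1 + (m + N) * a))"
    by (simp add: powr_diff[symmetric] algebra_simps)
  moreover have "exp (- (M_tilde \<tau> j0 (js, x, u) jn i k a / \<theta> powr a)) * exp (- b_rate m q t a / \<theta> powr a) =
      exp (- (b_rate m q t a + M_tilde \<tau> j0 (js, x, u) jn i k a) / \<theta> powr a)"
    by (simp add: add_divide_distrib diff_divide_distrib flip: exp_add)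
  ultimately show ?thesis using True
    by (simp add: cell_def gig_density_def flip: N_def) (simp add: field_simps)
qed (simp add: cell_def gig_density_def)

text \<open>The powers \<open>C powr a\<close>, \<open>t powr (m * a)\<close> and
  \<open>\<theta> powr ((N + m) * a)\<close> are exponentials of linear functions of
  \<open>a\<close>; this is the origin of the logarithm in the kernel. What stays outside is free of
  \<open>a\<close>: \<open>C\<close> from \<open>C powr (a - 1)\<close>, one factor \<theta> from
  the exponent \<open>1 + (m + N) * a\<close>, and the constants of the prior.\<close>

lemma cell_alpha:
  assumes "positive_times \<tau> (js, x, u)" "0 < \<theta>" "0 < t" "0 < a" "0 < m" "0 < q" "q < 1"
  shows "cell \<tau> j0 m q (js, x, u) jn i k a \<theta> t *
      (a powr (m - c) * (a - \<alpha>0) powr (c - 1) * exp (- m * d * a) * indicator (alpha_support d \<alpha>0 \<alpha>1) a) =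
    (b_coeff m q powr m / (Gamma m * C_stat \<tau> j0 js x i k * \<theta>)) *
      alpha_kernel \<tau> j0 m q c d \<alpha>0 \<alpha>1 i k (js, x, u) jn \<theta> t a"
proof -
  define N where "N = N_visits \<tau> j0 js i k"
  define C where "C = C_stat \<tau> j0 js x i k"
  define M where "M = M_tilde \<tau> j0 (js, x, u) jn i k a"
  define b where "b = b_rate m q t a"
  define L where "L = ln (C * t powr m / \<theta> powr (real N + m))"
  have C: "0 < C" unfolding C_def by (rule C_stat_pos) fact
  have \<kappa>: "0 < b_coeff m q" by (rule b_coeff_pos) fact+
  have p1: "a ^ N * a * a powr (m - c) = a powr (real N + 1 + m - c)"
    using assms by (simp add: powr_add powr_diff powr_realpow)
  have p2: "b powr m = t powr (m * a) * b_coeff m q powr m"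
    unfolding b_def b_rate_eq using assms \<kappa> by (simp add: powr_mult powr_powr mult.commute)
  have p3: "exp (- (m * d - L) * a) = exp (- m * d * a) * (C powr a * t powr (m * a) / \<theta> powr ((real N + m) * a))"
  proof -
    have L: "L = ln C + m * ln t - (real N + m) * ln \<theta>"
      unfolding L_def using C assms by (simp add: ln_mult ln_div ln_powr)
    have *: "- (m * d - L) * a = - m * d * a + (a * ln C + (m * a) * ln t - ((real N + m) * a) * ln \<theta>)"
      unfolding L by (simp add: algebra_simps)
    show ?thesis unfolding * exp_add exp_diff using C assms by (simp add: powr_def)
  qed
  have p4: "exp (- ((b + M) / \<theta> powr a)) = exp (- (b + M) / \<theta> powr a)" by (simp only: minus_divide_left)
  have p5: "\<theta> powr (- (1 + (m + real N) * a)) = 1 / (\<theta> * \<theta> powr ((real N + m) * a))"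
    unfolding powr_minus_divide powr_add using assms by (simp add: add.commute)
  have p6: "C powr (a - 1) = C powr a / C" using C by (simp add: powr_diff)
  show ?thesis
    using assms C unfolding cell_theta alpha_kernel_def Let_def prod.case
      N_def[symmetric] C_def[symmetric] M_def[symmetric] b_def[symmetric] L_def[symmetric]
    unfolding p3 p5 p6 p2 p4 p1[symmetric]
    by (simp add: field_simps)
qed

text \<open>Writing every power as an exponential in \<open>a\<close> breaks the exponent into one
  term \<open>l * a - exp (l * a)\<close> per visit, one term from the prior of \<theta> and one
  from the censored time. Integrability uses that these terms are bounded above, log-concavity that
  they are concave.\<close>

lemma alpha_kernel_exponent:
  assumes pos: "positive_times \<tau> (js, x, u)" "0 < \<theta>" "0 < t"
  shows "alpha_kernel \<tau> j0 m q c d \<alpha>0 \<alpha>1 i k (js, x, u) jn \<theta> t a =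
    a powr (real (N_visits \<tau> j0 js i k) + 1 + m - c) * (a - \<alpha>0) powr (c - 1) * exp (- (m * d * a)) *
    exp ((\<Sum>r\<in>{1..N_visits \<tau> j0 js i k}.
        ln (visit_time \<tau> j0 js x i k r / \<theta>) * a - exp (ln (visit_time \<tau> j0 js x i k r / \<theta>) * a)) +
      (m * ln (t / \<theta>) * a - b_coeff m q * exp (ln (t / \<theta>) * a)) -
      of_bool ((state_at j0 js \<tau>, jn) = (i, k)) * exp (ln (u / \<theta>) * a)) *
    indicator (alpha_support d \<alpha>0 \<alpha>1) a"
proof -
  define N where "N = N_visits \<tau> j0 js i k"
  define C where "C = C_stat \<tau> j0 js x i k"
  define y where "y r = visit_time \<tau> j0 js x i k r" for r
  define v :: real where "v = of_bool ((state_at j0 js \<tau>, jn) = (i, k))"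
  have y: "0 < y r" if "r \<in> {1..N}" for r
    unfolding y_def using that by (intro visit_time_pos[OF pos(1)]) (simp add: N_def)
  have u: "0 < u" using pos by (simp add: positive_times_def)
  have C: "0 < C" unfolding C_def by (rule C_stat_pos) fact
  have "ln (C * t powr m / \<theta> powr (real N + m)) = ln C + m * ln t - (real N + m) * ln \<theta>"
    using C assms by (simp add: ln_mult ln_div ln_powr)
  also have "ln C = (\<Sum>r\<in>{1..N}. ln (y r))"
    unfolding C_def C_stat_def N_def y_def
    by (rule ln_prod) (use y in \<open>fastforce simp: N_def y_def\<close>)+
  also have "\<dots> + m * ln t - (real N + m) * ln \<theta> = (\<Sum>r\<in>{1..N}. ln (y r / \<theta>)) + m * ln (t / \<theta>)"
  proof -
    have "(\<Sum>r\<in>{1..N}. ln (y r / \<theta>)) = (\<Sum>r\<in>{1..N}. ln (y r) - ln \<theta>)"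
    proof (intro sum.cong refl)
      fix r assume "r \<in> {1..N}"
      from y[OF this] show "ln (y r / \<theta>) = ln (y r) - ln \<theta>" using pos by (simp add: ln_div)
    qed
    then show ?thesis using pos by (simp add: ln_div sum_subtractf algebra_simps)
  qed
  finally have L: "ln (C * t powr m / \<theta> powr (real N + m)) = (\<Sum>r\<in>{1..N}. ln (y r / \<theta>)) + m * ln (t / \<theta>)" .
  \<comment> \<open>Division by \<open>\<theta> powr a\<close> is absorbed into the logarithm, so
    linear and exponential terms carry the same slope \<open>ln (w / \<theta>)\<close> and can be
    paired.\<close>
  have pw: "w powr a / \<theta> powr a = exp (ln (w / \<theta>) * a)" if "0 < w" for w
    using that pos by (simp add: powr_def ln_div right_diff_distrib exp_diff mult.commute)
  have "(b_rate m q t a + M_tilde \<tau> j0 (js, x, u) jn i k a) / \<theta> powr a =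
     b_coeff m q * (t powr a / \<theta> powr a) + (\<Sum>r\<in>{1..N}. y r powr a / \<theta> powr a) + v * (u powr a / \<theta> powr a)"
    by (simp add: b_rate_eq M_tilde_def M_stat_def N_def y_def v_def add_divide_distrib sum_divide_distrib)
  also have "\<dots> = b_coeff m q * exp (ln (t / \<theta>) * a) + (\<Sum>r\<in>{1..N}. exp (ln (y r / \<theta>) * a)) + v * exp (ln (u / \<theta>) * a)"
    using sum.cong[OF refl pw[OF y], of "{1..N}"] pw[OF pos(3)] pw[OF u] by simp
  finally have E: "(b_rate m q t a + M_tilde \<tau> j0 (js, x, u) jn i k a) / \<theta> powr a = \<dots>" .
  have "exp (- (m * d - ln (C * t powr m / \<theta> powr (real N + m))) * a) *
      exp (- ((b_rate m q t a + M_tilde \<tau> j0 (js, x, u) jn i k a) / \<theta> powr a)) =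
    exp (- (m * d * a)) * exp ((\<Sum>r\<in>{1..N}. ln (y r / \<theta>) * a - exp (ln (y r / \<theta>) * a)) +
      (m * ln (t / \<theta>) * a - b_coeff m q * exp (ln (t / \<theta>) * a)) - v * exp (ln (u / \<theta>) * a))"
    unfolding L E by (simp add: exp_add[symmetric] sum_subtractf sum_distrib_left algebra_simps)
  then show ?thesis
    unfolding alpha_kernel_def Let_def prod.case N_def[symmetric] C_def[symmetric] y_def[symmetric] v_def[symmetric]
    by (simp add: mult.assoc)
qed

section \<open>Integrability and log-concavity of the kernel of a shape parameter\<close>

text \<open>The left side is maximal at \<open>w = m / k\<close>, with value
  \<open>m * ln (m / k) - m\<close>; the bound drops the last summand.\<close>

lemma mult_ln_diff_le:
  fixes w m k :: real
  assumes "0 < w" "0 < m" "0 < k"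
  shows "m * ln w - k * w \<le> m * ln (m / k)"
proof -
  have "ln (k * w / m) \<le> k * w / m - 1" by (rule ln_le_minus_one) (use assms in auto)
  then have "m * ln (k * w / m) \<le> m * (k * w / m - 1)" using assms by simp
  also have "\<dots> \<le> k * w" using assms by (simp add: field_simps)
  finally show ?thesis using assms by (simp add: ln_mult ln_div algebra_simps)
qed

lemma alpha_kernel_nonneg: "0 \<le> alpha_kernel \<tau> j0 m q c d \<alpha>0 \<alpha>1 i k dat jn \<theta> t a"
  by (cases dat) (simp add: alpha_kernel_def Let_def)

text \<open>For positive \<open>p\<close> the exponential wins over the power, by
  \<open>mult_ln_diff_le\<close>. For \<open>p \<le> 0\<close> the power is largest at
  \<open>a0\<close>, which is why \<open>a\<close> must stay away from 0.\<close>

lemma powr_exp_bounded: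
  fixes p e a0 :: real
  assumes "0 < e" "0 < a0"
  obtains K where "0 \<le> K" "\<And>a. a0 \<le> a \<Longrightarrow> a powr p * exp (- (e * a)) \<le> K"
proof (cases "0 < p")
  case True
  show ?thesis
  proof (rule that)
    fix a assume "a0 \<le> a"
    then have a: "0 < a" using assms by simp
    have "p * ln a - e * a \<le> p * ln (p / e)" by (rule mult_ln_diff_le) (use a True assms in auto)
    then show "a powr p * exp (- (e * a)) \<le> exp (p * ln (p / e))"
      using a by (simp add: powr_def flip: exp_add)
  qed simp
next
  case False
  show ?thesis
  proof (rule that)
    fix a assume a: "a0 \<le> a"
    have "a powr p \<le> a0 powr p" by (rule powr_mono2') (use a False assms in auto)
    then show "a powr p * exp (- (e * a)) \<le> a0 powr p * 1"
      using a assms by (intro mult_mono) auto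
  qed simp
qed

text \<open>An exponential tail has to survive after the power has been absorbed. If
  \<open>d > 0\<close>, half of the rate \<open>m * d\<close> absorbs the power and the other half
  remains. If \<open>d = 0\<close>, the support is bounded and a tail can be inserted at the cost of
  a constant.\<close>

lemma alpha_prior_tail:
  fixes p \<alpha>0 \<alpha>1 m d :: real
  assumes "0 < m" "0 \<le> d" "0 < \<alpha>0"
  obtains K e where "0 \<le> K" "0 < e"
    "\<And>a. a \<in> alpha_support d \<alpha>0 \<alpha>1 \<Longrightarrow> a powr p * exp (- (m * d * a)) \<le> K * exp (- (e * a))"
proof (cases "d = 0")
  case True
  obtain K where K: "0 \<le> K" "\<And>a. \<alpha>0 \<le> a \<Longrightarrow> a powr p * exp (- (1 * a)) \<le> K"
    using powr_exp_bounded[of 1 \<alpha>0 p] assms by auto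
  show ?thesis
  proof (rule that[of "K * exp (2 * \<alpha>1)" 1])
    fix a assume "a \<in> alpha_support d \<alpha>0 \<alpha>1"
    then have a: "\<alpha>0 < a" "a < \<alpha>1" using True by (auto simp: alpha_support_def)
    \<comment> \<open>The factor 1 is split into three exponentials: one absorbs the power,
      \<open>exp (2 * a)\<close> is bounded by \<open>exp (2 * \<alpha>1)\<close>, and the last one
      is the required tail.\<close>
    have "a powr p * exp (- (m * d * a)) = (a powr p * exp (- (1 * a))) * exp (2 * a) * exp (- (1 * a))"
      using True by (simp add: mult.assoc flip: exp_add)
    also have "\<dots> \<le> K * exp (2 * \<alpha>1) * exp (- (1 * a))"
      using K a by (intro mult_right_mono mult_mono) auto
    finally show "a powr p * exp (- (m * d * a)) \<le> K * exp (2 * \<alpha>1) * exp (- (1 * a))" .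
  qed (use K in auto)
next
  case False
  then have d: "0 < m * d / 2" using assms by simp
  obtain K where K: "0 \<le> K" "\<And>a. \<alpha>0 \<le> a \<Longrightarrow> a powr p * exp (- (m * d / 2 * a)) \<le> K"
    using powr_exp_bounded[of "m * d / 2" \<alpha>0 p] assms d by auto
  show ?thesis
  proof (rule that[of K "m * d / 2"])
    fix a assume "a \<in> alpha_support d \<alpha>0 \<alpha>1"
    then have a: "\<alpha>0 \<le> a" using False by (auto simp: alpha_support_def)
    have "a powr p * exp (- (m * d * a)) = (a powr p * exp (- (m * d / 2 * a))) * exp (- (m * d / 2 * a))"
      by (simp add: mult.assoc flip: exp_add)
    also have "\<dots> \<le> K * exp (- (m * d / 2 * a))"
      using K a by (intro mult_right_mono) auto
    finally show "a powr p * exp (- (m * d * a)) \<le> K * exp (- (m * d / 2 * a))" .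
  qed (use K d in auto)
qed

lemma nn_integral_shifted_gamma_kernel_finite:
  fixes c e \<alpha>0 :: real
  assumes "0 < c" "0 < e"
  shows "(\<integral>\<^sup>+ a. ennreal ((a - \<alpha>0) powr (c - 1) * exp (- (e * a)) * indicator {\<alpha>0<..} a) \<partial>lborel) < \<infinity>"
proof -
  have "(\<integral>\<^sup>+ a. ennreal ((a - \<alpha>0) powr (c - 1) * exp (- (e * a)) * indicator {\<alpha>0<..} a) \<partial>lborel) =
    ennreal \<bar>1\<bar> * (\<integral>\<^sup>+ x. ennreal ((\<alpha>0 + 1 * x - \<alpha>0) powr (c - 1) * exp (- (e * (\<alpha>0 + 1 * x))) * indicator {\<alpha>0<..} (\<alpha>0 + 1 * x)) \<partial>lborel)"
    by (rule nn_integral_real_affine) auto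
  also have "\<dots> = (\<integral>\<^sup>+ x. ennreal (exp (- (e * \<alpha>0))) * ennreal (x powr (c - 1) * exp (- e * x) * indicator {0<..} x) \<partial>lborel)"
    by (simp, intro nn_integral_cong)
       (auto simp: ennreal_mult'[symmetric] distrib_left exp_diff exp_minus field_simps exp_add split: split_indicator)
  also have "\<dots> = ennreal (exp (- (e * \<alpha>0))) * ennreal (Gamma c / e powr c)"
    by (subst nn_integral_cmult, simp) (use nn_integral_gamma_kernel[OF assms] in simp)
  also have "\<dots> < \<infinity>" by (simp add: ennreal_mult_less_top)
  finally show ?thesis .
qed

lemma alpha_kernel_measurable:
  "alpha_kernel \<tau> j0 m q c d \<alpha>0 \<alpha>1 i k dat jn \<theta> t \<in> borel_measurable borel"
  by (cases dat) (simp add: alpha_kernel_def Let_def M_tilde_def M_stat_def b_rate_def)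

lemma alpha_kernel_integrable:
  assumes pos: "positive_times \<tau> dat" "0 < \<theta>" "0 < t"
    and par: "0 < m" "0 < q" "q < 1" "0 < c" "0 \<le> d" "0 < \<alpha>0"
  shows "integrable lborel (alpha_kernel \<tau> j0 m q c d \<alpha>0 \<alpha>1 i k dat jn \<theta> t)"
proof (rule integrableI_nonneg)
  obtain js x u where dat: "dat = (js, x, u)" by (cases dat) auto
  define p where "p = real (N_visits \<tau> j0 js i k) + 1 + m - c"
  \<comment> \<open>Bounds the exponential of the t-term uniformly in \<open>a\<close>, by
    \<open>mult_ln_diff_le\<close> at \<open>w = (t / \<theta>) powr a\<close>.\<close>
  define E where "E = exp (m * ln (m / b_coeff m q))"
  obtain K e where K: "0 \<le> K" "0 < e"
    "\<And>a. a \<in> alpha_support d \<alpha>0 \<alpha>1 \<Longrightarrow> a powr p * exp (- (m * d * a)) \<le> K * exp (- (e * a))"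
    using alpha_prior_tail[of m d \<alpha>0 \<alpha>1 p] par by blast
  have bnd: "alpha_kernel \<tau> j0 m q c d \<alpha>0 \<alpha>1 i k dat jn \<theta> t a \<le>
      K * E * ((a - \<alpha>0) powr (c - 1) * exp (- (e * a)) * indicator {\<alpha>0<..} a)" for a
  proof (cases "a \<in> alpha_support d \<alpha>0 \<alpha>1")
    case True
    then have a: "\<alpha>0 < a" by (auto simp: alpha_support_def split: if_splits)
    let ?S = "\<Sum>r\<in>{1..N_visits \<tau> j0 js i k}.
        ln (visit_time \<tau> j0 js x i k r / \<theta>) * a - exp (ln (visit_time \<tau> j0 js x i k r / \<theta>) * a)"
    let ?T = "m * ln (t / \<theta>) * a - b_coeff m q * exp (ln (t / \<theta>) * a)"
    let ?V = "of_bool ((state_at j0 js \<tau>, jn) = (i, k)) * exp (ln (u / \<theta>) * a)"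
    \<comment> \<open>Each visit contributes \<open>z - exp z\<close>, which is at most -1.\<close>
    have "?S \<le> 0"
    proof (rule sum_nonpos)
      fix r show "ln (visit_time \<tau> j0 js x i k r / \<theta>) * a - exp (ln (visit_time \<tau> j0 js x i k r / \<theta>) * a) \<le> 0"
        using exp_ge_add_one_self[of "ln (visit_time \<tau> j0 js x i k r / \<theta>) * a"] by linarith
    qed
    moreover have "?T \<le> m * ln (m / b_coeff m q)"
      using mult_ln_diff_le[of "exp (ln (t / \<theta>) * a)" m "b_coeff m q"] b_coeff_pos[of m q] par
      by (simp add: mult.assoc)
    moreover have "0 \<le> ?V" by simp
    ultimately have E: "exp (?S + ?T - ?V) \<le> E" unfolding E_def exp_le_cancel_iff by linarith
    have "alpha_kernel \<tau> j0 m q c d \<alpha>0 \<alpha>1 i k dat jn \<theta> t a =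
        (a powr p * exp (- (m * d * a))) * exp (?S + ?T - ?V) * (a - \<alpha>0) powr (c - 1)"
      unfolding dat using pos True
      by (subst alpha_kernel_exponent) (auto simp: dat p_def)
    also have "\<dots> \<le> (K * exp (- (e * a))) * E * (a - \<alpha>0) powr (c - 1)"
      by (rule mult_right_mono[OF mult_mono]) (use K(3)[OF True] E K(1) in auto)
    finally show ?thesis using a by (simp add: mult_ac)
  next
    case False
    then have "alpha_kernel \<tau> j0 m q c d \<alpha>0 \<alpha>1 i k dat jn \<theta> t a = 0"
      by (simp add: alpha_kernel_def dat Let_def)
    then show ?thesis using K by (simp add: E_def)
  qed
  have "(\<integral>\<^sup>+ a. ennreal (alpha_kernel \<tau> j0 m q c d \<alpha>0 \<alpha>1 i k dat jn \<theta> t a) \<partial>lborel) \<le>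
      (\<integral>\<^sup>+ a. ennreal (K * E) * ennreal ((a - \<alpha>0) powr (c - 1) * exp (- (e * a)) * indicator {\<alpha>0<..} a) \<partial>lborel)"
    using bnd K by (intro nn_integral_mono) (auto simp: E_def ennreal_mult''[symmetric] intro!: ennreal_leI)
  also have "\<dots> = ennreal (K * E) * (\<integral>\<^sup>+ a. ennreal ((a - \<alpha>0) powr (c - 1) * exp (- (e * a)) * indicator {\<alpha>0<..} a) \<partial>lborel)"
    by (rule nn_integral_cmult) measurable
  also have "\<dots> < \<infinity>"
    using nn_integral_shifted_gamma_kernel_finite[OF par(4) K(2), of \<alpha>0]
    by (simp add: ennreal_mult_less_top)
  finally show "(\<integral>\<^sup>+ a. ennreal (alpha_kernel \<tau> j0 m q c d \<alpha>0 \<alpha>1 i k dat jn \<theta> t a) \<partial>lborel) < \<infinity>" .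
qed (use alpha_kernel_measurable in \<open>auto simp: alpha_kernel_nonneg\<close>)

lemma concave_on_linear_minus_exp:
  fixes p k l :: real
  assumes "convex S" "0 \<le> k"
  shows "concave_on S (\<lambda>a. p * a - k * exp (l * a))"
proof (rule f''_le0_imp_concave)
  show "((\<lambda>a. p * a - k * exp (l * a)) has_real_derivative p - k * l * exp (l * a)) (at a)" for a
    by (auto intro!: derivative_eq_intros)
  show "((\<lambda>a. p - k * l * exp (l * a)) has_real_derivative - (k * l\<^sup>2 * exp (l * a))) (at a)" for a
    by (auto intro!: derivative_eq_intros simp: power2_eq_square)
qed (use assms in auto)

text \<open>\<open>A\<close> may be negative, which makes its term convex. Since
  \<open>0 < a - \<alpha>0 < a\<close>, the second logarithm is at least as curved as
  \<open>B * ln a\<close>, so the sum behaves no worse than \<open>(A + B) * ln a\<close>.\<close>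

lemma concave_on_ln_plus_ln_shifted:
  fixes A B \<alpha>0 :: real
  assumes "convex S" "S \<subseteq> {\<alpha>0<..}" "0 < \<alpha>0" "0 \<le> B" "0 \<le> A + B"
  shows "concave_on S (\<lambda>a. A * ln a + B * ln (a - \<alpha>0))"
proof (rule f''_le0_imp_concave)
  fix a assume "a \<in> S"
  then have a: "\<alpha>0 < a" "0 < a" using assms by auto
  show "((\<lambda>a. A * ln a + B * ln (a - \<alpha>0)) has_real_derivative A / a + B / (a - \<alpha>0)) (at a)"
    using a by (auto intro!: derivative_eq_intros)
  show "((\<lambda>a. A / a + B / (a - \<alpha>0)) has_real_derivative - A / a\<^sup>2 - B / (a - \<alpha>0)\<^sup>2) (at a)"
    using a by (auto intro!: derivative_eq_intros simp: power2_eq_square)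
  have "B / a\<^sup>2 \<le> B / (a - \<alpha>0)\<^sup>2"
    using a assms by (intro divide_left_mono power_mono mult_pos_pos) auto
  moreover have "0 \<le> (A + B) / a\<^sup>2" using assms by simp
  ultimately show "- A / a\<^sup>2 - B / (a - \<alpha>0)\<^sup>2 \<le> 0"
    by (simp add: add_divide_distrib)
qed fact

lemma log_concave_alpha_kernel:
  assumes pos: "positive_times \<tau> dat" "0 < \<theta>" "0 < t"
    and par: "0 < m" "0 < q" "q < 1" "1 \<le> c" "0 < \<alpha>0"
  shows "log_concave (normalized lborel (alpha_kernel \<tau> j0 m q c d \<alpha>0 \<alpha>1 i k dat jn \<theta> t))"
proof -
  obtain js x u where dat: "dat = (js, x, u)" by (cases dat) auto
  define g where "g = alpha_kernel \<tau> j0 m q c d \<alpha>0 \<alpha>1 i k dat jn \<theta> t"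
  define Z where "Z = (\<integral>z. g z \<partial>lborel)"
  define I where "I = alpha_support d \<alpha>0 \<alpha>1"
  define N where "N = N_visits \<tau> j0 js i k"
  define l where "l r = ln (visit_time \<tau> j0 js x i k r / \<theta>)" for r
  define v :: real where "v = of_bool ((state_at j0 js \<tau>, jn) = (i, k))"
  have g0: "0 \<le> g a" for a unfolding g_def by (rule alpha_kernel_nonneg)
  then have Z0: "0 \<le> Z" unfolding Z_def by simp
  have I: "I \<subseteq> {\<alpha>0<..}" "convex I" by (auto simp: I_def alpha_support_def)
  have g_eq: "g a = a powr (real N + 1 + m - c) * (a - \<alpha>0) powr (c - 1) * exp (- (m * d * a)) *
    exp ((\<Sum>r\<in>{1..N}. l r * a - exp (l r * a)) +
      (m * ln (t / \<theta>) * a - b_coeff m q * exp (ln (t / \<theta>) * a)) - v * exp (ln (u / \<theta>) * a)) * indicator I a" for a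
    unfolding g_def dat N_def l_def v_def I_def
    by (rule alpha_kernel_exponent) (use pos dat in auto)
  show ?thesis
  \<comment> \<open>With \<open>Z = 0\<close> division by zero makes the normalised kernel
    identically 0, and concavity is asked on the empty set.\<close>
  proof (cases "Z = 0")
    case True
    then show ?thesis
      by (simp add: log_concave_def normalized_def concave_on_const flip: g_def Z_def)
  next
    case False
    with Z0 have Z: "0 < Z" by simp
    \<comment> \<open>All factors are strictly positive on \<open>I\<close>, so the logarithm of the
      density is finite exactly there.\<close>
    have supp: "{a. 0 < g a / Z} = I"
    proof -
      have "0 < g a / Z \<longleftrightarrow> a \<in> I" for a
        using I par Z by (cases "a \<in> I") (auto simp: g_eq zero_less_mult_iff)
      then show ?thesis by auto
    qed
    \<comment> \<open>The factor \<open>exp (- (m * d * a))\<close> supplies the linear part next to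
      the censored term, so that every summand but the logarithmic and the constant one is a linear
      function minus an exponential.\<close>
    have "concave_on I (\<lambda>a. ((real N + 1 + m - c) * ln a + (c - 1) * ln (a - \<alpha>0)) +
       ((\<Sum>r\<in>{1..N}. l r * a - 1 * exp (l r * a)) +
        ((m * ln (t / \<theta>) * a - b_coeff m q * exp (ln (t / \<theta>) * a)) +
         ((- (m * d)) * a - v * exp (ln (u / \<theta>) * a)))) + (- ln Z))"
    proof (rule concave_on_add[OF concave_on_add[OF concave_on_ln_plus_ln_shifted
            concave_on_add[OF _ concave_on_add[OF concave_on_linear_minus_exp concave_on_linear_minus_exp]]]])
      have "concave_on I (\<lambda>a. \<Sum>r\<in>{1..n}. l r * a - 1 * exp (l r * a))" for n
      proof (induction n)
        case (Suc n)
        have "concave_on I (\<lambda>a. (\<Sum>r\<in>{1..n}. l r * a - 1 * exp (l r * a)) + (l (Suc n) * a - 1 * exp (l (Suc n) * a)))"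
          by (intro concave_on_add Suc.IH concave_on_linear_minus_exp I) simp
        then show ?case by simp
      qed (simp add: concave_on_const I)
      then show "concave_on I (\<lambda>a. \<Sum>r\<in>{1..N}. l r * a - 1 * exp (l r * a))" .
      show "concave_on I (\<lambda>a. - ln Z)" using I by (simp add: concave_on_const)
    qed (use I par b_coeff_pos[of m q] in \<open>auto simp: v_def\<close>)
    moreover have "concave_on I (\<lambda>a. ln (g a / Z)) \<longleftrightarrow> concave_on I (\<lambda>a. ((real N + 1 + m - c) * ln a + (c - 1) * ln (a - \<alpha>0)) +
       ((\<Sum>r\<in>{1..N}. l r * a - 1 * exp (l r * a)) +
        ((m * ln (t / \<theta>) * a - b_coeff m q * exp (ln (t / \<theta>) * a)) +
         ((- (m * d)) * a - v * exp (ln (u / \<theta>) * a)))) + (- ln Z))"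
    proof -
      have "ln (g a / Z) = ((real N + 1 + m - c) * ln a + (c - 1) * ln (a - \<alpha>0)) +
       ((\<Sum>r\<in>{1..N}. l r * a - 1 * exp (l r * a)) +
        ((m * ln (t / \<theta>) * a - b_coeff m q * exp (ln (t / \<theta>) * a)) +
         ((- (m * d)) * a - v * exp (ln (u / \<theta>) * a)))) + (- ln Z)" if "a \<in> I" for a
      proof -
        have a: "\<alpha>0 < a" "0 < a" using that I par by auto
        then show ?thesis using Z that unfolding g_eq
          by (simp add: ln_div ln_mult ln_powr)
      qed
      \<comment> \<open>The two functions agree on \<open>I\<close> only; this suffices since the
        concavity inequality evaluates them at convex combinations, which stay in
        \<open>I\<close>.\<close>
      then show ?thesis using I(2)
        by (auto simp: concave_on_iff convex_def)
    qed
    ultimately show ?thesis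
      unfolding log_concave_def g_def[symmetric] normalized_def Z_def[symmetric] supp
      using g0 Z by simp
  qed
qed

section \<open>The truncated generalized Gamma law\<close>

text \<open>The scale arises by solving \<open>(t / A) powr a = b / \<theta> powr a\<close> for
  \<open>A\<close>, where b is \<open>b_rate m q t a\<close>. The power
  \<open>t powr (a * m)\<close> is what the prior normaliser \<open>b powr m\<close> contributes,
  whence \<open>d - 1 = a * m\<close>.\<close>

lemma cell_t:
  assumes "0 < t" "0 < \<theta>" "0 < a" "0 < m" "0 < q" "q < 1"
  shows "cell \<tau> j0 m q (js, x, u) jn i k a \<theta> t =
     (a ^ N_visits \<tau> j0 js i k / \<theta> powr (a * real (N_visits \<tau> j0 js i k)) *
      C_stat \<tau> j0 js x i k powr (a - 1) *
      exp (- (M_tilde \<tau> j0 (js, x, u) jn i k a / \<theta> powr a)) *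
      (a * b_coeff m q powr m / Gamma m * \<theta> powr (- (1 + m * a)))) *
     (t powr (a * m) * exp (- ((t / (\<theta> * ((1 - q) powr (- 1 / m) - 1) powr (1 / a))) powr a)))"
proof -
  define k' where "k' = (1 - q) powr (- 1 / m) - 1"
  have b: "b_coeff m q = 1 / k'" by (simp add: b_coeff_def k'_def divide_inverse)
  have k': "0 < k'" using b_coeff_pos[of m q] assms unfolding b by simp
  have "(k' powr (1 / a)) powr a = k'" using k' assms by (simp add: powr_powr)
  then have "(t / (\<theta> * k' powr (1 / a))) powr a = b_rate m q t a / \<theta> powr a"
    unfolding b_rate_eq b powr_divide powr_mult by simp
  moreover have "b_rate m q t a powr m = t powr (a * m) * b_coeff m q powr m"
    unfolding b_rate_eq powr_mult powr_powr ..
  ultimately show ?thesis using assms unfolding k'_def[symmetric]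
    by (simp add: cell_def gig_density_def)
qed

lemma integrable_trunc_gen_gamma_kernel:
  fixes A p a K t1 t2 :: real
  assumes "0 \<le> p" "0 \<le> t1" "t1 < t2"
  shows "integrable lborel (\<lambda>y. K * y powr p * exp (- ((y / A) powr a)) * indicator {t1<..<t2} y)"
proof -
  have "integrable lborel (\<lambda>y. \<bar>K\<bar> * t2 powr p * indicator {t1<..<t2} y)"
    using assms by (simp add: integrable_indicator_iff)
  then show ?thesis
  proof (rule Bochner_Integration.integrable_bound)
    show "AE y in lborel. norm (K * y powr p * exp (- ((y / A) powr a)) * indicator {t1<..<t2} y)
        \<le> norm (\<bar>K\<bar> * t2 powr p * indicator {t1<..<t2} y)"
    proof (rule AE_I2)
      fix y
      show "norm (K * y powr p * exp (- ((y / A) powr a)) * indicator {t1<..<t2} y)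
        \<le> norm (\<bar>K\<bar> * t2 powr p * indicator {t1<..<t2} y)"
      proof (cases "y \<in> {t1<..<t2}")
        case True
        then have "y powr p \<le> t2 powr p" using assms by (intro powr_mono2) auto
        then have "\<bar>K\<bar> * y powr p * exp (- ((y / A) powr a)) \<le> \<bar>K\<bar> * t2 powr p * 1"
          by (intro mult_mono) auto
        then show ?thesis using True by (simp add: abs_mult)
      qed simp
    qed
  qed simp
qed

text \<open>Conditioning on the interval divides by its mass, which is the integral used by
  \<open>normalized\<close>. The two descriptions in (e) therefore need only one section
  computation.\<close>

lemma trunc_gen_gamma_eq_prop_law:
  assumes "0 < A" "1 \<le> d" "0 < p" "0 \<le> t1" "t1 < t2"
  shows "trunc_gen_gamma A d p t1 t2 = prop_law lborel
    (\<lambda>y. p / A powr d / Gamma (d / p) * y powr (d - 1) * exp (- ((y / A) powr p)) * indicator {t1<..<t2} y)"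
    (is "_ = prop_law lborel ?g")
proof -
  define Z where "Z = (\<integral>y. ?g y \<partial>lborel)"
  have K: "0 < p / A powr d / Gamma (d / p)" using assms by (auto intro!: divide_pos_pos Gamma_real_pos)
  have g0: "0 \<le> ?g y" for y using K by (intro mult_nonneg_nonneg) auto
  have int: "integrable lborel ?g"
    by (rule integrable_trunc_gen_gamma_kernel) (use assms in auto)
  have geq: "gen_gamma_density A d p y * indicator {t1<..<t2} y = ?g y" for y
    using assms by (auto simp: gen_gamma_density_def split: split_indicator)
  have Z: "0 < Z"
  proof -
    \<comment> \<open>The kernel is positive on the interval, so a vanishing integral would make the
      interval a null set.\<close>
    have "Z \<noteq> 0"
    proof
      assume "Z = 0"
      then have "AE y in lborel. ?g y = 0"
        unfolding Z_def using int g0 by (subst (asm) integral_nonneg_eq_0_iff_AE) auto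
      then have "AE y in lborel. y \<notin> {t1<..<t2}"
      proof eventually_elim
        case (elim y)
        have "Gamma (d / p) \<noteq> 0" "A \<noteq> 0" using K by auto
        with elim show ?case using assms by auto
      qed
      then have "emeasure lborel {t1<..<t2} = 0"
        by (subst (asm) AE_iff_measurable[where N="{t1<..<t2}"]) auto
      then show False using assms by simp
    qed
    moreover have "0 \<le> Z" unfolding Z_def by (rule integral_nonneg_AE) (use g0 in \<open>rule AE_I2\<close>)
    ultimately show ?thesis by simp
  qed
  have [measurable]: "gen_gamma_density A d p \<in> borel_measurable borel"
    unfolding gen_gamma_density_def by measurable
  have "emeasure (gen_gamma A d p) {t1<..<t2} = (\<integral>\<^sup>+ y. ennreal (?g y) \<partial>lborel)"
    unfolding gen_gamma_def
    unfolding geq[symmetric]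
    by (subst emeasure_density) (auto intro!: nn_integral_cong split: split_indicator)
  also have "\<dots> = ennreal Z" unfolding Z_def
    using int g0 by (intro nn_integral_eq_integral) auto
  finally have S: "emeasure (gen_gamma A d p) {t1<..<t2} = ennreal Z" .
  have "trunc_gen_gamma A d p t1 t2 =
      density lborel (\<lambda>y. ennreal (gen_gamma_density A d p y) * (indicator {t1<..<t2} y / ennreal Z))"
    unfolding trunc_gen_gamma_def uniform_measure_def S unfolding gen_gamma_def
    by (rule density_density_eq) measurable
  also have "\<dots> = density lborel (\<lambda>y. ennreal (normalized lborel ?g y))"
  proof (rule arg_cong[where f="density lborel"], rule ext)
    fix y
    have "normalized lborel ?g y = gen_gamma_density A d p y * indicator {t1<..<t2} y / Z"
      by (simp only: normalized_def Z_def geq)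
    then show "ennreal (gen_gamma_density A d p y) * (indicator {t1<..<t2} y / ennreal Z) = ennreal (normalized lborel ?g y)"
      using Z by (auto simp: divide_ennreal ennreal_mult''[symmetric] simp flip: ennreal_1 split: split_indicator)
  qed
  finally show ?thesis by (simp add: prop_law_def)
qed

text \<open>The reciprocal Gamma function is continuous on the whole line, and at the poles
  \<open>inverse 0 = 0\<close> agrees with the default value of \<open>Gamma\<close>. In (e) the
  argument of \<open>Gamma\<close> varies with \<alpha>.\<close>

lemma Gamma_real_measurable [measurable]: "(Gamma :: real \<Rightarrow> real) \<in> borel_measurable borel"
proof -
  have "(rGamma :: real \<Rightarrow> real) \<in> borel_measurable borel"
    by (intro borel_measurable_continuous_onI continuous_intros) 
  moreover have "(Gamma :: real \<Rightarrow> real) = (\<lambda>x. inverse (rGamma x))"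
    by (simp add: fun_eq_iff rGamma_inverse_Gamma)
  ultimately show ?thesis by (metis borel_measurable_inverse)
qed

text \<open>For \<open>y = \<theta> powr a\<close> the Jacobian
  \<open>a * \<theta> powr (a - 1)\<close> turns the exponent \<open>- M - 1\<close> of the inverse
  Gamma kernel into \<open>- (1 + M * a)\<close>, which leaves the factor
  \<open>1 / a\<close>.\<close>

lemma nn_integral_theta_substitution:
  fixes a M B :: real
  assumes a: "0 < a" and [measurable]: "A \<in> sets borel"
  shows "(\<integral>\<^sup>+ \<theta>. ennreal (\<theta> powr (- (1 + M * a)) * exp (- B / \<theta> powr a) * indicator {0<..} \<theta>) * indicator A (\<theta> powr a) \<partial>lborel) =
    ennreal (1 / a) * (\<integral>\<^sup>+ y. ennreal (y powr (- M - 1) * exp (- B / y) * indicator {0<..} y) * indicator A y \<partial>lborel)"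
proof -
  let ?f = "\<lambda>y. ennreal (1 / a) * (ennreal (y powr (- M - 1) * exp (- B / y)) * indicator A y)"
  have "ennreal (1 / a) * (\<integral>\<^sup>+ y. ennreal (y powr (- M - 1) * exp (- B / y) * indicator {0<..} y) * indicator A y \<partial>lborel) =
     (\<integral>\<^sup>+ y. ?f y * indicator {0<..} y \<partial>lborel)"
    by (subst nn_integral_cmult[symmetric]) (auto intro!: nn_integral_cong split: split_indicator)
  also have "\<dots> = (\<integral>\<^sup>+ \<theta>. ?f (\<theta> powr a) * ennreal (\<bar>a\<bar> * \<theta> powr (a - 1)) * indicator {0<..} \<theta> \<partial>lborel)"
    by (rule nn_integral_powr_substitution) (use a in auto)
  also have "\<dots> = (\<integral>\<^sup>+ \<theta>. ennreal (\<theta> powr (- (1 + M * a)) * exp (- B / \<theta> powr a) * indicator {0<..} \<theta>) * indicator A (\<theta> powr a) \<partial>lborel)"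
  proof (rule nn_integral_cong)
    fix \<theta> :: real
    have "(\<theta> powr a) powr (- M - 1) * \<theta> powr (a - 1) = \<theta> powr (- (1 + M * a))"
      unfolding powr_powr powr_add[symmetric] by (rule arg_cong) (simp add: algebra_simps)
    then have "(1 / a) * ((\<theta> powr a) powr (- M - 1) * exp (- B / \<theta> powr a)) * (\<bar>a\<bar> * \<theta> powr (a - 1)) =
        \<theta> powr (- (1 + M * a)) * exp (- B / \<theta> powr a)"
      using a by (simp add: mult_ac)
    then have "ennreal (1 / a) * ennreal ((\<theta> powr a) powr (- M - 1) * exp (- B / \<theta> powr a)) * ennreal (\<bar>a\<bar> * \<theta> powr (a - 1)) =
        ennreal (\<theta> powr (- (1 + M * a)) * exp (- B / \<theta> powr a))"
      by (simp flip: ennreal_mult'')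
    then show "?f (\<theta> powr a) * ennreal (\<bar>a\<bar> * \<theta> powr (a - 1)) * indicator {0<..} \<theta> =
       ennreal (\<theta> powr (- (1 + M * a)) * exp (- B / \<theta> powr a) * indicator {0<..} \<theta>) * indicator A (\<theta> powr a)"
      by (auto split: split_indicator)
  qed
  finally show ?thesis ..
qed

section \<open>Factorization of likelihood times prior density over the strings\<close>

lemma gig_density_nonneg: "0 \<le> a \<Longrightarrow> 0 < m \<Longrightarrow> 0 \<le> gig_density m b a \<theta>"
  using Gamma_real_pos[of m] by (simp add: gig_density_def)

lemma cell_nonpos_theta: "\<theta> \<le> 0 \<Longrightarrow> cell \<tau> j0 m q dat jn i k a \<theta> t = 0"
  by (cases dat) (simp add: cell_def gig_density_def)

text \<open>The factor of the censored sojourn belongs to the single string formed by the last state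
  and \<open>jn\<close>. Its probability raises the exponent of p from \<open>N_visits\<close> to
  \<open>N_tilde\<close>, and its exponential changes \<open>M_stat\<close> into
  \<open>M_tilde\<close>; afterwards no string plays a special role.\<close>

lemma full_likelihood_times_gig:
  assumes "state_at j0 js \<tau> \<in> {1..s}" "jn \<in> {1..s}"
  shows "full_likelihood s \<tau> j0 (js, x, u) jn p \<alpha> \<theta> *
      (\<Prod>e\<in>index_pairs s. gig_density (m e) (b_rate (m e) (q e) (t e) (\<alpha> e)) (\<alpha> e) (\<theta> e)) =
    (\<Prod>i\<in>{1..s}. \<Prod>k\<in>{1..s}. p i k ^ N_tilde \<tau> j0 js jn i k) *
    (\<Prod>e\<in>index_pairs s. cell \<tau> j0 (m e) (q e) (js, x, u) jn (fst e) (snd e) (\<alpha> e) (\<theta> e) (t e))"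
proof -
  define e0 where "e0 = (state_at j0 js \<tau>, jn)"
  have e0: "e0 \<in> index_pairs s" using assms by (auto simp: e0_def)
  have fin: "finite (index_pairs s)" by simp
  define N where "N e = N_visits \<tau> j0 js (fst e) (snd e)" for e
  define W where "W e = \<alpha> e ^ N e / \<theta> e powr (\<alpha> e * real (N e)) * C_stat \<tau> j0 js x (fst e) (snd e) powr (\<alpha> e - 1) *
        exp (- (1 / \<theta> e powr \<alpha> e) * M_stat \<tau> j0 js x (fst e) (snd e) (\<alpha> e))" for e
  define U where "U = exp (- ((u / \<theta> e0) powr \<alpha> e0))"
  define G where "G e = gig_density (m e) (b_rate (m e) (q e) (t e) (\<alpha> e)) (\<alpha> e) (\<theta> e)" for e
  have cell: "cell \<tau> j0 (m e) (q e) (js, x, u) jn (fst e) (snd e) (\<alpha> e) (\<theta> e) (t e) =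
      W e * (if e = e0 then U else 1) * G e" for e
  proof -
    have "exp (- (M_tilde \<tau> j0 (js, x, u) jn (fst e) (snd e) (\<alpha> e) / \<theta> e powr \<alpha> e)) =
        exp (- (1 / \<theta> e powr \<alpha> e) * M_stat \<tau> j0 js x (fst e) (snd e) (\<alpha> e)) * (if e = e0 then U else 1)"
      by (auto simp: M_tilde_def U_def e0_def powr_divide add_divide_distrib simp flip: exp_add)
    then show ?thesis by (simp add: cell_def W_def G_def N_def)
  qed
  have "(\<Prod>i\<in>{1..s}. \<Prod>k\<in>{1..s}. p i k ^ N_tilde \<tau> j0 js jn i k) =
      (\<Prod>e\<in>index_pairs s. p (fst e) (snd e) ^ N e * (if e = e0 then p (fst e) (snd e) else 1))"
    unfolding prod.cartesian_product
  proof (intro prod.cong refl)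
    fix e assume "e \<in> index_pairs s"
    obtain a b where e: "e = (a, b)" by fastforce
    show "(case e of (i, k) \<Rightarrow> p i k ^ N_tilde \<tau> j0 js jn i k) =
        p (fst e) (snd e) ^ N e * (if e = e0 then p (fst e) (snd e) else 1)"
      unfolding e by (cases "(a, b) = e0") (auto simp: N_tilde_def N_def e0_def)
  qed
  also have "\<dots> = (\<Prod>e\<in>index_pairs s. p (fst e) (snd e) ^ N e) * p (state_at j0 js \<tau>) jn"
    unfolding prod.distrib using e0 by (simp add: prod.delta e0_def)
  finally have P: "(\<Prod>i\<in>{1..s}. \<Prod>k\<in>{1..s}. p i k ^ N_tilde \<tau> j0 js jn i k) = \<dots>" .
  have "full_likelihood s \<tau> j0 (js, x, u) jn p \<alpha> \<theta> =
      (\<Prod>e\<in>index_pairs s. p (fst e) (snd e) ^ N e) * (\<Prod>e\<in>index_pairs s. W e) * (p (state_at j0 js \<tau>) jn * U)"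
    by (simp add: full_likelihood_def Let_def W_def N_def U_def e0_def case_prod_beta)
  then show ?thesis
    unfolding P cell prod.distrib G_def[symmetric] using e0
    by (simp add: prod.delta fin)
qed

section \<open>The joint law\<close>

lemma measurable_PiM_borel_apply:
  "f \<in> measurable M (PiM I (\<lambda>_. borel)) \<Longrightarrow> (\<lambda>w. f w e) \<in> borel_measurable M"
  by (rule measurable_compose[OF _ measurable_PiM_borel_component])

lemma measurable_matrices_apply:
  "f \<in> measurable M (matrices I s) \<Longrightarrow> (\<lambda>w. f w l k) \<in> borel_measurable M"
  by (rule measurable_compose[OF _ measurable_matrices_component])

text \<open>The observed states take finitely many values, so they may be fixed in measurability proofs.\<close>

lemma measurable_by_states:
  assumes f: "\<And>js. (\<lambda>w. f js w) \<in> measurable M N"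
    and g: "g \<in> measurable M (PiM {1..\<tau>::nat} (\<lambda>_. count_space {1..s::nat}))"
  shows "(\<lambda>w. f (g w) w) \<in> measurable M N"
proof -
  have "PiM {1..\<tau>} (\<lambda>_. count_space {1..s}) = count_space (PiE {1..\<tau>} (\<lambda>_. {1..s}))"
    by (rule count_space_PiM_finite) auto
  then have g': "g \<in> measurable M (count_space (PiE {1..\<tau>} (\<lambda>_. {1..s})))" using g by simp
  have "countable (PiE {1..\<tau>} (\<lambda>_. {1..s}))"
    by (intro countable_finite finite_PiE) auto
  then show ?thesis
    by (rule measurable_compose_countable'[OF f g'])
qed

lemma measurable_by_data:
  assumes f: "\<And>js jn. (\<lambda>w. f js jn w) \<in> measurable M N"
    and g: "g \<in> measurable M (PiM {1..\<tau>::nat} (\<lambda>_. count_space {1..s::nat}))"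
    and h: "h \<in> measurable M (count_space {1..s::nat})"
  shows "(\<lambda>w. f (g w) (h w) w) \<in> measurable M N"
proof (rule measurable_by_states[OF _ g])
  show "(\<lambda>w. f js (h w) w) \<in> measurable M N" for js
    by (rule measurable_compose_countable'[OF f h]) auto
qed

lemma full_likelihood_measurable:
  "(\<lambda>(dat, jn, p, \<alpha>, \<theta>, t). full_likelihood s \<tau> j0 dat jn p \<alpha> \<theta>) \<in> borel_measurable
    (obs_space s \<tau> \<Otimes>\<^sub>M count_space {1..s} \<Otimes>\<^sub>M matrices {1..s} s \<Otimes>\<^sub>M arrays I \<Otimes>\<^sub>M arrays I \<Otimes>\<^sub>M arrays I)"
    (is "_ \<in> borel_measurable ?W")
proof -
  have [measurable]: "(\<lambda>w. fst (snd (fst w)) n) \<in> borel_measurable ?W" for n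
    unfolding obs_space_def by (rule measurable_PiM_borel_apply) measurable
  have [measurable]: "(\<lambda>w. snd (snd (fst w))) \<in> borel_measurable ?W"
    unfolding obs_space_def by measurable
  have [measurable]: "(\<lambda>w. fst (snd (snd w)) l k) \<in> borel_measurable ?W" for l k
    by (rule measurable_matrices_apply) measurable
  have [measurable]: "(\<lambda>w. fst (snd (snd (snd w))) e) \<in> borel_measurable ?W" for e
    by (rule measurable_PiM_borel_apply) measurable
  have [measurable]: "(\<lambda>w. fst (snd (snd (snd (snd w)))) e) \<in> borel_measurable ?W" for e
    by (rule measurable_PiM_borel_apply) measurable
  have "(\<lambda>w. full_likelihood s \<tau> j0 (js, fst (snd (fst w)), snd (snd (fst w))) jn (fst (snd (snd w)))
      (fst (snd (snd (snd w)))) (fst (snd (snd (snd (snd w)))))) \<in> borel_measurable ?W" for js jn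
    unfolding full_likelihood_def prod.case Let_def case_prod_beta C_stat_def M_stat_def visit_time_def
      fst_conv snd_conv
    by measurable
  then have "(\<lambda>w. full_likelihood s \<tau> j0 (fst (fst w), fst (snd (fst w)), snd (snd (fst w))) (fst (snd w)) (fst (snd (snd w)))
      (fst (snd (snd (snd w)))) (fst (snd (snd (snd (snd w)))))) \<in> borel_measurable ?W"
    by (rule measurable_by_data) (unfold obs_space_def, measurable)
  then show ?thesis by (simp add: case_prod_beta)
qed

lemma gig_product_measurable:
  "(\<lambda>(\<alpha>, \<theta>, t). \<Prod>e\<in>I. gig_density (m e) (b_rate (m e) (q e) (t e) (\<alpha> e)) (\<alpha> e) (\<theta> e))
    \<in> borel_measurable (arrays J \<Otimes>\<^sub>M arrays J \<Otimes>\<^sub>M arrays J)" (is "_ \<in> borel_measurable ?W")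
proof -
  have [measurable]: "(\<lambda>w. fst w e) \<in> borel_measurable ?W" for e
    by (rule measurable_PiM_borel_apply) measurable
  have [measurable]: "(\<lambda>w. fst (snd w) e) \<in> borel_measurable ?W" for e
    by (rule measurable_PiM_borel_apply) measurable
  have [measurable]: "(\<lambda>w. snd (snd w) e) \<in> borel_measurable ?W" for e
    by (rule measurable_PiM_borel_apply) measurable
  show ?thesis unfolding case_prod_beta gig_density_def b_rate_def by measurable
qed

locale weibull_renewal_model =
  fixes s \<tau> j0 :: nat
    and \<gamma> :: "nat \<Rightarrow> nat \<Rightarrow> real"
    and m q c d \<alpha>0 \<alpha>1 :: "nat \<times> nat \<Rightarrow> real"
    and \<pi>t :: "nat \<times> nat \<Rightarrow> t_prior"
    and D :: "obs measure"
  assumes \<tau>: "1 \<le> \<tau>"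
    and sigma_D: "sigma_finite_measure D" and sets_D: "sets D = sets (obs_space s \<tau>)"
    and positive_D: "AE dat in D. positive_times \<tau> dat"
    and m_pos: "\<And>e. e \<in> index_pairs s \<Longrightarrow> 0 < m e"
    and q_bounds: "\<And>e. e \<in> index_pairs s \<Longrightarrow> 0 < q e \<and> q e < 1"
    and c_pos: "\<And>e. e \<in> index_pairs s \<Longrightarrow> 0 < c e"
    and d_nonneg: "\<And>e. e \<in> index_pairs s \<Longrightarrow> 0 \<le> d e"
    and \<alpha>0_pos: "\<And>e. e \<in> index_pairs s \<Longrightarrow> 0 < \<alpha>0 e"
    and valid_t: "\<And>e. e \<in> index_pairs s \<Longrightarrow> valid_t_prior (\<pi>t e)"
begin

abbreviation "E \<equiv> count_space {1..s}"
abbreviation "I \<equiv> index_pairs s"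
definition "row_law i = dirichlet s (\<gamma> i)"
definition "\<alpha>_law e = alpha_law (m e) (c e) (d e) (\<alpha>0 e) (\<alpha>1 e)"
definition "t_entry_law e = t_law (\<pi>t e)"

text \<open>The index set is a parameter because removing one coordinate leaves a product of the
  same kind over a smaller set.\<close>

definition "row_laws J = PiM J row_law"
definition "\<alpha>s J = PiM J \<alpha>_law"
definition "\<theta>s J = PiM J (\<lambda>_::nat \<times> nat. lborel :: real measure)"
definition "ts J = PiM J t_entry_law"

lemma sets_row_law [simp, measurable_cong]: "sets (row_law i) = sets (row_space s)" by (simp add: row_law_def)
lemma sets_\<alpha>_law [simp, measurable_cong]: "sets (\<alpha>_law e) = sets borel" by (simp add: \<alpha>_law_def)
lemma sets_t_entry_law [simp, measurable_cong]: "sets (t_entry_law e) = sets borel" by (simp add: t_entry_law_def)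

lemma sets_row_laws [simp, measurable_cong]: "sets (row_laws J) = sets (matrices J s)"
  unfolding row_laws_def by (rule sets_PiM_cong) auto
lemma sets_\<alpha>s [simp, measurable_cong]: "sets (\<alpha>s J) = sets (arrays J)"
  unfolding \<alpha>s_def by (rule sets_PiM_cong) auto
lemma sets_\<theta>s [simp, measurable_cong]: "sets (\<theta>s J) = sets (arrays J)"
  unfolding \<theta>s_def by (rule sets_PiM_cong) auto
lemma sets_ts [simp, measurable_cong]: "sets (ts J) = sets (arrays J)"
  unfolding ts_def by (rule sets_PiM_cong) auto

lemmas [measurable_cong] = sets_D

lemma sigma_row_law: "sigma_finite_measure (row_law i)"
  unfolding row_law_def by (rule sigma_finite_dirichlet)
lemma sigma_\<alpha>_law: "sigma_finite_measure (\<alpha>_law e)"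
  unfolding \<alpha>_law_def by (rule sigma_finite_alpha_law)
lemma sigma_t_entry_law: "sigma_finite_measure (t_entry_law e)"
  unfolding t_entry_law_def by (rule sigma_finite_t_law)
lemma sigma_E: "sigma_finite_measure E"
  by (rule sigma_finite_measure_count_space_finite) simp
lemma sigma_row_laws: "finite J \<Longrightarrow> sigma_finite_measure (row_laws J)"
  unfolding row_laws_def by (rule sigma_finite_PiM[OF sigma_row_law])
lemma sigma_\<alpha>s: "finite J \<Longrightarrow> sigma_finite_measure (\<alpha>s J)"
  unfolding \<alpha>s_def by (rule sigma_finite_PiM[OF sigma_\<alpha>_law])
lemma sigma_\<theta>s: "finite J \<Longrightarrow> sigma_finite_measure (\<theta>s J)"
  unfolding \<theta>s_def by (rule sigma_finite_PiM[OF lborel.sigma_finite_measure_axioms])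
lemma sigma_ts: "finite J \<Longrightarrow> sigma_finite_measure (ts J)"
  unfolding ts_def by (rule sigma_finite_PiM[OF sigma_t_entry_law])

lemmas sigma_intros = sigma_D sigma_E sigma_row_laws sigma_\<alpha>s sigma_\<theta>s sigma_ts sigma_finite_pair

abbreviation "W \<equiv> obs_space s \<tau> \<Otimes>\<^sub>M E \<Otimes>\<^sub>M matrices {1..s} s \<Otimes>\<^sub>M arrays I \<Otimes>\<^sub>M arrays I \<Otimes>\<^sub>M arrays I"

text \<open>The prior laws of p, \<alpha> and t are part of the reference measure, whereas \<theta>
  has Lebesgue measure: its prior depends on \<alpha> and t and therefore enters through
  \<open>joint_density\<close>.\<close>

definition "base = D \<Otimes>\<^sub>M E \<Otimes>\<^sub>M row_laws {1..s} \<Otimes>\<^sub>M \<alpha>s I \<Otimes>\<^sub>M \<theta>s I \<Otimes>\<^sub>M ts I"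

definition "joint_density = (\<lambda>(dat, jn, p, \<alpha>, \<theta>, t).
  ennreal (full_likelihood s \<tau> j0 dat jn p \<alpha> \<theta>) *
  ennreal (\<Prod>e\<in>I. gig_density (m e) (b_rate (m e) (q e) (t e) (\<alpha> e)) (\<alpha> e) (\<theta> e)))"

abbreviation "P \<equiv> joint_law s \<tau> j0 D (prior_law s \<gamma> m q c d \<alpha>0 \<alpha>1 \<pi>t)"

lemma sets_base [measurable_cong]: "sets base = sets W"
  unfolding base_def by (intro sets_pair_measure_cong sets_D sets_row_laws sets_\<alpha>s sets_\<theta>s sets_ts refl)

lemma gig_measurable:
  "(\<lambda>(\<alpha>, \<theta>, t). ennreal (\<Prod>e\<in>I. gig_density (m e) (b_rate (m e) (q e) (t e) (\<alpha> e)) (\<alpha> e) (\<theta> e)))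
    \<in> borel_measurable (\<alpha>s I \<Otimes>\<^sub>M \<theta>s I \<Otimes>\<^sub>M ts I)"
proof -
  have "(\<lambda>w. ennreal ((\<lambda>(\<alpha>, \<theta>, t). \<Prod>e\<in>I. gig_density (m e) (b_rate (m e) (q e) (t e) (\<alpha> e)) (\<alpha> e) (\<theta> e)) w))
      \<in> borel_measurable (\<alpha>s I \<Otimes>\<^sub>M \<theta>s I \<Otimes>\<^sub>M ts I)"
    using gig_product_measurable[of m q I I] by measurable
  then show ?thesis by (simp add: case_prod_beta)
qed

lemma likelihood_measurable:
  "(\<lambda>(dat, jn, p, \<alpha>, \<theta>, t). ennreal (full_likelihood s \<tau> j0 dat jn p \<alpha> \<theta>)) \<in> borel_measurable base"
proof -
  have "(\<lambda>w. ennreal ((\<lambda>(dat, jn, p, \<alpha>, \<theta>, t). full_likelihood s \<tau> j0 dat jn p \<alpha> \<theta>) w)) \<in> borel_measurable base"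
    using full_likelihood_measurable[of s \<tau> j0 I] by measurable
  then show ?thesis by (simp add: case_prod_beta)
qed

lemma P_eq: "P = density base joint_density"
proof -
  let ?R = "\<alpha>s I \<Otimes>\<^sub>M \<theta>s I \<Otimes>\<^sub>M ts I"
  let ?G = "\<lambda>(\<alpha>, \<theta>, t). ennreal (\<Prod>e\<in>I. gig_density (m e) (b_rate (m e) (q e) (t e) (\<alpha> e)) (\<alpha> e) (\<theta> e))"
  note [measurable] = gig_measurable
  have s1: "sigma_finite_measure ?R" by (intro sigma_intros) auto
  have s2: "sigma_finite_measure (row_laws {1..s} \<Otimes>\<^sub>M ?R)" by (intro sigma_intros) auto
  have s3: "sigma_finite_measure (E \<Otimes>\<^sub>M row_laws {1..s} \<Otimes>\<^sub>M ?R)" by (intro sigma_intros) auto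
  have m2: "(\<lambda>w. ?G (snd w)) \<in> borel_measurable (row_laws {1..s} \<Otimes>\<^sub>M ?R)" by measurable
  have m3: "(\<lambda>w. ?G (snd (snd w))) \<in> borel_measurable (E \<Otimes>\<^sub>M row_laws {1..s} \<Otimes>\<^sub>M ?R)" by measurable
  have m4: "(\<lambda>w. ?G (snd (snd (snd w)))) \<in> borel_measurable (D \<Otimes>\<^sub>M E \<Otimes>\<^sub>M row_laws {1..s} \<Otimes>\<^sub>M ?R)" by measurable
  have "row_laws {1..s} \<Otimes>\<^sub>M density ?R ?G = density (row_laws {1..s} \<Otimes>\<^sub>M ?R) (\<lambda>w. ?G (snd w))"
    by (rule pair_density_right[OF s1 gig_measurable]) (simp add: case_prod_beta)
  moreover have "E \<Otimes>\<^sub>M density (row_laws {1..s} \<Otimes>\<^sub>M ?R) (\<lambda>w. ?G (snd w)) =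
      density (E \<Otimes>\<^sub>M row_laws {1..s} \<Otimes>\<^sub>M ?R) (\<lambda>w. ?G (snd (snd w)))"
    by (rule pair_density_right[OF s2 m2]) (simp add: case_prod_beta)
  moreover have "D \<Otimes>\<^sub>M density (E \<Otimes>\<^sub>M row_laws {1..s} \<Otimes>\<^sub>M ?R) (\<lambda>w. ?G (snd (snd w))) =
      density base (\<lambda>w. ?G (snd (snd (snd w))))"
    unfolding base_def by (rule pair_density_right[OF s3 m3]) (simp add: case_prod_beta)
  ultimately have "P = density (density base (\<lambda>w. ?G (snd (snd (snd w)))))
      (\<lambda>(dat, jn, p, \<alpha>, \<theta>, t). ennreal (full_likelihood s \<tau> j0 dat jn p \<alpha> \<theta>))"
    unfolding joint_law_def prior_law_def row_laws_def row_law_def \<alpha>s_def \<alpha>_law_def \<theta>s_def ts_def t_entry_law_def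
    by (simp only:)
  also have "\<dots> = density base (\<lambda>w. ?G (snd (snd (snd w))) *
      (\<lambda>(dat, jn, p, \<alpha>, \<theta>, t). ennreal (full_likelihood s \<tau> j0 dat jn p \<alpha> \<theta>)) w)"
    using m4 by (intro density_density_eq likelihood_measurable) (simp add: base_def)
  also have "(\<lambda>w. ?G (snd (snd (snd w))) *
      (\<lambda>(dat, jn, p, \<alpha>, \<theta>, t). ennreal (full_likelihood s \<tau> j0 dat jn p \<alpha> \<theta>)) w) = joint_density"
    by (auto simp: joint_density_def fun_eq_iff mult.commute)
  finally show ?thesis .
qed

lemma joint_density_measurable [measurable]: "joint_density \<in> borel_measurable base"
proof -
  note [measurable] = gig_measurable likelihood_measurable
  have "(\<lambda>w. (\<lambda>(dat, jn, p, \<alpha>, \<theta>, t). ennreal (full_likelihood s \<tau> j0 dat jn p \<alpha> \<theta>)) w *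
     (\<lambda>(\<alpha>, \<theta>, t). ennreal (\<Prod>e\<in>I. gig_density (m e) (b_rate (m e) (q e) (t e) (\<alpha> e)) (\<alpha> e) (\<theta> e))) (snd (snd (snd w))))
     \<in> borel_measurable base"
    unfolding base_def using likelihood_measurable[unfolded base_def] by measurable
  then show ?thesis by (simp add: joint_density_def case_prod_beta)
qed

text \<open>At least one transition is observed, so the last state is the component
  \<open>js \<tau>\<close> of the data and not \<open>j0\<close>.\<close>

lemma state_at_last:
  assumes "(js, x, u) \<in> space (obs_space s \<tau>)"
  shows "state_at j0 js \<tau> \<in> {1..s}"
  using assms \<tau> by (auto simp: obs_space_def space_pair_measure space_PiM state_at_def PiE_iff)

text \<open>\<open>ennreal\<close> cuts negative numbers to 0 and is multiplicative as soon as one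
  factor is nonnegative. The likelihood may be negative off the support of the prior, so the
  nonnegative factor has to be the product of the prior densities of \<theta>; this is where
  positivity of \<alpha> enters.\<close>

lemma joint_density_eq:
  assumes "(js, x, u) \<in> space (obs_space s \<tau>)" "jn \<in> {1..s}" "\<And>e. e \<in> I \<Longrightarrow> 0 < \<alpha> e"
  shows "joint_density ((js, x, u), jn, p, \<alpha>, \<theta>, t) = ennreal (
    (\<Prod>i\<in>{1..s}. \<Prod>k\<in>{1..s}. p i k ^ N_tilde \<tau> j0 js jn i k) *
    (\<Prod>e\<in>I. cell \<tau> j0 (m e) (q e) (js, x, u) jn (fst e) (snd e) (\<alpha> e) (\<theta> e) (t e)))"
proof -
  have "0 \<le> (\<Prod>e\<in>I. gig_density (m e) (b_rate (m e) (q e) (t e) (\<alpha> e)) (\<alpha> e) (\<theta> e))"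
    by (intro prod_nonneg ballI gig_density_nonneg less_imp_le[OF assms(3)] m_pos)
  then show ?thesis
    unfolding joint_density_def prod.case using full_likelihood_times_gig[OF state_at_last[OF assms(1)] assms(2)]
    by (simp flip: ennreal_mult'')
qed

lemma AE_row_laws:
  assumes "J \<subseteq> {1..s}"
  shows "AE p in row_laws J. \<forall>i\<in>J. p i \<in> prob_simplex s"
proof -
  have "AE p in row_law i. p \<in> prob_simplex s" for i
    unfolding row_law_def by (rule AE_dirichlet)
  then show ?thesis unfolding row_laws_def
    using assms finite_subset by (intro AE_PiM_all_components sigma_row_law) auto
qed

lemma AE_\<alpha>_law: "AE a in \<alpha>_law e. a \<in> alpha_support (d e) (\<alpha>0 e) (\<alpha>1 e)"
  unfolding \<alpha>_law_def by (rule AE_alpha_law)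

lemma alpha_support_pos: "e \<in> I \<Longrightarrow> a \<in> alpha_support (d e) (\<alpha>0 e) (\<alpha>1 e) \<Longrightarrow> 0 < a"
  using \<alpha>0_pos[of e] by (auto simp: alpha_support_def split: if_splits)

lemma AE_\<alpha>s:
  assumes "J \<subseteq> I"
  shows "AE \<alpha> in \<alpha>s J. \<forall>e\<in>J. 0 < \<alpha> e"
proof -
  have "AE a in \<alpha>_law e. 0 < a" if "e \<in> J" for e
    using AE_\<alpha>_law[of e]
  proof eventually_elim
    case (elim a)
    then show ?case using alpha_support_pos[of e a] that assms by blast
  qed
  then show ?thesis unfolding \<alpha>s_def
    using finite_subset[OF assms] by (intro AE_PiM_all_components sigma_\<alpha>_law) auto
qed

lemma AE_ts:
  assumes "J \<subseteq> I"
  shows "AE t in ts J. \<forall>e\<in>J. 0 < t e"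
proof -
  have "AE a in t_entry_law e. 0 < a" if "e \<in> J" for e
    unfolding t_entry_law_def by (rule AE_t_law[OF valid_t]) (use that assms in blast)
  then show ?thesis unfolding ts_def
    using finite_subset[OF assms] by (intro AE_PiM_all_components sigma_t_entry_law) auto
qed

end

section \<open>The full conditional laws\<close>

lemma splits_section_measurable:
  assumes "splits B \<mu> \<nu> \<phi>" "F \<in> measurable B N" "y \<in> space \<nu>"
  shows "(\<lambda>x. F (\<phi> x y)) \<in> measurable \<mu> N"
  using measurable_compose[OF measurable_compose[OF measurable_Pair2'[OF assms(3)]
      splits_measurable(1)[OF assms(1)]] assms(2)] by simp

lemma inv_gamma_measurable:
  assumes [measurable]: "B \<in> borel_measurable M" and A: "A \<in> sets borel"
  shows "(\<lambda>y. emeasure (inv_gamma k (B y)) A) \<in> borel_measurable M"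
  unfolding inv_gamma_def
  by (rule measurable_emeasure_density) (use A in \<open>auto intro: lborel.sigma_finite_measure_axioms\<close>)

lemma alpha_prior_kernel_measurable:
  "(\<lambda>v. v powr (m - c) * (v - \<alpha>0) powr (c - 1) * exp (- m * d * v) * indicator (alpha_support d \<alpha>0 \<alpha>1) v)
    \<in> borel_measurable lborel"
  by measurable

context weibull_renewal_model
begin

declare One_nat_def [simp del] \<comment> \<open>keeps \<open>{1..s}\<close> from turning into \<open>{Suc 0..s}\<close>\<close>

lemma sigma_lborel: "sigma_finite_measure (lborel :: real measure)"
  by (rule lborel.sigma_finite_measure_axioms)

section \<open>Splitting one parameter off the reference measure\<close>

lemma splits_base_row:
  assumes "i \<in> {1..s}"
  shows "splits base (row_law i)
    (D \<Otimes>\<^sub>M E \<Otimes>\<^sub>M row_laws ({1..s} - {i}) \<Otimes>\<^sub>M \<alpha>s I \<Otimes>\<^sub>M \<theta>s I \<Otimes>\<^sub>M ts I)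
    (\<lambda>x (dat, jn, p, r). (dat, jn, p(i := x), r))"
proof -
  have s0: "splits (row_laws {1..s}) (row_law i) (row_laws ({1..s} - {i})) (\<lambda>x p. p(i := x))"
    unfolding row_laws_def using assms by (intro splits_PiM sigma_row_law) auto
  show ?thesis unfolding base_def
    using splits_lift_left[OF sigma_D _ splits_lift_left[OF sigma_E _ splits_lift_right[OF _ _ s0]],
        of "\<alpha>s I \<Otimes>\<^sub>M \<theta>s I \<Otimes>\<^sub>M ts I"]
    by (simp add: case_prod_unfold sigma_intros)
qed

lemma splits_base_\<alpha>:
  assumes "e \<in> I"
  shows "splits base (\<alpha>_law e)
    (D \<Otimes>\<^sub>M E \<Otimes>\<^sub>M row_laws {1..s} \<Otimes>\<^sub>M \<alpha>s (I - {e}) \<Otimes>\<^sub>M \<theta>s I \<Otimes>\<^sub>M ts I)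
    (\<lambda>x (dat, jn, p, \<alpha>, r). (dat, jn, p, \<alpha>(e := x), r))"
proof -
  have s0: "splits (\<alpha>s I) (\<alpha>_law e) (\<alpha>s (I - {e})) (\<lambda>x f. f(e := x))"
    unfolding \<alpha>s_def using assms by (intro splits_PiM sigma_\<alpha>_law) auto
  show ?thesis unfolding base_def
    using splits_lift_left[OF sigma_D _ splits_lift_left[OF sigma_E _
          splits_lift_left[OF sigma_row_laws _ splits_lift_right[OF _ _ s0]]],
        of "{1..s}" "\<theta>s I \<Otimes>\<^sub>M ts I"]
    by (simp add: case_prod_unfold sigma_intros)
qed

lemma splits_base_\<theta>:
  assumes "e \<in> I"
  shows "splits base lborel
    (D \<Otimes>\<^sub>M E \<Otimes>\<^sub>M row_laws {1..s} \<Otimes>\<^sub>M \<alpha>s I \<Otimes>\<^sub>M \<theta>s (I - {e}) \<Otimes>\<^sub>M ts I)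
    (\<lambda>x (dat, jn, p, \<alpha>, \<theta>, t). (dat, jn, p, \<alpha>, \<theta>(e := x), t))"
proof -
  have s0: "splits (\<theta>s I) lborel (\<theta>s (I - {e})) (\<lambda>x f. f(e := x))"
    unfolding \<theta>s_def using assms by (intro splits_PiM sigma_lborel) auto
  show ?thesis unfolding base_def
    using splits_lift_left[OF sigma_D _ splits_lift_left[OF sigma_E _
          splits_lift_left[OF sigma_row_laws _ splits_lift_left[OF sigma_\<alpha>s _ splits_lift_right[OF _ _ s0]]]],
        of "{1..s}" I "ts I"]
    by (simp add: case_prod_unfold sigma_intros)
qed

lemma prod_cells_update:
  assumes "e \<in> I" "\<And>k. k \<in> I - {e} \<Longrightarrow> \<alpha>' k = \<alpha> k \<and> \<theta>' k = \<theta> k \<and> t' k = t k"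
  shows "(\<Prod>k\<in>I. cell \<tau> j0 (m k) (q k) dat jn (fst k) (snd k) (\<alpha>' k) (\<theta>' k) (t' k)) =
    cell \<tau> j0 (m e) (q e) dat jn (fst e) (snd e) (\<alpha>' e) (\<theta>' e) (t' e) *
    (\<Prod>k\<in>I - {e}. cell \<tau> j0 (m k) (q k) dat jn (fst k) (snd k) (\<alpha> k) (\<theta> k) (t k))"
  using assms by (subst prod.remove[of _ e]) (auto intro!: prod.cong)

section \<open>Claim (a): Dirichlet conjugacy for a row\<close>

lemma cond_law_row:
  assumes i: "i \<in> {1..s}"
  shows "cond_law P (row_space s) (\<lambda>(dat, jn, p, \<alpha>, \<theta>, t). p i)
       (obs_space s \<tau> \<Otimes>\<^sub>M E \<Otimes>\<^sub>M matrices ({1..s} - {i}) s \<Otimes>\<^sub>M arrays I \<Otimes>\<^sub>M arrays I \<Otimes>\<^sub>M arrays I)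
       (\<lambda>(dat, jn, p, \<alpha>, \<theta>, t). (dat, jn, restrict p ({1..s} - {i}), \<alpha>, \<theta>, t))
       (\<lambda>((js, x, u), jn, p, \<alpha>, \<theta>, t). dirichlet s (\<lambda>k. real (N_tilde \<tau> j0 js jn i k) + \<gamma> i k))"
    (is "cond_law _ _ ?X ?MY ?Y ?K")
proof (rule cond_law_of_splits[OF splits_base_row[OF i] joint_density_measurable P_eq])
  let ?\<nu> = "D \<Otimes>\<^sub>M E \<Otimes>\<^sub>M row_laws ({1..s} - {i}) \<Otimes>\<^sub>M \<alpha>s I \<Otimes>\<^sub>M \<theta>s I \<Otimes>\<^sub>M ts I"
  let ?\<phi> = "\<lambda>x (dat, jn, p, r). (dat, jn, p(i := x), r)"
  show sets: "sets ?\<nu> = sets ?MY"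
    by (intro sets_pair_measure_cong sets_D sets_row_laws sets_\<alpha>s sets_\<theta>s sets_ts refl)
  note [measurable_cong] = sets_base
  have [measurable]: "(\<lambda>p. p i) \<in> measurable (matrices {1..s} s) (row_space s)"
    using i by (rule measurable_component_singleton)
  have [measurable]: "(\<lambda>p. restrict p ({1..s} - {i})) \<in> measurable (matrices {1..s} s) (matrices ({1..s} - {i}) s)"
    by (rule measurable_restrict_subset) auto
  show "?X \<in> measurable base (row_space s)"
    unfolding case_prod_unfold by measurable
  show "?Y \<in> measurable base ?MY"
    unfolding case_prod_unfold by measurable
  show "?Y (?\<phi> x y) = y" if "x \<in> space (row_law i)" "y \<in> space ?MY" for x y
    using that(2) by (auto simp: space_pair_measure space_PiM PiE_def extensional_def fun_eq_iff)
  show "sets (?K y) = sets (row_space s)" for y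
    by (simp add: case_prod_unfold)
  show "(\<lambda>y. emeasure (?K y) A) \<in> borel_measurable ?MY" if A: "A \<in> sets (row_space s)" for A
  proof -
    have "(\<lambda>y. emeasure (dirichlet s (\<lambda>k. real (N_tilde \<tau> j0 (fst (fst y)) (fst (snd y)) i k) + \<gamma> i k)) A) \<in> borel_measurable ?MY"
      by (rule measurable_by_data[where g="\<lambda>y. fst (fst y)" and h="\<lambda>y. fst (snd y)" and s=s and \<tau>=\<tau>])
         (unfold obs_space_def, measurable)
    then show ?thesis by (simp add: case_prod_unfold)
  qed
  have ae_\<alpha>: "AE y in ?\<nu>. \<forall>e\<in>I. 0 < fst (snd (snd (snd y))) e"
    by (intro AE_pair_snd AE_pair_fst AE_\<alpha>s sigma_intros) auto
  show "AE y in ?\<nu>. \<exists>c<\<infinity>. (c \<noteq> 0 \<longrightarrow> prob_space (?K y)) \<and>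
      (\<forall>A\<in>sets (row_space s). (\<integral>\<^sup>+ x. joint_density (?\<phi> x y) * indicator A (?X (?\<phi> x y)) \<partial>row_law i) = c * emeasure (?K y) A)"
    using ae_\<alpha> AE_space
  proof eventually_elim
    case (elim y)
    obtain js x u jn p \<alpha> \<theta> t where y: "y = ((js, x, u), jn, p, \<alpha>, \<theta>, t)" by (metis prod_cases3 surj_pair)
    have sp: "(js, x, u) \<in> space (obs_space s \<tau>)" "jn \<in> {1..s}"
      using elim(2) unfolding sets_eq_imp_space_eq[OF sets] y by (auto simp: space_pair_measure)
    have \<alpha>: "\<And>e. e \<in> I \<Longrightarrow> 0 < \<alpha> e" using elim(1) unfolding y by auto
    define n where "n k = N_tilde \<tau> j0 js jn i k" for k
    define g0 where "g0 p = (\<Prod>j\<in>{1..s}. p j powr (\<gamma> i j - 1)) * indicator (prob_simplex s) p" for p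
    define g1 where "g1 p = (\<Prod>j\<in>{1..s}. p j powr (real (n j) + \<gamma> i j - 1)) * indicator (prob_simplex s) p" for p
    define Z where "Z = (\<integral>p. g0 p \<partial>hyperplane_measure s)"
    define R where "R = (\<Prod>i'\<in>{1..s} - {i}. \<Prod>k\<in>{1..s}. p i' k ^ N_tilde \<tau> j0 js jn i' k) *
      (\<Prod>e\<in>I. cell \<tau> j0 (m e) (q e) (js, x, u) jn (fst e) (snd e) (\<alpha> e) (\<theta> e) (t e))"
    have K: "?K y = prop_law (hyperplane_measure s) g1" by (simp add: y dirichlet_def g1_def[abs_def] n_def)
    have row: "row_law i = prop_law (hyperplane_measure s) g0" by (simp add: row_law_def dirichlet_def g0_def[abs_def])
    have m0: "g0 \<in> borel_measurable (hyperplane_measure s)"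
      unfolding g0_def[abs_def] by (rule dirichlet_kernel_measurable)
    have m1: "g1 \<in> borel_measurable (hyperplane_measure s)"
      unfolding g1_def[abs_def] by (rule dirichlet_kernel_measurable)
    have nn: "0 \<le> g0 p" "0 \<le> g1 p" for p
      by (auto simp: g0_def g1_def intro!: mult_nonneg_nonneg prod_nonneg)
    have Z0: "0 \<le> Z" unfolding Z_def using nn by simp
    have g1_eq: "g1 v = (\<Prod>k\<in>{1..s}. v k ^ n k) * g0 v" for v
    proof (cases "v \<in> prob_simplex s")
      case True
      \<comment> \<open>On the boundary of the simplex the identity survives because
        \<open>0 powr z = 0\<close> for every \<open>z\<close>, also when
        \<open>n k = 0\<close>.\<close>
      have "v k powr (real (n k) + \<gamma> i k - 1) = v k ^ n k * v k powr (\<gamma> i k - 1)" if "k \<in> {1..s}" for k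
        using True that by (cases "v k = 0") (auto simp: prob_simplex_def powr_realpow[symmetric] powr_add[symmetric] less_le add_diff_eq)
      then show ?thesis using True by (simp add: g0_def g1_def prod.distrib[symmetric])
    qed (simp add: g0_def g1_def)
    have dens: "joint_density (?\<phi> v y) = ennreal ((\<Prod>k\<in>{1..s}. v k ^ n k) * R)" for v
      unfolding y prod.case using i
      by (subst joint_density_eq[OF sp \<alpha>])
         (auto simp: R_def n_def prod.remove[of "{1..s}" i] mult.assoc intro!: arg_cong[where f=ennreal] prod.cong)
    have meas: "(\<lambda>v. joint_density (?\<phi> v y) * indicator A (?X (?\<phi> v y))) \<in> borel_measurable (hyperplane_measure s)"
      if "A \<in> sets (row_space s)" for A
    proof -
      have "(\<lambda>v. joint_density (?\<phi> v y)) \<in> borel_measurable (row_law i)"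
        by (rule splits_section_measurable[OF splits_base_row[OF i] joint_density_measurable elim(2)])
      then have "(\<lambda>v. joint_density (?\<phi> v y)) \<in> borel_measurable (hyperplane_measure s)"
        by (simp only: measurable_cong_sets[OF sets_row_law refl] measurable_cong_sets[OF sets_hyperplane_measure refl])
      moreover have "(\<lambda>v. indicator A v :: ennreal) \<in> borel_measurable (hyperplane_measure s)"
        using that by (intro borel_measurable_indicator) (simp only: sets_hyperplane_measure)
      ultimately show ?thesis unfolding y prod.case fun_upd_same
        by (rule borel_measurable_times_ennreal)
    qed
    have J: "(\<integral>\<^sup>+ v. joint_density (?\<phi> v y) * indicator A (?X (?\<phi> v y)) \<partial>row_law i) =
        ennreal (R / Z) * (\<integral>\<^sup>+ v. ennreal (g1 v) * indicator A v \<partial>hyperplane_measure s)"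
      if A[measurable]: "A \<in> sets (row_space s)" for A
    proof -
      have "(\<integral>\<^sup>+ v. joint_density (?\<phi> v y) * indicator A (?X (?\<phi> v y)) \<partial>row_law i) =
          (\<integral>\<^sup>+ v. ennreal (g0 v / Z) * (joint_density (?\<phi> v y) * indicator A (?X (?\<phi> v y))) \<partial>hyperplane_measure s)"
        unfolding row Z_def by (rule nn_integral_prop_law[OF m0 meas[OF A]])
      also have "\<dots> = (\<integral>\<^sup>+ v. ennreal (R / Z) * (ennreal (g1 v) * indicator A v) \<partial>hyperplane_measure s)"
      proof (rule nn_integral_cong)
        fix v
        \<comment> \<open>The sign of \<open>R\<close> is not controlled, so \<open>ennreal\<close>
          is split only along the nonnegative factors \<open>g0 v / Z\<close> and
          \<open>g1 v\<close>.\<close>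
        have "ennreal (g0 v / Z) * ennreal ((\<Prod>k\<in>{1..s}. v k ^ n k) * R) = ennreal ((\<Prod>k\<in>{1..s}. v k ^ n k) * R * (g0 v / Z))"
          using nn Z0 by (subst mult.commute, intro ennreal_mult''[symmetric]) simp
        also have "(\<Prod>k\<in>{1..s}. v k ^ n k) * R * (g0 v / Z) = R / Z * g1 v"
          by (simp add: g1_eq)
        also have "ennreal \<dots> = ennreal (R / Z) * ennreal (g1 v)"
          by (rule ennreal_mult''[OF nn(2)])
        finally show "ennreal (g0 v / Z) * (joint_density (?\<phi> v y) * indicator A (?X (?\<phi> v y))) =
            ennreal (R / Z) * (ennreal (g1 v) * indicator A v)"
          unfolding dens by (simp add: y mult.assoc[symmetric])
      qed
      also have "\<dots> = ennreal (R / Z) * (\<integral>\<^sup>+ v. ennreal (g1 v) * indicator A v \<partial>hyperplane_measure s)"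
        by (intro nn_integral_cmult borel_measurable_times_ennreal measurable_compose[OF m1 measurable_ennreal]
            borel_measurable_indicator) (simp only: sets_hyperplane_measure A)
      finally show ?thesis .
    qed
    show ?case
    \<comment> \<open>On the simplex all entries are at most 1, so additional counts only decrease
      the kernel and integrability passes from prior to posterior. Otherwise \<open>Z = 0\<close>,
      the prior law of the row is the null measure, and the constant 0 works.\<close>
    proof (cases "integrable (hyperplane_measure s) g0")
      case True
      have "integrable (hyperplane_measure s) g1"
      proof (rule Bochner_Integration.integrable_bound[OF True m1], rule AE_I2)
        fix v
        show "norm (g1 v) \<le> norm (g0 v)"
        proof (cases "v \<in> prob_simplex s")
          case True
          have "v k \<le> 1" if "k \<in> {1..s}" for k
            using True member_le_sum[of k "{1..s}" v] that by (auto simp: prob_simplex_def)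
          then have "(\<Prod>k\<in>{1..s}. v k ^ n k) \<le> 1"
            using True by (intro prod_le_1) (auto simp: prob_simplex_def power_le_one)
          moreover have "0 \<le> (\<Prod>k\<in>{1..s}. v k ^ n k)"
            using True by (intro prod_nonneg) (auto simp: prob_simplex_def)
          ultimately show ?thesis using nn(1)[of v] by (simp add: g1_eq mult_left_le_one_le)
        qed (simp add: g1_def)
      qed
      with prop_law_of_proportional[OF m1 nn(2), of "ennreal (R / Z)"
          "\<lambda>A. \<integral>\<^sup>+ v. joint_density (?\<phi> v y) * indicator A (?X (?\<phi> v y)) \<partial>row_law i"] J
      show ?thesis unfolding K by simp
    next
      case False
      then have "Z = 0" unfolding Z_def by (rule not_integrable_integral_eq)
      with J show ?thesis by (intro exI[of _ 0]) simp
    qed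
  qed
qed

section \<open>Claim (b): inverse Gamma law of a power of the scale\<close>

lemma theta_section_proportional:
  assumes e: "e \<in> I" and \<alpha>: "0 < \<alpha>" and t: "0 < t"
  shows "\<exists>c<\<infinity>. \<forall>A\<in>sets borel. (\<integral>\<^sup>+ x. ennreal (R * cell \<tau> j0 (m e) (q e) (js, y, u) jn i k \<alpha> x t) * indicator A (x powr \<alpha>) \<partial>lborel) =
      c * emeasure (inv_gamma (m e + real (N_visits \<tau> j0 js i k))
            (b_rate (m e) (q e) t \<alpha> + M_tilde \<tau> j0 (js, y, u) jn i k \<alpha>)) A"
proof -
  define M where "M = m e + real (N_visits \<tau> j0 js i k)"
  define B where "B = b_rate (m e) (q e) t \<alpha> + M_tilde \<tau> j0 (js, y, u) jn i k \<alpha>"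
  define K where "K = \<alpha> ^ N_visits \<tau> j0 js i k * C_stat \<tau> j0 js y i k powr (\<alpha> - 1) *
     (\<alpha> * b_rate (m e) (q e) t \<alpha> powr m e / Gamma (m e))"
  \<comment> \<open>Contains the whole dependence on the integration variable. Being nonnegative, it
    lets \<open>ennreal (R * K)\<close> be pulled out whatever the sign of
    \<open>R * K\<close>.\<close>
  define h where "h x = x powr (- (1 + M * \<alpha>)) * exp (- B / x powr \<alpha>) * indicator {0<..} x" for x :: real
  have M: "0 < M" using m_pos[OF e] by (simp add: M_def)
  have "0 < b_rate (m e) (q e) t \<alpha>" by (rule b_rate_pos) (use m_pos q_bounds e t in auto)
  then have B: "0 < B" unfolding B_def by (intro add_pos_nonneg M_tilde_nonneg)
  have h0: "0 \<le> h x" for x by (simp add: h_def)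
  have cell: "R * cell \<tau> j0 (m e) (q e) (js, y, u) jn i k \<alpha> x t = (R * K) * h x" for x
    unfolding cell_theta h_def K_def B_def M_def by (simp only: mult.assoc)
  show ?thesis unfolding M_def[symmetric] B_def[symmetric]
  proof (intro exI[of _ "ennreal (R * K) * (ennreal (1 / \<alpha>) * ennreal (Gamma M / B powr M))"] conjI ballI)
    show "ennreal (R * K) * (ennreal (1 / \<alpha>) * ennreal (Gamma M / B powr M)) < \<infinity>"
      by (simp add: ennreal_mult_less_top)
    fix A :: "real set" assume A[measurable]: "A \<in> sets borel"
    have "(\<integral>\<^sup>+ x. ennreal (R * cell \<tau> j0 (m e) (q e) (js, y, u) jn i k \<alpha> x t) * indicator A (x powr \<alpha>) \<partial>lborel) =
       (\<integral>\<^sup>+ x. ennreal (R * K) * (ennreal (h x) * indicator A (x powr \<alpha>)) \<partial>lborel)"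
      by (intro nn_integral_cong, simp only: cell ennreal_mult''[OF h0], rule mult.assoc)
    also have "\<dots> = ennreal (R * K) * (\<integral>\<^sup>+ x. ennreal (h x) * indicator A (x powr \<alpha>) \<partial>lborel)"
      unfolding h_def by (rule nn_integral_cmult) measurable
    also have "(\<integral>\<^sup>+ x. ennreal (h x) * indicator A (x powr \<alpha>) \<partial>lborel) =
        ennreal (1 / \<alpha>) * (ennreal (Gamma M / B powr M) * emeasure (inv_gamma M B) A)"
      unfolding h_def nn_integral_theta_substitution[OF \<alpha> A] emeasure_inv_gamma[OF M B A] ..
    finally show "(\<integral>\<^sup>+ x. ennreal (R * cell \<tau> j0 (m e) (q e) (js, y, u) jn i k \<alpha> x t) * indicator A (x powr \<alpha>) \<partial>lborel) =
        ennreal (R * K) * (ennreal (1 / \<alpha>) * ennreal (Gamma M / B powr M)) * emeasure (inv_gamma M B) A"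
      by (simp add: mult.assoc)
  qed
qed

text \<open>The shape is among the conditioning variables, so for fixed \<open>y\<close> an event
  about \<open>\<theta> powr \<alpha>\<close> is an event about the split-off coordinate
  alone.\<close>

lemma cond_law_theta:
  assumes e: "(i, j) \<in> I"
  shows "cond_law P
       borel (\<lambda>(dat, jn, p, \<alpha>, \<theta>, t). \<theta> (i,j) powr \<alpha> (i,j))
       (obs_space s \<tau> \<Otimes>\<^sub>M E \<Otimes>\<^sub>M matrices {1..s} s \<Otimes>\<^sub>M arrays I \<Otimes>\<^sub>M arrays (I - {(i,j)}) \<Otimes>\<^sub>M arrays I)
       (\<lambda>(dat, jn, p, \<alpha>, \<theta>, t). (dat, jn, p, \<alpha>, restrict \<theta> (I - {(i,j)}), t))
       (\<lambda>((js, x, u), jn, p, \<alpha>, \<theta>, t).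
          inv_gamma (m (i,j) + real (N_visits \<tau> j0 js i j))
            (b_rate (m (i,j)) (q (i,j)) (t (i,j)) (\<alpha> (i,j)) + M_tilde \<tau> j0 (js, x, u) jn i j (\<alpha> (i,j))))"
    (is "cond_law _ _ ?X ?MY ?Y ?K")
proof (rule cond_law_of_splits[OF splits_base_\<theta>[OF e] joint_density_measurable P_eq])
  let ?\<nu> = "D \<Otimes>\<^sub>M E \<Otimes>\<^sub>M row_laws {1..s} \<Otimes>\<^sub>M \<alpha>s I \<Otimes>\<^sub>M \<theta>s (I - {(i,j)}) \<Otimes>\<^sub>M ts I"
  let ?\<phi> = "\<lambda>x (dat, jn, p, \<alpha>, \<theta>, t). (dat, jn, p, \<alpha>, \<theta>((i,j) := x), t)"
  show sets: "sets ?\<nu> = sets ?MY"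
    by (intro sets_pair_measure_cong sets_D sets_row_laws sets_\<alpha>s sets_\<theta>s sets_ts refl)
  note [measurable_cong] = sets_base
  have [measurable]: "(\<lambda>p. restrict p (I - {(i,j)})) \<in> measurable (arrays I) (arrays (I - {(i,j)}))"
    by (rule measurable_restrict_subset) auto
  show "?X \<in> measurable base borel"
  proof -
    note [measurable] = measurable_PiM_borel_component
    show ?thesis unfolding case_prod_unfold by measurable
  qed
  show "?Y \<in> measurable base ?MY"
    unfolding case_prod_unfold by measurable
  show "?Y (?\<phi> x y) = y" if "x \<in> space lborel" "y \<in> space ?MY" for x y
    using that(2) by (auto simp: space_pair_measure space_PiM PiE_def extensional_def fun_eq_iff)
  show "sets (?K y) = sets borel" for y
    by (simp add: case_prod_unfold inv_gamma_def)
  show "(\<lambda>y. emeasure (?K y) A) \<in> borel_measurable ?MY" if A: "A \<in> sets borel" for A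
  proof -
    note [measurable] = measurable_PiM_borel_component
    have [measurable]: "(\<lambda>w. fst (snd (fst w)) n) \<in> borel_measurable ?MY" for n
      unfolding obs_space_def by measurable
    have [measurable]: "(\<lambda>w. snd (snd (fst w))) \<in> borel_measurable ?MY"
      unfolding obs_space_def by measurable
    have "(\<lambda>y. emeasure (inv_gamma (m (i,j) + real (N_visits \<tau> j0 js i j))
            (b_rate (m (i,j)) (q (i,j)) (snd (snd (snd (snd (snd y)))) (i,j)) (fst (snd (snd (snd y))) (i,j)) +
             M_tilde \<tau> j0 (js, snd (fst y)) jn i j (fst (snd (snd (snd y))) (i,j)))) A) \<in> borel_measurable ?MY" for js jn
      unfolding b_rate_def M_tilde_def M_stat_def visit_time_def case_prod_unfold fst_conv snd_conv
      by (rule inv_gamma_measurable[OF _ A]) measurable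
    then have "(\<lambda>y. emeasure (inv_gamma (m (i,j) + real (N_visits \<tau> j0 (fst (fst y)) i j))
            (b_rate (m (i,j)) (q (i,j)) (snd (snd (snd (snd (snd y)))) (i,j)) (fst (snd (snd (snd y))) (i,j)) +
             M_tilde \<tau> j0 (fst (fst y), snd (fst y)) (fst (snd y)) i j (fst (snd (snd (snd y))) (i,j)))) A) \<in> borel_measurable ?MY"
      by (rule measurable_by_data[where g="\<lambda>y. fst (fst y)" and h="\<lambda>y. fst (snd y)" and s=s and \<tau>=\<tau>])
         (unfold obs_space_def, measurable)
    then show ?thesis by (simp only: case_prod_unfold prod.collapse)
  qed
  have ae_\<alpha>: "AE y in ?\<nu>. \<forall>e\<in>I. 0 < fst (snd (snd (snd y))) e"
    by (intro AE_pair_snd AE_pair_fst AE_\<alpha>s sigma_intros) auto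
  have ae_t: "AE y in ?\<nu>. \<forall>e\<in>I. 0 < snd (snd (snd (snd (snd y)))) e"
    by (intro AE_pair_snd AE_ts sigma_intros) auto
  show "AE y in ?\<nu>. \<exists>c<\<infinity>. (c \<noteq> 0 \<longrightarrow> prob_space (?K y)) \<and>
      (\<forall>A\<in>sets borel. (\<integral>\<^sup>+ x. joint_density (?\<phi> x y) * indicator A (?X (?\<phi> x y)) \<partial>lborel) = c * emeasure (?K y) A)"
    using ae_\<alpha> ae_t AE_space
  proof eventually_elim
    case (elim y)
    obtain js x u jn p \<alpha> \<theta> t where y: "y = ((js, x, u), jn, p, \<alpha>, \<theta>, t)" by (metis prod_cases3 surj_pair)
    have sp: "(js, x, u) \<in> space (obs_space s \<tau>)" "jn \<in> {1..s}"
      using elim(3) unfolding sets_eq_imp_space_eq[OF sets] y by (auto simp: space_pair_measure)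
    have \<alpha>: "\<And>e. e \<in> I \<Longrightarrow> 0 < \<alpha> e" using elim(1) unfolding y by auto
    have t: "0 < t (i, j)" using elim(2) e unfolding y by auto
    define R where "R = (\<Prod>i\<in>{1..s}. \<Prod>k\<in>{1..s}. p i k ^ N_tilde \<tau> j0 js jn i k) *
      (\<Prod>e\<in>I - {(i, j)}. cell \<tau> j0 (m e) (q e) (js, x, u) jn (fst e) (snd e) (\<alpha> e) (\<theta> e) (t e))"
    have dens: "joint_density (?\<phi> v y) = ennreal (R * cell \<tau> j0 (m (i, j)) (q (i, j)) (js, x, u) jn i j (\<alpha> (i, j)) v (t (i, j)))" for v
      unfolding y prod.case
      by (subst joint_density_eq[OF sp \<alpha>], assumption)
         (subst prod_cells_update[OF e, where \<alpha>=\<alpha> and \<theta>=\<theta> and t=t], auto simp: R_def mult_ac)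
    have "0 < b_rate (m (i, j)) (q (i, j)) (t (i, j)) (\<alpha> (i, j))"
      by (rule b_rate_pos) (use m_pos q_bounds e t in auto)
    then have "prob_space (?K y)"
      unfolding y prod.case using m_pos[OF e]
      by (intro prob_space_inv_gamma add_pos_nonneg M_tilde_nonneg) auto
    then show ?case
      using theta_section_proportional[OF e \<alpha>[OF e] t, where R=R and js=js and y=x and u=u and jn=jn and i=i and k=j]
      unfolding dens unfolding y prod.case by auto
  qed
qed

section \<open>Claim (c): conditional density of a shape parameter\<close>

lemma cond_law_alpha:
  assumes e: "(i, j) \<in> I"
  shows "cond_law P
       borel (\<lambda>(dat, jn, p, \<alpha>, \<theta>, t). \<alpha> (i,j))
       (obs_space s \<tau> \<Otimes>\<^sub>M E \<Otimes>\<^sub>M matrices {1..s} s \<Otimes>\<^sub>M arrays (I - {(i,j)}) \<Otimes>\<^sub>M arrays I \<Otimes>\<^sub>M arrays I)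
       (\<lambda>(dat, jn, p, \<alpha>, \<theta>, t). (dat, jn, p, restrict \<alpha> (I - {(i,j)}), \<theta>, t))
       (\<lambda>(dat, jn, p, \<alpha>, \<theta>, t). prop_law lborel
          (alpha_kernel \<tau> j0 (m (i,j)) (q (i,j)) (c (i,j)) (d (i,j)) (\<alpha>0 (i,j)) (\<alpha>1 (i,j)) i j
             dat jn (\<theta> (i,j)) (t (i,j))))"
    (is "cond_law _ _ ?X ?MY ?Y ?K")
proof (rule cond_law_of_splits[OF splits_base_\<alpha>[OF e] joint_density_measurable P_eq])
  let ?\<nu> = "D \<Otimes>\<^sub>M E \<Otimes>\<^sub>M row_laws {1..s} \<Otimes>\<^sub>M \<alpha>s (I - {(i,j)}) \<Otimes>\<^sub>M \<theta>s I \<Otimes>\<^sub>M ts I"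
  let ?\<phi> = "\<lambda>x (dat, jn, p, \<alpha>, r). (dat, jn, p, \<alpha>((i,j) := x), r)"
  let ?g = "alpha_kernel \<tau> j0 (m (i,j)) (q (i,j)) (c (i,j)) (d (i,j)) (\<alpha>0 (i,j)) (\<alpha>1 (i,j)) i j"
  show sets: "sets ?\<nu> = sets ?MY"
    by (intro sets_pair_measure_cong sets_D sets_row_laws sets_\<alpha>s sets_\<theta>s sets_ts refl)
  note [measurable_cong] = sets_base
  have [measurable]: "(\<lambda>p. restrict p (I - {(i,j)})) \<in> measurable (arrays I) (arrays (I - {(i,j)}))"
    by (rule measurable_restrict_subset) auto
  show "?X \<in> measurable base borel"
  proof -
    note [measurable] = measurable_PiM_borel_component
    show ?thesis unfolding case_prod_unfold by measurable
  qed
  show "?Y \<in> measurable base ?MY"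
    unfolding case_prod_unfold by measurable
  show "?Y (?\<phi> x y) = y" if "x \<in> space (\<alpha>_law (i, j))" "y \<in> space ?MY" for x y
    using that(2) by (auto simp: space_pair_measure space_PiM PiE_def extensional_def fun_eq_iff)
  show "sets (?K y) = sets borel" for y
    by (simp add: case_prod_unfold)
  show "(\<lambda>y. emeasure (?K y) A) \<in> borel_measurable ?MY" if A: "A \<in> sets borel" for A
  proof -
    note [measurable] = measurable_PiM_borel_component
    have [measurable]: "(\<lambda>w. fst (snd (fst (fst w))) n) \<in> borel_measurable (?MY \<Otimes>\<^sub>M lborel)" for n
      unfolding obs_space_def by measurable
    have [measurable]: "(\<lambda>w. snd (snd (fst (fst w)))) \<in> borel_measurable (?MY \<Otimes>\<^sub>M lborel)"
      unfolding obs_space_def by measurable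
    have "(\<lambda>w. ?g (js, snd (fst (fst w))) jn (fst (snd (snd (snd (snd (fst w))))) (i,j))
          (snd (snd (snd (snd (snd (fst w))))) (i,j)) (snd w)) \<in> borel_measurable (?MY \<Otimes>\<^sub>M lborel)" for js jn
      unfolding b_rate_def alpha_kernel_def C_stat_def M_tilde_def M_stat_def visit_time_def Let_def
        case_prod_unfold fst_conv snd_conv indicator_def
      by measurable
    then have "(\<lambda>w. ?g (fst (fst (fst w)), snd (fst (fst w))) (fst (snd (fst w))) (fst (snd (snd (snd (snd (fst w))))) (i,j))
          (snd (snd (snd (snd (snd (fst w))))) (i,j)) (snd w)) \<in> borel_measurable (?MY \<Otimes>\<^sub>M lborel)"
      by (rule measurable_by_data[where g="\<lambda>w. fst (fst (fst w))" and h="\<lambda>w. fst (snd (fst w))" and s=s and \<tau>=\<tau>])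
         (unfold obs_space_def, measurable)
    then have "(\<lambda>(y, a). ?g (fst y) (fst (snd y)) (fst (snd (snd (snd (snd y)))) (i,j))
          (snd (snd (snd (snd (snd y)))) (i,j)) a) \<in> borel_measurable (?MY \<Otimes>\<^sub>M lborel)"
      by (simp only: case_prod_unfold prod.collapse)
    moreover have "A \<in> sets lborel" using A by simp
    ultimately have "(\<lambda>y. emeasure (prop_law lborel (?g (fst y) (fst (snd y)) (fst (snd (snd (snd (snd y)))) (i,j))
          (snd (snd (snd (snd (snd y)))) (i,j)))) A) \<in> borel_measurable ?MY"
      by (rule measurable_emeasure_prop_law[OF sigma_lborel])
    then show ?thesis by (simp only: case_prod_unfold)
  qed
  have ae_d: "AE y in ?\<nu>. positive_times \<tau> (fst y)"
    by (intro AE_pair_fst positive_D sigma_intros) auto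
  \<comment> \<open>The entry at \<open>(i,j)\<close> is the integration variable; its positivity
    comes from the support of its own prior.\<close>
  have ae_\<alpha>: "AE y in ?\<nu>. \<forall>e\<in>I - {(i,j)}. 0 < fst (snd (snd (snd y))) e"
    by (intro AE_pair_snd AE_pair_fst AE_\<alpha>s sigma_intros) auto
  have ae_t: "AE y in ?\<nu>. \<forall>e\<in>I. 0 < snd (snd (snd (snd (snd y)))) e"
    by (intro AE_pair_snd AE_ts sigma_intros) auto
  show "AE y in ?\<nu>. \<exists>c<\<infinity>. (c \<noteq> 0 \<longrightarrow> prob_space (?K y)) \<and>
      (\<forall>A\<in>sets borel. (\<integral>\<^sup>+ x. joint_density (?\<phi> x y) * indicator A (?X (?\<phi> x y)) \<partial>\<alpha>_law (i, j)) = c * emeasure (?K y) A)"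
    using ae_d ae_\<alpha> ae_t AE_space
  proof eventually_elim
    case (elim y)
    obtain js x u jn p \<alpha> \<theta> t where y: "y = ((js, x, u), jn, p, \<alpha>, \<theta>, t)" by (metis prod_cases3 surj_pair)
    have pos: "positive_times \<tau> (js, x, u)" using elim(1) unfolding y by simp
    have sp: "(js, x, u) \<in> space (obs_space s \<tau>)" "jn \<in> {1..s}"
      using elim(4) unfolding sets_eq_imp_space_eq[OF sets] y by (auto simp: space_pair_measure)
    have \<alpha>: "\<And>k v. k \<in> I \<Longrightarrow> 0 < v \<Longrightarrow> 0 < (\<alpha>((i, j) := v)) k" using elim(2) unfolding y by auto
    have t: "0 < t (i, j)" using elim(3) e unfolding y by auto
    define R where "R = (\<Prod>i\<in>{1..s}. \<Prod>k\<in>{1..s}. p i k ^ N_tilde \<tau> j0 js jn i k) *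
      (\<Prod>e\<in>I - {(i, j)}. cell \<tau> j0 (m e) (q e) (js, x, u) jn (fst e) (snd e) (\<alpha> e) (\<theta> e) (t e))"
    define cl where "cl v = cell \<tau> j0 (m (i, j)) (q (i, j)) (js, x, u) jn i j v (\<theta> (i, j)) (t (i, j))" for v
    define S where "S = alpha_support (d (i,j)) (\<alpha>0 (i,j)) (\<alpha>1 (i,j))"
    define w where "w v = v powr (m (i,j) - c (i,j)) * (v - \<alpha>0 (i,j)) powr (c (i,j) - 1) *
        exp (- m (i,j) * d (i,j) * v) * indicator S v" for v
    define Z where "Z = (\<integral>v. w v \<partial>lborel)"
    define g where "g = ?g (js, x, u) jn (\<theta> (i,j)) (t (i,j))"
    have K: "?K y = prop_law lborel g" by (simp add: y g_def)
    have law: "\<alpha>_law (i, j) = prop_law lborel w"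
      by (simp add: \<alpha>_law_def alpha_law_def w_def[abs_def] S_def)
    have wm: "w \<in> borel_measurable lborel" unfolding w_def[abs_def] S_def by (rule alpha_prior_kernel_measurable)
    have gm: "g \<in> borel_measurable lborel" unfolding g_def using alpha_kernel_measurable by simp
    have w0: "0 \<le> w v" for v by (simp add: w_def)
    have g0: "0 \<le> g v" for v unfolding g_def by (rule alpha_kernel_nonneg)
    have Z0: "0 \<le> Z" unfolding Z_def using w0 by simp
    have dens: "joint_density (?\<phi> v y) = ennreal (R * cl v)" if "0 < v" for v
    proof -
      have \<alpha>': "\<And>k. k \<in> I \<Longrightarrow> 0 < (\<alpha>((i, j) := v)) k" using \<alpha> that by blast
      show ?thesis
        unfolding y prod.case
        by (subst joint_density_eq[OF sp \<alpha>'], assumption)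
           (subst prod_cells_update[OF e, where \<alpha>=\<alpha> and \<theta>=\<theta> and t=t], auto simp: R_def cl_def mult_ac)
    qed
    have J: "(\<integral>\<^sup>+ v. joint_density (?\<phi> v y) * indicator A (?X (?\<phi> v y)) \<partial>\<alpha>_law (i, j)) =
        (\<integral>\<^sup>+ v. ennreal (R / Z * (cl v * w v)) * indicator A v \<partial>lborel)"
      if A: "A \<in> sets borel" for A
    proof -
      have "(\<lambda>v. joint_density (?\<phi> v y)) \<in> borel_measurable (\<alpha>_law (i, j))"
        by (rule splits_section_measurable[OF splits_base_\<alpha>[OF e] joint_density_measurable elim(4)])
      then have "(\<lambda>v. joint_density (?\<phi> v y) * indicator A (?X (?\<phi> v y))) \<in> borel_measurable lborel"
        using A unfolding y prod.case measurable_cong_sets[OF sets_\<alpha>_law refl]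
        by (intro borel_measurable_times_ennreal borel_measurable_indicator') auto
      then have "(\<integral>\<^sup>+ v. joint_density (?\<phi> v y) * indicator A (?X (?\<phi> v y)) \<partial>\<alpha>_law (i, j)) =
          (\<integral>\<^sup>+ v. ennreal (w v / Z) * (joint_density (?\<phi> v y) * indicator A (?X (?\<phi> v y))) \<partial>lborel)"
        unfolding law Z_def by (rule nn_integral_prop_law[OF wm])
      also have "\<dots> = (\<integral>\<^sup>+ v. ennreal (R / Z * (cl v * w v)) * indicator A v \<partial>lborel)"
      proof (rule nn_integral_cong)
        fix v
        have "ennreal (w v / Z) * joint_density (?\<phi> v y) = ennreal (R / Z * (cl v * w v))"
        \<comment> \<open>Outside the support the prior weight is 0, so a formula for the density at
          positive \<open>v\<close> is enough.\<close>
        proof (cases "v \<in> S")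
          case True
          then have "0 < v" using alpha_support_pos[OF e] by (simp add: S_def)
          then have "ennreal (w v / Z) * joint_density (?\<phi> v y) = ennreal (R * cl v) * ennreal (w v / Z)"
            by (simp add: dens mult.commute)
          also have "\<dots> = ennreal (R * cl v * (w v / Z))"
            using w0 Z0 by (intro ennreal_mult''[symmetric]) simp
          finally show ?thesis by (simp add: mult_ac)
        qed (simp add: w_def)
        then show "ennreal (w v / Z) * (joint_density (?\<phi> v y) * indicator A (?X (?\<phi> v y))) =
            ennreal (R / Z * (cl v * w v)) * indicator A v"
          by (simp add: y mult.assoc[symmetric])
      qed
      finally show ?thesis .
    qed
    show ?case
    \<comment> \<open>Lebesgue measure charges nonpositive \<theta>, where the cell and hence the
      constant is 0. For positive \<theta> the kernel is integrable whether or not the prior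
      normaliser is finite; if \<open>Z = 0\<close>, the factor \<open>R / Z * k\<close> is
      0.\<close>
    proof (cases "0 < \<theta> (i, j)")
      case True
      define k where "k = b_coeff (m (i,j)) (q (i,j)) powr m (i,j) / (Gamma (m (i,j)) * C_stat \<tau> j0 js x i j * \<theta> (i,j))"
      have clw: "cl v * w v = k * g v" for v
      proof (cases "v \<in> S")
        case True': True
        then have "0 < v" using alpha_support_pos[OF e] by (simp add: S_def)
        then show ?thesis unfolding cl_def w_def k_def g_def S_def
          by (intro cell_alpha[OF pos True t]) (use m_pos q_bounds e in auto)
      next
        case False
        then show ?thesis by (simp add: w_def g_def S_def alpha_kernel_def Let_def)
      qed
      have "(\<integral>\<^sup>+ v. joint_density (?\<phi> v y) * indicator A (?X (?\<phi> v y)) \<partial>\<alpha>_law (i, j)) =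
          ennreal (R / Z * k) * (\<integral>\<^sup>+ v. ennreal (g v) * indicator A v \<partial>lborel)"
        if A: "A \<in> sets lborel" for A
      proof -
        have "(\<integral>\<^sup>+ v. ennreal (R / Z * (cl v * w v)) * indicator A v \<partial>lborel) =
           (\<integral>\<^sup>+ v. ennreal (R / Z * k) * (ennreal (g v) * indicator A v) \<partial>lborel)"
          unfolding clw using g0 by (intro nn_integral_cong) (simp add: ennreal_mult''[symmetric] mult.assoc[symmetric])
        also have "\<dots> = ennreal (R / Z * k) * (\<integral>\<^sup>+ v. ennreal (g v) * indicator A v \<partial>lborel)"
          by (intro nn_integral_cmult borel_measurable_times_ennreal measurable_compose[OF gm measurable_ennreal]
              borel_measurable_indicator A)
        finally show ?thesis using J[of A] A by simp
      qed
      moreover have "integrable lborel g"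
        unfolding g_def by (rule alpha_kernel_integrable[OF pos True t])
          (use m_pos q_bounds c_pos d_nonneg \<alpha>0_pos e in auto)
      ultimately show ?thesis unfolding K
        using prop_law_of_proportional[OF gm g0, of "ennreal (R / Z * k)"
          "\<lambda>A. \<integral>\<^sup>+ v. joint_density (?\<phi> v y) * indicator A (?X (?\<phi> v y)) \<partial>\<alpha>_law (i, j)"] by simp
    next
      case False
      then have "cl v = 0" for v unfolding cl_def by (intro cell_nonpos_theta) simp
      with J show ?thesis by (intro exI[of _ 0]) simp
    qed
  qed
qed

section \<open>Claim (d): law of the unseen next state\<close>

lemma splits_base_next_state:
  "splits base E (D \<Otimes>\<^sub>M row_laws {1..s} \<Otimes>\<^sub>M \<alpha>s I \<Otimes>\<^sub>M \<theta>s I \<Otimes>\<^sub>M ts I)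
    (\<lambda>jn (dat, r). (dat, jn, r))"
  unfolding base_def by (intro splits_lift_left splits_pair sigma_intros) auto

lemma cond_law_next_state:
  "cond_law P
       E (\<lambda>(dat, jn, p, \<alpha>, \<theta>, t). jn)
       (obs_space s \<tau> \<Otimes>\<^sub>M matrices {1..s} s \<Otimes>\<^sub>M arrays I \<Otimes>\<^sub>M arrays I \<Otimes>\<^sub>M arrays I)
       (\<lambda>(dat, jn, p, \<alpha>, \<theta>, t). (dat, p, \<alpha>, \<theta>, t))
       (\<lambda>((js, x, u), p, \<alpha>, \<theta>, t). point_measure {1..s} (\<lambda>k. ennreal (
          let l = state_at j0 js \<tau> in
            p l k * exp (- ((u / \<theta> (l,k)) powr \<alpha> (l,k))) /
            (\<Sum>k'\<in>{1..s}. p l k' * exp (- ((u / \<theta> (l,k')) powr \<alpha> (l,k')))))))"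
    (is "cond_law _ _ ?X ?MY ?Y ?K")
proof (rule cond_law_of_splits[OF splits_base_next_state joint_density_measurable P_eq])
  let ?\<nu> = "D \<Otimes>\<^sub>M row_laws {1..s} \<Otimes>\<^sub>M \<alpha>s I \<Otimes>\<^sub>M \<theta>s I \<Otimes>\<^sub>M ts I"
  let ?\<phi> = "\<lambda>jn (dat, r). (dat, jn, r)"
  show sets: "sets ?\<nu> = sets ?MY"
    by (intro sets_pair_measure_cong sets_D sets_row_laws sets_\<alpha>s sets_\<theta>s sets_ts refl)
  note [measurable_cong] = sets_base
  show "?X \<in> measurable base E"
    unfolding case_prod_unfold by measurable
  show "?Y \<in> measurable base ?MY"
    unfolding case_prod_unfold by measurable
  show "?Y (?\<phi> x y) = y" for x y
    by (auto simp: case_prod_unfold)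
  show "sets (?K y) = sets E" for y
    by (simp add: case_prod_unfold sets_point_measure)
  show "(\<lambda>y. emeasure (?K y) A) \<in> borel_measurable ?MY" if A: "A \<in> sets E" for A
  proof -
    have [measurable]: "(\<lambda>w. snd (snd (fst w))) \<in> borel_measurable ?MY"
      unfolding obs_space_def by measurable
    have [measurable]: "(\<lambda>w. fst (snd w) l k) \<in> borel_measurable ?MY" for l k
      by (rule measurable_matrices_apply) measurable
    have [measurable]: "(\<lambda>w. fst (snd (snd w)) e) \<in> borel_measurable ?MY" for e
      by (rule measurable_PiM_borel_apply) measurable
    have [measurable]: "(\<lambda>w. fst (snd (snd (snd w))) e) \<in> borel_measurable ?MY" for e
      by (rule measurable_PiM_borel_apply) measurable
    have "(\<lambda>y. \<Sum>k\<in>A. ennreal (fst (snd y) (state_at j0 js \<tau>) k *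
        exp (- ((snd (snd (fst y)) / fst (snd (snd (snd y))) (state_at j0 js \<tau>,k)) powr fst (snd (snd y)) (state_at j0 js \<tau>,k))) /
            (\<Sum>k'\<in>{1..s}. fst (snd y) (state_at j0 js \<tau>) k' *
        exp (- ((snd (snd (fst y)) / fst (snd (snd (snd y))) (state_at j0 js \<tau>,k')) powr fst (snd (snd y)) (state_at j0 js \<tau>,k')))))) \<in> borel_measurable ?MY" for js
      by measurable
    then have "(\<lambda>y. \<Sum>k\<in>A. ennreal (fst (snd y) (state_at j0 (fst (fst y)) \<tau>) k *
        exp (- ((snd (snd (fst y)) / fst (snd (snd (snd y))) (state_at j0 (fst (fst y)) \<tau>,k)) powr fst (snd (snd y)) (state_at j0 (fst (fst y)) \<tau>,k))) /
            (\<Sum>k'\<in>{1..s}. fst (snd y) (state_at j0 (fst (fst y)) \<tau>) k' *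
        exp (- ((snd (snd (fst y)) / fst (snd (snd (snd y))) (state_at j0 (fst (fst y)) \<tau>,k')) powr fst (snd (snd y)) (state_at j0 (fst (fst y)) \<tau>,k')))))) \<in> borel_measurable ?MY"
      by (rule measurable_by_states[where g="\<lambda>y. fst (fst y)" and s=s and \<tau>=\<tau>])
         (unfold obs_space_def, measurable)
    moreover have "A \<subseteq> {1..s}" using A by simp
    ultimately show ?thesis
      by (simp only: case_prod_unfold Let_def emeasure_point_measure_finite finite_atLeastAtMost)
  qed
  have ae_p: "AE y in ?\<nu>. \<forall>l\<in>{1..s}. fst (snd y) l \<in> prob_simplex s"
    by (intro AE_pair_snd AE_pair_fst AE_row_laws sigma_intros) auto
  show "AE y in ?\<nu>. \<exists>c<\<infinity>. (c \<noteq> 0 \<longrightarrow> prob_space (?K y)) \<and>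
      (\<forall>A\<in>sets E. (\<integral>\<^sup>+ k. joint_density (?\<phi> k y) * indicator A (?X (?\<phi> k y)) \<partial>E) = c * emeasure (?K y) A)"
    using ae_p AE_space
  proof eventually_elim
    case (elim y)
    obtain js x u p \<alpha> \<theta> t where y: "y = ((js, x, u), p, \<alpha>, \<theta>, t)" by (metis prod_cases3 surj_pair)
    have sp: "(js, x, u) \<in> space (obs_space s \<tau>)"
      using elim(2) unfolding sets_eq_imp_space_eq[OF sets] y by (auto simp: space_pair_measure)
    define l where "l = state_at j0 js \<tau>"
    have l: "l \<in> {1..s}" unfolding l_def by (rule state_at_last[OF sp])
    define w where "w k = p l k * exp (- ((u / \<theta> (l,k)) powr \<alpha> (l,k)))" for k
    define S where "S = (\<Sum>k\<in>{1..s}. w k)"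
    have p: "p l \<in> prob_simplex s" using elim(1) l unfolding y by simp
    then have w0: "0 \<le> w k" if "k \<in> {1..s}" for k using that by (simp add: w_def prob_simplex_def)
    \<comment> \<open>A probability row has a positive entry, and the survival factors are positive.
      This makes the stated mass function a probability at almost every \<open>y\<close>.\<close>
    have S: "0 < S"
    proof -
      have "\<exists>k\<in>{1..s}. 0 < p l k"
      proof (rule ccontr)
        assume "\<not> ?thesis"
        then have "(\<Sum>k\<in>{1..s}. p l k) \<le> 0" by (intro sum_nonpos) force
        then show False using p by (simp add: prob_simplex_def)
      qed
      then obtain k where "k \<in> {1..s}" "0 < w k" by (auto simp: w_def)
      then show ?thesis unfolding S_def using w0 by (intro sum_pos2[of _ k]) auto
    qed
    have K: "?K y = point_measure {1..s} (\<lambda>k. ennreal (w k / S))"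
      by (simp add: y Let_def w_def S_def l_def)
    \<comment> \<open>The likelihood is kept in its original form here, because in it the next state
      occurs only in the last factor, whereas \<open>N_tilde\<close> and \<open>M_tilde\<close>
      spread it over all strings.\<close>
    define R where "R = (\<Prod>(i,k)\<in>{1..s} \<times> {1..s}. p i k ^ N_visits \<tau> j0 js i k) *
     (\<Prod>(i,k)\<in>{1..s} \<times> {1..s}.
        \<alpha> (i,k) ^ N_visits \<tau> j0 js i k / \<theta> (i,k) powr (\<alpha> (i,k) * real (N_visits \<tau> j0 js i k)) *
        C_stat \<tau> j0 js x i k powr (\<alpha> (i,k) - 1) *
        exp (- (1 / \<theta> (i,k) powr \<alpha> (i,k)) * M_stat \<tau> j0 js x i k (\<alpha> (i,k))))"
    define G where "G = (\<Prod>e\<in>I. gig_density (m e) (b_rate (m e) (q e) (t e) (\<alpha> e)) (\<alpha> e) (\<theta> e))"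
    have dens: "joint_density (?\<phi> k y) = ennreal R * ennreal G * ennreal S * ennreal (w k / S)" if k: "k \<in> {1..s}" for k
    proof -
      have "joint_density (?\<phi> k y) = ennreal (R * w k) * ennreal G"
        by (simp add: y joint_density_def full_likelihood_def Let_def R_def G_def w_def l_def)
      also have "\<dots> = ennreal R * ennreal (w k) * ennreal G" using w0[OF k] by (simp add: ennreal_mult'')
      also have "ennreal (w k) = ennreal S * ennreal (w k / S)"
        using S w0[OF k] by (subst ennreal_mult''[symmetric]) auto
      finally show ?thesis by (simp add: mult_ac)
    qed
    show ?case
    proof (intro exI[of _ "ennreal R * ennreal G * ennreal S"] conjI impI ballI)
      show "ennreal R * ennreal G * ennreal S < \<infinity>" by (simp add: ennreal_mult_less_top)
      show "prob_space (?K y)"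
      proof (rule prob_spaceI)
        have "emeasure (?K y) {1..s} = (\<Sum>k\<in>{1..s}. ennreal (w k / S))"
          unfolding K by (rule emeasure_point_measure_finite) auto
        also have "\<dots> = ennreal (\<Sum>k\<in>{1..s}. w k / S)" using w0 S by (intro sum_ennreal) auto
        also have "(\<Sum>k\<in>{1..s}. w k / S) = 1" using S by (simp add: S_def flip: sum_divide_distrib)
        finally show "emeasure (?K y) (space (?K y)) = 1" by (simp add: K space_point_measure)
      qed
      fix A assume "A \<in> sets E"
      then have A: "A \<subseteq> {1..s}" by simp
      have "(\<integral>\<^sup>+ k. joint_density (?\<phi> k y) * indicator A (?X (?\<phi> k y)) \<partial>E) =
          (\<Sum>k\<in>{1..s}. joint_density (?\<phi> k y) * indicator A k)"
        by (subst nn_integral_count_space_finite) (auto simp: y)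
      also have "\<dots> = (\<Sum>k\<in>A. joint_density (?\<phi> k y))"
        using A by (intro sum.mono_neutral_cong_right) auto
      also have "\<dots> = (\<Sum>k\<in>A. ennreal R * ennreal G * ennreal S * ennreal (w k / S))"
        using A by (intro sum.cong refl dens) auto
      also have "\<dots> = ennreal R * ennreal G * ennreal S * emeasure (?K y) A"
        unfolding K sum_distrib_left[symmetric]
        by (subst emeasure_point_measure_finite) (use A in auto)
      finally show "(\<integral>\<^sup>+ k. joint_density (?\<phi> k y) * indicator A (?X (?\<phi> k y)) \<partial>E) =
          ennreal R * ennreal G * ennreal S * emeasure (?K y) A" .
    qed
  qed
qed

section \<open>Claim (e): truncated generalized Gamma law of the quantile hyperparameter\<close>

lemma splits_t:
  assumes "e \<in> I"
  shows "splits (D \<Otimes>\<^sub>M row_laws {1..s} \<Otimes>\<^sub>M \<alpha>s I \<Otimes>\<^sub>M \<theta>s I \<Otimes>\<^sub>M ts I) (t_entry_law e)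
    (D \<Otimes>\<^sub>M row_laws {1..s} \<Otimes>\<^sub>M \<alpha>s I \<Otimes>\<^sub>M \<theta>s I \<Otimes>\<^sub>M ts (I - {e}))
    (\<lambda>x (dat, p, \<alpha>, \<theta>, t). (dat, p, \<alpha>, \<theta>, t(e := x)))"
proof -
  have s0: "splits (ts I) (t_entry_law e) (ts (I - {e})) (\<lambda>x f. f(e := x))"
    unfolding ts_def using assms by (intro splits_PiM sigma_t_entry_law) auto
  show ?thesis
    using splits_lift_left[OF sigma_D _ splits_lift_left[OF sigma_row_laws _
          splits_lift_left[OF sigma_\<alpha>s _ splits_lift_left[OF sigma_\<theta>s _ s0]]],
        of "{1..s}" I I]
    by (simp add: case_prod_unfold sigma_intros)
qed

lemma splits_base_next_state_t:
  assumes "e \<in> I"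
  shows "splits base (E \<Otimes>\<^sub>M t_entry_law e)
    (D \<Otimes>\<^sub>M row_laws {1..s} \<Otimes>\<^sub>M \<alpha>s I \<Otimes>\<^sub>M \<theta>s I \<Otimes>\<^sub>M ts (I - {e}))
    (\<lambda>(jn, x) (dat, p, \<alpha>, \<theta>, t). (dat, jn, p, \<alpha>, \<theta>, t(e := x)))"
  using splits_compose[OF splits_base_next_state splits_t[OF assms]]
  by (simp add: case_prod_unfold)

text \<open>The disjunction lets both descriptions of the kernel share one section computation. They
  are identified only at positive \<alpha> and \<theta>, so measurability in the conditioning
  variables is proved for each of them separately.\<close>

lemma cond_law_t:
  assumes e: "(i, j) \<in> I" and unif: "\<pi>t (i, j) = Uniform t1 t2"
    and K: "K = (\<lambda>(dat, p, \<alpha>, \<theta>, t). prop_law lborel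
      (\<lambda>y. \<alpha> (i,j) / (\<theta> (i,j) * ((1 - q (i,j)) powr (- 1 / m (i,j)) - 1) powr (1 / \<alpha> (i,j))) powr (\<alpha> (i,j) * m (i,j) + 1) /
        Gamma ((\<alpha> (i,j) * m (i,j) + 1) / \<alpha> (i,j)) * y powr (\<alpha> (i,j) * m (i,j) + 1 - 1) *
        exp (- ((y / (\<theta> (i,j) * ((1 - q (i,j)) powr (- 1 / m (i,j)) - 1) powr (1 / \<alpha> (i,j)))) powr \<alpha> (i,j))) * indicator {t1<..<t2} y)) \<or>
      K = (\<lambda>(dat, p, \<alpha>, \<theta>, t). trunc_gen_gamma (\<theta> (i,j) * ((1 - q (i,j)) powr (- 1 / m (i,j)) - 1) powr (1 / \<alpha> (i,j)))
        (\<alpha> (i,j) * m (i,j) + 1) (\<alpha> (i,j)) t1 t2)" (is "K = ?Kp \<or> K = ?Kt")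
  shows "cond_law P borel (\<lambda>(dat, jn, p, \<alpha>, \<theta>, t). t (i,j))
    (obs_space s \<tau> \<Otimes>\<^sub>M matrices {1..s} s \<Otimes>\<^sub>M arrays I \<Otimes>\<^sub>M arrays I \<Otimes>\<^sub>M arrays (I - {(i,j)}))
    (\<lambda>(dat, jn, p, \<alpha>, \<theta>, t). (dat, p, \<alpha>, \<theta>, restrict t (I - {(i,j)}))) K"
    (is "cond_law _ _ ?X ?MY ?Y _")
proof (rule cond_law_of_splits[OF splits_base_next_state_t[OF e] joint_density_measurable P_eq])
  let ?\<nu> = "D \<Otimes>\<^sub>M row_laws {1..s} \<Otimes>\<^sub>M \<alpha>s I \<Otimes>\<^sub>M \<theta>s I \<Otimes>\<^sub>M ts (I - {(i,j)})"
  let ?\<phi> = "\<lambda>(jn, x) (dat, p, \<alpha>, \<theta>, t). (dat, jn, p, \<alpha>, \<theta>, t((i,j) := x))"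
  let ?\<mu> = "E \<Otimes>\<^sub>M t_entry_law (i, j)"
  have t12: "0 \<le> t1" "t1 < t2" using valid_t[OF e] unif by auto
  have mq: "0 < m (i,j)" "0 < q (i,j)" "q (i,j) < 1" using m_pos[OF e] q_bounds[OF e] by auto
  show sets: "sets ?\<nu> = sets ?MY"
    by (intro sets_pair_measure_cong sets_D sets_row_laws sets_\<alpha>s sets_\<theta>s sets_ts refl)
  note [measurable_cong] = sets_base
  have [measurable]: "(\<lambda>p. restrict p (I - {(i,j)})) \<in> measurable (arrays I) (arrays (I - {(i,j)}))"
    by (rule measurable_restrict_subset) auto
  show "?X \<in> measurable base borel"
  proof -
    note [measurable] = measurable_PiM_borel_component
    show ?thesis unfolding case_prod_unfold by measurable
  qed
  show "?Y \<in> measurable base ?MY"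
    unfolding case_prod_unfold by measurable
  show "?Y (?\<phi> x y) = y" if "x \<in> space ?\<mu>" "y \<in> space ?MY" for x y
    using that(2) by (cases x) (auto simp: space_pair_measure space_PiM PiE_def extensional_def fun_eq_iff)
  show "sets (K y) = sets borel" for y
    using K by (auto simp: case_prod_unfold trunc_gen_gamma_def gen_gamma_def)
  show "(\<lambda>y. emeasure (K y) A) \<in> borel_measurable ?MY" if A: "A \<in> sets borel" for A
  proof -
    have Al: "A \<in> sets lborel" using A by simp
    have [measurable]: "(\<lambda>w. fst (snd (snd (fst w))) e) \<in> borel_measurable (?MY \<Otimes>\<^sub>M lborel)" for e
      by (rule measurable_PiM_borel_apply) measurable
    have [measurable]: "(\<lambda>w. fst (snd (snd (snd (fst w)))) e) \<in> borel_measurable (?MY \<Otimes>\<^sub>M lborel)" for e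
      by (rule measurable_PiM_borel_apply) measurable
    have 1: "(\<lambda>y. emeasure (?Kp y) A) \<in> borel_measurable ?MY"
      unfolding case_prod_unfold
    proof (rule measurable_emeasure_prop_law[OF sigma_lborel _ Al])
      show "(\<lambda>(z, y). fst (snd (snd z)) (i,j) / (fst (snd (snd (snd z))) (i,j) * ((1 - q (i,j)) powr (- 1 / m (i,j)) - 1) powr (1 / fst (snd (snd z)) (i,j))) powr (fst (snd (snd z)) (i,j) * m (i,j) + 1) /
        Gamma ((fst (snd (snd z)) (i,j) * m (i,j) + 1) / fst (snd (snd z)) (i,j)) * y powr (fst (snd (snd z)) (i,j) * m (i,j) + 1 - 1) *
        exp (- ((y / (fst (snd (snd (snd z))) (i,j) * ((1 - q (i,j)) powr (- 1 / m (i,j)) - 1) powr (1 / fst (snd (snd z)) (i,j)))) powr fst (snd (snd z)) (i,j))) * indicator {t1<..<t2} y)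
        \<in> borel_measurable (?MY \<Otimes>\<^sub>M lborel)"
        unfolding case_prod_unfold by measurable
    qed
    have 2: "(\<lambda>y. emeasure (gen_gamma (fst (snd (snd (snd y))) (i,j) * ((1 - q (i,j)) powr (- 1 / m (i,j)) - 1) powr (1 / fst (snd (snd y)) (i,j)))
        (fst (snd (snd y)) (i,j) * m (i,j) + 1) (fst (snd (snd y)) (i,j))) C) \<in> borel_measurable ?MY"
      if C: "C \<in> sets lborel" for C
      unfolding gen_gamma_def
    proof (rule measurable_emeasure_density[OF sigma_lborel _ C])
      show "(\<lambda>(y, x). ennreal (gen_gamma_density (fst (snd (snd (snd y))) (i,j) * ((1 - q (i,j)) powr (- 1 / m (i,j)) - 1) powr (1 / fst (snd (snd y)) (i,j)))
        (fst (snd (snd y)) (i,j) * m (i,j) + 1) (fst (snd (snd y)) (i,j)) x)) \<in> borel_measurable (?MY \<Otimes>\<^sub>M lborel)"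
        unfolding case_prod_unfold gen_gamma_density_def by measurable
    qed
    have 3: "(\<lambda>y. emeasure (?Kt y) A) \<in> borel_measurable ?MY"
    proof -
      \<comment> \<open>Conditioning is a quotient of two measures under the untruncated law, each
        measurable in the parameters.\<close>
      have "emeasure (trunc_gen_gamma a b c t1 t2) A =
          emeasure (gen_gamma a b c) ({t1<..<t2} \<inter> A) / emeasure (gen_gamma a b c) {t1<..<t2}" for a b c
        unfolding trunc_gen_gamma_def using A by (intro emeasure_uniform_measure) (auto simp: gen_gamma_def)
      then show ?thesis
        unfolding case_prod_unfold using A by (simp only:) (intro borel_measurable_divide_ennreal 2; simp)
    qed
    show ?thesis using K 1 3 by blast
  qed
  have ae_\<alpha>: "AE y in ?\<nu>. \<forall>e\<in>I. 0 < fst (snd (snd y)) e"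
    by (intro AE_pair_snd AE_pair_fst AE_\<alpha>s sigma_intros) auto
  show "AE y in ?\<nu>. \<exists>c<\<infinity>. (c \<noteq> 0 \<longrightarrow> prob_space (K y)) \<and>
      (\<forall>A\<in>sets borel. (\<integral>\<^sup>+ v. joint_density (?\<phi> v y) * indicator A (?X (?\<phi> v y)) \<partial>?\<mu>) = c * emeasure (K y) A)"
    using ae_\<alpha> AE_space
  proof eventually_elim
    case (elim y)
    obtain js x u p \<alpha> \<theta> t where y: "y = ((js, x, u), p, \<alpha>, \<theta>, t)" by (metis prod_cases3 surj_pair)
    have sp: "(js, x, u) \<in> space (obs_space s \<tau>)"
      using elim(2) unfolding sets_eq_imp_space_eq[OF sets] y by (auto simp: space_pair_measure)
    have \<alpha>: "\<And>e. e \<in> I \<Longrightarrow> 0 < \<alpha> e" using elim(1) unfolding y by auto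
    define a where "a = \<alpha> (i, j)"
    have a: "0 < a" using \<alpha>[OF e] by (simp add: a_def)
    define A0 where "A0 = \<theta> (i,j) * ((1 - q (i,j)) powr (- 1 / m (i,j)) - 1) powr (1 / a)"
    define R where "R jn = (\<Prod>i\<in>{1..s}. \<Prod>k\<in>{1..s}. p i k ^ N_tilde \<tau> j0 js jn i k) *
      (\<Prod>e\<in>I - {(i, j)}. cell \<tau> j0 (m e) (q e) (js, x, u) jn (fst e) (snd e) (\<alpha> e) (\<theta> e) (t e))" for jn
    have dens: "joint_density (?\<phi> (jn, v) y) = ennreal (R jn * cell \<tau> j0 (m (i, j)) (q (i, j)) (js, x, u) jn i j a (\<theta> (i, j)) v)"
      if "jn \<in> {1..s}" for jn v
      unfolding y prod.case
      by (subst joint_density_eq[OF sp that \<alpha>], assumption)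
         (subst prod_cells_update[OF e, where \<alpha>=\<alpha> and \<theta>=\<theta> and t=t], auto simp: R_def a_def mult_ac)
    show ?case
    proof (cases "0 < \<theta> (i, j)")
      case False
      then have "joint_density (?\<phi> v y) = 0" if "v \<in> space ?\<mu>" for v
        using dens[of "fst v" "snd v"] cell_nonpos_theta[of "\<theta> (i, j)"] that
        by (auto simp: space_pair_measure not_less)
      then have "(\<integral>\<^sup>+ v. joint_density (?\<phi> v y) * indicator A (?X (?\<phi> v y)) \<partial>?\<mu>) = (\<integral>\<^sup>+ v. 0 \<partial>?\<mu>)" for A
        by (intro nn_integral_cong) simp
      then show ?thesis by (intro exI[of _ 0]) simp
    next
      case \<theta>: True
      have k': "0 < (1 - q (i,j)) powr (- 1 / m (i,j)) - 1"
        using b_coeff_pos[OF mq] by (simp add: b_coeff_def)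
      have A0: "0 < A0" unfolding A0_def using \<theta> k' by (intro mult_pos_pos) auto
      define h where "h v = v powr (a * m (i,j)) * exp (- ((v / A0) powr a))" for v
      \<comment> \<open>The density in (e) displays this constant of the generalized Gamma law; the
        factor \<open>1 / C\<close> removes it again.\<close>
      define C where "C = a / A0 powr (a * m (i,j) + 1) / Gamma ((a * m (i,j) + 1) / a)"
      define g where "g v = C * v powr (a * m (i,j) + 1 - 1) * exp (- ((v / A0) powr a)) * indicator {t1<..<t2} v" for v
      define k where "k jn = a ^ N_visits \<tau> j0 js i j / \<theta> (i, j) powr (a * real (N_visits \<tau> j0 js i j)) *
        C_stat \<tau> j0 js x i j powr (a - 1) *
        exp (- (M_tilde \<tau> j0 (js, x, u) jn i j a / \<theta> (i, j) powr a)) *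
        (a * b_coeff (m (i,j)) (q (i,j)) powr m (i,j) / Gamma (m (i,j)) * \<theta> (i, j) powr (- (1 + m (i,j) * a)))" for jn
      have C: "0 < C" unfolding C_def using A0 a mq
        by (intro divide_pos_pos Gamma_real_pos add_pos_pos mult_pos_pos) auto
      have gh: "g v = C * h v * indicator {t1<..<t2} v" for v by (simp add: g_def h_def)
      have h0: "0 \<le> h v" for v by (simp add: h_def)
      have g0: "0 \<le> g v" for v using C h0 by (simp add: gh)
      have hm[measurable]: "h \<in> borel_measurable borel" unfolding h_def[abs_def] by measurable
      have gm: "g \<in> borel_measurable lborel" unfolding g_def[abs_def] by measurable
      have int: "integrable lborel g"
        unfolding g_def[abs_def] by (rule integrable_trunc_gen_gamma_kernel) (use a mq t12 in auto)
      have Kp: "?Kp y = prop_law lborel g"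
        by (simp only: y prod.case g_def[abs_def] C_def A0_def a_def)
      have "?Kt y = trunc_gen_gamma A0 (a * m (i,j) + 1) a t1 t2"
        by (simp only: y prod.case A0_def a_def)
      also have "\<dots> = prop_law lborel g"
        unfolding g_def[abs_def] C_def by (rule trunc_gen_gamma_eq_prop_law) (use A0 a mq t12 in auto)
      finally have Ky: "K y = prop_law lborel g" using K Kp by auto
      \<comment> \<open>The unobserved next state affects only \<open>R\<close> and
        \<open>k\<close>, while the dependence \<open>h\<close> on t is common to all states.
        Summing it out therefore preserves the shape of the kernel.\<close>
      define c0 where "c0 = (\<Sum>jn\<in>{1..s}. ennreal (R jn * k jn))"
      have J: "(\<integral>\<^sup>+ v. joint_density (?\<phi> v y) * indicator A (?X (?\<phi> v y)) \<partial>?\<mu>) =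
          (c0 / ennreal (t2 - t1) * ennreal (1 / C)) * (\<integral>\<^sup>+ v. ennreal (g v) * indicator A v \<partial>lborel)"
        if Al: "A \<in> sets lborel" for A
      proof -
        have A[measurable]: "A \<in> sets borel" using Al by simp
        interpret T: sigma_finite_measure "t_entry_law (i, j)" by (rule sigma_t_entry_law)
        have m1: "(\<lambda>v. joint_density (?\<phi> v y) * indicator A (?X (?\<phi> v y))) \<in> borel_measurable ?\<mu>"
        proof (rule borel_measurable_times_ennreal)
          show "(\<lambda>v. joint_density (?\<phi> v y)) \<in> borel_measurable ?\<mu>"
            by (rule splits_section_measurable[OF splits_base_next_state_t[OF e] joint_density_measurable elim(2)])
          show "(\<lambda>v. indicator A (?X (?\<phi> v y))) \<in> borel_measurable ?\<mu>"
            unfolding y case_prod_unfold fst_conv snd_conv fun_upd_same by measurable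
        qed
        have tA: "t_entry_law (i, j) = uniform_measure lborel {t1<..<t2}"
          by (simp add: t_entry_law_def unif)
        have "(\<integral>\<^sup>+ v. joint_density (?\<phi> v y) * indicator A (?X (?\<phi> v y)) \<partial>?\<mu>) =
            (\<integral>\<^sup>+ jn. \<integral>\<^sup>+ v. joint_density (?\<phi> (jn, v) y) * indicator A (?X (?\<phi> (jn, v) y)) \<partial>t_entry_law (i, j) \<partial>E)"
          by (rule T.nn_integral_fst[symmetric, OF m1])
        also have "\<dots> = (\<Sum>jn\<in>{1..s}. \<integral>\<^sup>+ v. joint_density (?\<phi> (jn, v) y) * indicator A (?X (?\<phi> (jn, v) y)) \<partial>t_entry_law (i, j))"
          by (rule nn_integral_count_space_finite) simp
        also have "\<dots> = (\<Sum>jn\<in>{1..s}. ennreal (R jn * k jn) * (\<integral>\<^sup>+ v. ennreal (h v) * indicator A v \<partial>t_entry_law (i, j)))"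
        proof (rule sum.cong[OF refl])
          fix jn assume jn: "jn \<in> {1..s}"
          \<comment> \<open>\<open>cell_t\<close> requires a positive argument; this is available
            even for \<open>t1 = 0\<close> because the interval is open.\<close>
          have "AE v in t_entry_law (i, j). 0 < v"
            unfolding t_entry_law_def by (rule AE_t_law[OF valid_t[OF e]])
          then have "AE v in t_entry_law (i, j). joint_density (?\<phi> (jn, v) y) * indicator A (?X (?\<phi> (jn, v) y)) =
              ennreal (R jn * k jn) * (ennreal (h v) * indicator A v)"
          proof eventually_elim
            case (elim v)
            have "joint_density (?\<phi> (jn, v) y) = ennreal (R jn * k jn * h v)"
              unfolding dens[OF jn] cell_t[OF elim \<theta> a mq] k_def h_def A0_def by (simp only: mult.assoc)
            also have "\<dots> = ennreal (R jn * k jn) * ennreal (h v)" by (rule ennreal_mult''[OF h0])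
            finally show ?case by (simp add: y mult.assoc)
          qed
          then have "(\<integral>\<^sup>+ v. joint_density (?\<phi> (jn, v) y) * indicator A (?X (?\<phi> (jn, v) y)) \<partial>t_entry_law (i, j)) =
              (\<integral>\<^sup>+ v. ennreal (R jn * k jn) * (ennreal (h v) * indicator A v) \<partial>t_entry_law (i, j))"
            by (rule nn_integral_cong_AE)
          also have "\<dots> = ennreal (R jn * k jn) * (\<integral>\<^sup>+ v. ennreal (h v) * indicator A v \<partial>t_entry_law (i, j))"
            by (rule nn_integral_cmult) measurable
          finally show "(\<integral>\<^sup>+ v. joint_density (?\<phi> (jn, v) y) * indicator A (?X (?\<phi> (jn, v) y)) \<partial>t_entry_law (i, j)) = \<dots>" .
        qed
        also have "\<dots> = c0 * (\<integral>\<^sup>+ v. ennreal (h v) * indicator A v \<partial>t_entry_law (i, j))"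
          by (simp only: c0_def sum_distrib_right)
        also have "(\<integral>\<^sup>+ v. ennreal (h v) * indicator A v \<partial>t_entry_law (i, j)) =
            (\<integral>\<^sup>+ v. ennreal (h v) * indicator A v * indicator {t1<..<t2} v \<partial>lborel) / ennreal (t2 - t1)"
          unfolding tA using t12 by (subst nn_integral_uniform_measure) auto
        also have "(\<integral>\<^sup>+ v. ennreal (h v) * indicator A v * indicator {t1<..<t2} v \<partial>lborel) =
            (\<integral>\<^sup>+ v. ennreal (1 / C) * (ennreal (g v) * indicator A v) \<partial>lborel)"
          using C h0 by (intro nn_integral_cong) (auto simp: gh ennreal_mult'[symmetric] mult.assoc[symmetric] split: split_indicator)
        also have "\<dots> = ennreal (1 / C) * (\<integral>\<^sup>+ v. ennreal (g v) * indicator A v \<partial>lborel)"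
          by (intro nn_integral_cmult borel_measurable_times_ennreal measurable_compose[OF gm measurable_ennreal]
              borel_measurable_indicator Al)
        also have "c0 * (ennreal (1 / C) * (\<integral>\<^sup>+ v. ennreal (g v) * indicator A v \<partial>lborel) / ennreal (t2 - t1)) =
            (c0 / ennreal (t2 - t1) * ennreal (1 / C)) * (\<integral>\<^sup>+ v. ennreal (g v) * indicator A v \<partial>lborel)"
          by (simp add: divide_ennreal_def mult_ac)
        finally show ?thesis .
      qed
      have "c0 < \<infinity>" unfolding c0_def by (simp add: less_top[symmetric])
      then have "c0 / ennreal (t2 - t1) * ennreal (1 / C) < \<infinity>"
        unfolding divide_ennreal_def using t12
        by (simp add: inverse_ennreal ennreal_mult_less_top)
      from prop_law_of_proportional[OF gm g0 int this J]
      show ?thesis unfolding Ky by simp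
    qed
  qed
qed

end

theorem propositionA1:
  fixes s \<tau> j0 i j :: nat
    and \<gamma> :: "nat \<Rightarrow> nat \<Rightarrow> real"
    and m q c d \<alpha>0 \<alpha>1 :: "nat \<times> nat \<Rightarrow> real"
    and \<pi>t :: "nat \<times> nat \<Rightarrow> t_prior"
    and D :: "obs measure"
  assumes "1 \<le> \<tau>" and "j0 \<in> {1..s}"
    and "sigma_finite_measure D" and "sets D = sets (obs_space s \<tau>)"
    and "AE dat in D. positive_times \<tau> dat"
    and "\<And>i k. i \<in> {1..s} \<Longrightarrow> k \<in> {1..s} \<Longrightarrow> 0 < \<gamma> i k"
    and "\<And>e. e \<in> index_pairs s \<Longrightarrow> 0 < m e"
    and "\<And>e. e \<in> index_pairs s \<Longrightarrow> 0 < q e \<and> q e < 1"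
    and "\<And>e. e \<in> index_pairs s \<Longrightarrow> 0 < c e"
    and "\<And>e. e \<in> index_pairs s \<Longrightarrow> 0 \<le> d e"
    and "\<And>e. e \<in> index_pairs s \<Longrightarrow> 0 < \<alpha>0 e"
    and "\<And>e. e \<in> index_pairs s \<Longrightarrow> d e = 0 \<Longrightarrow> \<alpha>0 e < \<alpha>1 e"
    and "\<And>e. e \<in> index_pairs s \<Longrightarrow> valid_t_prior (\<pi>t e)"
    and "i \<in> {1..s}" and "j \<in> {1..s}"
  shows
    "let P = joint_law s \<tau> j0 D (prior_law s \<gamma> m q c d \<alpha>0 \<alpha>1 \<pi>t);
         I = index_pairs s;
         E = count_space {1..s}
     in
     \<comment> \<open>(a)\<close>
     cond_law P
       (row_space s) (\<lambda>(dat, jn, p, \<alpha>, \<theta>, t). p i)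
       (obs_space s \<tau> \<Otimes>\<^sub>M E \<Otimes>\<^sub>M matrices ({1..s} - {i}) s \<Otimes>\<^sub>M arrays I \<Otimes>\<^sub>M arrays I \<Otimes>\<^sub>M arrays I)
       (\<lambda>(dat, jn, p, \<alpha>, \<theta>, t). (dat, jn, restrict p ({1..s} - {i}), \<alpha>, \<theta>, t))
       (\<lambda>((js, x, u), jn, p, \<alpha>, \<theta>, t). dirichlet s (\<lambda>k. real (N_tilde \<tau> j0 js jn i k) + \<gamma> i k))
     \<and>
     \<comment> \<open>(b)\<close>
     cond_law P
       borel (\<lambda>(dat, jn, p, \<alpha>, \<theta>, t). \<theta> (i,j) powr \<alpha> (i,j))
       (obs_space s \<tau> \<Otimes>\<^sub>M E \<Otimes>\<^sub>M matrices {1..s} s \<Otimes>\<^sub>M arrays I \<Otimes>\<^sub>M arrays (I - {(i,j)}) \<Otimes>\<^sub>M arrays I)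
       (\<lambda>(dat, jn, p, \<alpha>, \<theta>, t). (dat, jn, p, \<alpha>, restrict \<theta> (I - {(i,j)}), t))
       (\<lambda>((js, x, u), jn, p, \<alpha>, \<theta>, t).
          inv_gamma (m (i,j) + real (N_visits \<tau> j0 js i j))
            (b_rate (m (i,j)) (q (i,j)) (t (i,j)) (\<alpha> (i,j)) + M_tilde \<tau> j0 (js, x, u) jn i j (\<alpha> (i,j))))
     \<and>
     \<comment> \<open>(c)\<close>
     cond_law P
       borel (\<lambda>(dat, jn, p, \<alpha>, \<theta>, t). \<alpha> (i,j))
       (obs_space s \<tau> \<Otimes>\<^sub>M E \<Otimes>\<^sub>M matrices {1..s} s \<Otimes>\<^sub>M arrays (I - {(i,j)}) \<Otimes>\<^sub>M arrays I \<Otimes>\<^sub>M arrays I)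
       (\<lambda>(dat, jn, p, \<alpha>, \<theta>, t). (dat, jn, p, restrict \<alpha> (I - {(i,j)}), \<theta>, t))
       (\<lambda>(dat, jn, p, \<alpha>, \<theta>, t). prop_law lborel
          (alpha_kernel \<tau> j0 (m (i,j)) (q (i,j)) (c (i,j)) (d (i,j)) (\<alpha>0 (i,j)) (\<alpha>1 (i,j)) i j
             dat jn (\<theta> (i,j)) (t (i,j))))
     \<and>
     (1 \<le> c (i,j) \<longrightarrow>
        (\<forall>dat\<in>space (obs_space s \<tau>). \<forall>jn\<in>{1..s}. \<forall>\<theta>ij>0. \<forall>tij>0. positive_times \<tau> dat \<longrightarrow>
           log_concave (normalized lborel
             (alpha_kernel \<tau> j0 (m (i,j)) (q (i,j)) (c (i,j)) (d (i,j)) (\<alpha>0 (i,j)) (\<alpha>1 (i,j)) i j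
                dat jn \<theta>ij tij))))
     \<and>
     \<comment> \<open>(d)\<close>
     cond_law P
       E (\<lambda>(dat, jn, p, \<alpha>, \<theta>, t). jn)
       (obs_space s \<tau> \<Otimes>\<^sub>M matrices {1..s} s \<Otimes>\<^sub>M arrays I \<Otimes>\<^sub>M arrays I \<Otimes>\<^sub>M arrays I)
       (\<lambda>(dat, jn, p, \<alpha>, \<theta>, t). (dat, p, \<alpha>, \<theta>, t))
       (\<lambda>((js, x, u), p, \<alpha>, \<theta>, t). point_measure {1..s} (\<lambda>k. ennreal (
          let l = state_at j0 js \<tau> in
            p l k * exp (- ((u / \<theta> (l,k)) powr \<alpha> (l,k))) /
            (\<Sum>k'\<in>{1..s}. p l k' * exp (- ((u / \<theta> (l,k')) powr \<alpha> (l,k')))))))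
     \<and>
     \<comment> \<open>(e)\<close>
     (\<forall>t1 t2. \<pi>t (i,j) = Uniform t1 t2 \<longrightarrow>
       (let X = (\<lambda>(dat, jn, p, \<alpha>, \<theta>, t). t (i,j));
            MY = obs_space s \<tau> \<Otimes>\<^sub>M matrices {1..s} s \<Otimes>\<^sub>M arrays I \<Otimes>\<^sub>M arrays I \<Otimes>\<^sub>M arrays (I - {(i,j)});
            Y = (\<lambda>(dat, jn, p, \<alpha>, \<theta>, t). (dat, p, \<alpha>, \<theta>, restrict t (I - {(i,j)})));
            ga = (\<lambda>\<alpha> \<theta>. \<theta> (i,j) * ((1 - q (i,j)) powr (- 1 / m (i,j)) - 1) powr (1 / \<alpha> (i,j)));
            gd = (\<lambda>\<alpha>. \<alpha> (i,j) * m (i,j) + 1);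
            gp = (\<lambda>\<alpha>. \<alpha> (i,j))
        in
        cond_law P borel X MY Y
          (\<lambda>(dat, p, \<alpha>, \<theta>, t). trunc_gen_gamma (ga \<alpha> \<theta>) (gd \<alpha>) (gp \<alpha>) t1 t2)
        \<and>
        cond_law P borel X MY Y
          (\<lambda>(dat, p, \<alpha>, \<theta>, t). prop_law lborel
             (\<lambda>y. gp \<alpha> / ga \<alpha> \<theta> powr gd \<alpha> / Gamma (gd \<alpha> / gp \<alpha>) * y powr (gd \<alpha> - 1) *
                  exp (- ((y / ga \<alpha> \<theta>) powr gp \<alpha>)) * indicator {t1<..<t2} y))))"
proof -
  interpret M: weibull_renewal_model s \<tau> j0 \<gamma> m q c d \<alpha>0 \<alpha>1 \<pi>t D
    by (rule weibull_renewal_model.intro) (rule assms; assumption)+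
  have e: "(i, j) \<in> index_pairs s" using assms(14,15) by simp
  have log_concave: "log_concave (normalized lborel
       (alpha_kernel \<tau> j0 (m (i,j)) (q (i,j)) (c (i,j)) (d (i,j)) (\<alpha>0 (i,j)) (\<alpha>1 (i,j)) i j dat jn \<theta> t))"
    if "1 \<le> c (i,j)" "0 < \<theta>" "0 < t" "positive_times \<tau> dat" for dat jn \<theta> t
    using that assms(7,8,11)[OF e] by (intro log_concave_alpha_kernel) auto
  show ?thesis
    unfolding Let_def
    by (intro conjI allI impI ballI M.cond_law_row M.cond_law_theta M.cond_law_alpha
        M.cond_law_next_state[unfolded Let_def] M.cond_law_t assms(14) e log_concave)
      (assumption | simp)+
qed

end
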